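(* There is an absolute constant $C>0$ such that the following holds. Let $n$ be a positive integer, $r>0$ real, let $A\subseteq S_n$ be a non-empty $r$-global set, and let $d\ge 0$ be an integer with $d\le\min\left(\tfrac18\log(1/\mu(A)),\,10^{-5}n\right)$. Then $$\|1_A^{=d}\|_2^2\le \mu(A)^2\left(Cr^4d^{-1}\log(1/\mu(A))\right)^d ,$$ where for $d=0$ the right-hand side is read as $\mu(A)^2$.
   Context: $L^2(S_n)$ is the space of real functions on $S_n$ with the uniform probability measure $\mu$, $\langle f,g\rangle=\mathbb{E}_{\sigma\in S_n}[f(\sigma)g(\sigma)]$, and $\|f\|_p=(\mathbb{E}|f|^p)^{1/p}$. $\log$ is natural. Globalness: let $[n]_t$ be the set of $t$-tuples of distinct elements of $[n]$. For $I,J\in[n]_t$ let $U_{I\to J}=\{\sigma\in S_n:\sigma(I_s)=J_s \text{ for all } s\}$ and let $f_{I\to J}$ be the restriction of $f$ to $U_{I\to J}$, with norms taken with respect to the uniform probability measure on $U_{I\to J}$. $f$ is $(r,\gamma)$-global if $\|f_{I\to J}\|_2\le r^t\gamma$ for every $t$ and all $I,J\in[n]_t$; it is $r$-global if it is $(r,\|f\|_2)$-global. A set $A\subseteq S_n$ is $r$-global if its indicator function $1_A$ is. Degree decomposition: let $x_{i\to j}(\sigma)=1$ if $\sigma(i)=j$ and $0$ otherwise. $V_{\le d}\le L^2(S_n)$ is the space of functions expressible as polynomials of degree at most $d$ in the $n^2$ functions $x_{i\to j}$ (with $V_{\le -1}=0$). $f^{\le d}$ is the orthogonal projection of $f$ on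 $V_{\le d}$, and $f^{=d}=f^{\le d}-f^{\le d-1}$. *)

theory Defs
  imports
    "HOL-Probability.Probability"
    "HOL-Combinatorics.Permutations"
    "HOL-Library.Poly_Mapping"
begin

definition Sym :: "nat \<Rightarrow> (nat \<Rightarrow> nat) set" where
  "Sym n = {\<sigma>. \<sigma> permutes {1..n}}"

text \<open>Expectations, norms and inner products over a finite non-empty set \<open>U\<close> of permutations are
  taken with respect to the uniform probability measure on \<open>U\<close>; they only depend on the values
  of the functions on \<open>U\<close>, so that no explicit restriction to \<open>U\<close> is needed.\<close>

definition Expect :: "(nat \<Rightarrow> nat) set \<Rightarrow> ((nat \<Rightarrow> nat) \<Rightarrow> real) \<Rightarrow> real" where
  "Expect U f = measure_pmf.expectation (pmf_of_set U) f"

definition Lnorm :: "real \<Rightarrow> (nat \<Rightarrow> nat) set \<Rightarrow> ((nat \<Rightarrow> nat) \<Rightarrow> real) \<Rightarrow> real" where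
  "Lnorm p U f = Expect U (\<lambda>\<sigma>. \<bar>f \<sigma>\<bar> powr p) powr (1 / p)"

definition ip :: "nat \<Rightarrow> ((nat \<Rightarrow> nat) \<Rightarrow> real) \<Rightarrow> ((nat \<Rightarrow> nat) \<Rightarrow> real) \<Rightarrow> real" where
  "ip n f g = Expect (Sym n) (\<lambda>\<sigma>. f \<sigma> * g \<sigma>)"

definition mu :: "nat \<Rightarrow> (nat \<Rightarrow> nat) set \<Rightarrow> real" where
  "mu n A = measure_pmf.prob (pmf_of_set (Sym n)) A"

definition tuples :: "nat \<Rightarrow> nat \<Rightarrow> nat list set" where
  "tuples n t = {I. length I = t \<and> distinct I \<and> set I \<subseteq> {1..n}}"

definition umvirate :: "nat \<Rightarrow> nat list \<Rightarrow> nat list \<Rightarrow> (nat \<Rightarrow> nat) set" where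
  "umvirate n I J = {\<sigma> \<in> Sym n. \<forall>s < length I. \<sigma> (I ! s) = J ! s}"

definition global_with :: "nat \<Rightarrow> real \<Rightarrow> real \<Rightarrow> ((nat \<Rightarrow> nat) \<Rightarrow> real) \<Rightarrow> bool" where
  "global_with n r \<gamma> f \<longleftrightarrow>
     (\<forall>t. \<forall>I \<in> tuples n t. \<forall>J \<in> tuples n t. Lnorm 2 (umvirate n I J) f \<le> r ^ t * \<gamma>)"

definition global_fun :: "nat \<Rightarrow> real \<Rightarrow> ((nat \<Rightarrow> nat) \<Rightarrow> real) \<Rightarrow> bool" where
  "global_fun n r f \<longleftrightarrow> global_with n r (Lnorm 2 (Sym n) f) f"

definition global_set :: "nat \<Rightarrow> real \<Rightarrow> (nat \<Rightarrow> nat) set \<Rightarrow> bool" where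
  "global_set n r A \<longleftrightarrow> global_fun n r (indicator A)"

text \<open>A function on \<open>Sym n\<close> is represented by its extension by zero to the whole type, so that
  two elements of \<open>L2 n\<close> that agree on \<open>Sym n\<close> are equal.\<close>

definition L2 :: "nat \<Rightarrow> ((nat \<Rightarrow> nat) \<Rightarrow> real) set" where
  "L2 n = {f. \<forall>\<sigma>. \<sigma> \<notin> Sym n \<longrightarrow> f \<sigma> = 0}"

definition coord :: "nat \<Rightarrow> nat \<Rightarrow> (nat \<Rightarrow> nat) \<Rightarrow> real" where
  "coord i j \<sigma> = (if \<sigma> i = j then 1 else 0)"

text \<open>A real polynomial in variables from \<open>'v\<close> is a finitely supported map from monomials to
  coefficients, a monomial being a finitely supported map from variables to exponents.\<close>

definition monom_degree :: "('v \<Rightarrow>\<^sub>0 nat) \<Rightarrow> nat" where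
  "monom_degree m = (\<Sum>v \<in> Poly_Mapping.keys m. Poly_Mapping.lookup m v)"

definition monom_eval :: "('v \<Rightarrow>\<^sub>0 nat) \<Rightarrow> ('v \<Rightarrow> real) \<Rightarrow> real" where
  "monom_eval m a = (\<Prod>v \<in> Poly_Mapping.keys m. a v ^ Poly_Mapping.lookup m v)"

definition mpoly_eval :: "(('v \<Rightarrow>\<^sub>0 nat) \<Rightarrow>\<^sub>0 real) \<Rightarrow> ('v \<Rightarrow> real) \<Rightarrow> real" where
  "mpoly_eval P a = (\<Sum>m \<in> Poly_Mapping.keys P. Poly_Mapping.lookup P m * monom_eval m a)"

text \<open>The degree bound is an integer: \<open>V_le n (-1)\<close> only admits the zero polynomial, hence is
  the zero space.\<close>

definition V_le :: "nat \<Rightarrow> int \<Rightarrow> ((nat \<Rightarrow> nat) \<Rightarrow> real) set" where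
  "V_le n d = {f \<in> L2 n. \<exists>P :: ((nat \<times> nat) \<Rightarrow>\<^sub>0 nat) \<Rightarrow>\<^sub>0 real.
      (\<forall>m \<in> Poly_Mapping.keys P.
         Poly_Mapping.keys m \<subseteq> {1..n} \<times> {1..n} \<and> int (monom_degree m) \<le> d) \<and>
      (\<forall>\<sigma> \<in> Sym n. f \<sigma> = mpoly_eval P (\<lambda>(i, j). coord i j \<sigma>))}"

definition proj_le :: "nat \<Rightarrow> int \<Rightarrow> ((nat \<Rightarrow> nat) \<Rightarrow> real) \<Rightarrow> (nat \<Rightarrow> nat) \<Rightarrow> real" where
  "proj_le n d f =
     (THE g. g \<in> V_le n d \<and> (\<forall>h \<in> V_le n d. ip n (\<lambda>\<sigma>. f \<sigma> - g \<sigma>) h = 0))"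

definition level :: "nat \<Rightarrow> int \<Rightarrow> ((nat \<Rightarrow> nat) \<Rightarrow> real) \<Rightarrow> (nat \<Rightarrow> nat) \<Rightarrow> real" where
  "level n d f = (\<lambda>\<sigma>. proj_le n d f \<sigma> - proj_le n (d - 1) f \<sigma>)"

end

(*
Let f be the indicator of A and R = r^2. Globalness says that the average of f over the permutations
with t prescribed values is at most R^t mu(A), and this is the only property of A that is used.

Lower bound by alternating coefficients. Let P be a set of m = n/4 disjoint pairs {l, l+m}. For a
d-set D of pairs let w_D be the conditional expectation, given the values at the first points of D,
of the alternating average of f over the 2^d products of transpositions from D. Alternation kills
degree < d and the conditioning kills degree > d, so w_D only sees g = f^{=d}. Averaging over all
relabellings of the points, the sum of |w_D|^2 over D is at least c^d |g|^2. This rests on two positivity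
facts for functions orthogonal to degree < d, both consequences of one inclusion-exclusion identity: the
alternating average does not lose more than a factor 2^d, and the operator A = sum of E[. | sigma(I)]
over all d-sets I satisfies A^2 >= A, whence A >= 1 on pure degree d.

Upper bound by induction on d. The function G = sum of psi_D, where psi_D is the alternating sum of
w_D over the swaps of D, satisfies <f, G> = 2^d sum |w_D|^2, and along the swaps it is a homogeneous
Rademacher chaos. Hoelder with exponent 2k, where 2k is about log(1/mu(A))/d, and Bonami's inequality reduce
the problem to the k-th moment of the non-negative statistic Y = sum psi_D^2. Integrating one factor
at a time, that moment is controlled by the conditional expectations of Y given few pairs U: the terms with
D disjoint from U reproduce the quantity to be bounded, and a term meeting U in a j-set reduces to the same
quantity for degree d - j and f restricted by j values, which costs R^j.
*)

theory Submission imports Defs begin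

section \<open>Conditional expectations on the symmetric group\<close>

text \<open>The values of a random permutation at different points are dependent, so
  hypercontractivity on product spaces does not apply directly. Disjoint transpositions restore it:
  their products form a group (Z/2)^m acting by right multiplication, every orbit is a cube, and
  Bonami's inequality is used orbit by orbit. The choice 4m \<le> n keeps a quarter of the values
  free however many pairs are conditioned upon, so that dependence costs only a factor 4 per point
  (\<open>CE_density\<close>). The quantity to be bounded reappears on the right-hand side of its
  own estimate, as the contribution of the sets disjoint from \<open>U\<close>; the induction step
  therefore ends in a self-bounding inequality of the form Q^2 \<le> a(Q + b) rather than in a
  direct estimate. The factor r^4 = R^2 per degree enters because squared averages are
  compared.\<close>

lemma finite_subset_interval: "S \<subseteq> {a..b :: nat} \<Longrightarrow> finite S"
  by (rule finite_subset) auto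

lemma Sym_comp: "s \<in> Sym n \<Longrightarrow> t \<in> Sym n \<Longrightarrow> s \<circ> t \<in> Sym n"
  by (simp add: Sym_def permutes_compose)

lemma Sym_inv: "s \<in> Sym n \<Longrightarrow> inv s \<in> Sym n"
  by (simp add: Sym_def permutes_inv)

lemma Sym_id: "id \<in> Sym n" by (simp add: Sym_def)

lemma Sym_inv_app [simp]:
  assumes "s \<in> Sym n" shows "inv s (s x) = x" "s (inv s x) = x"
  using assms by (auto simp: Sym_def permutes_inverses)

lemma Sym_inv_comp [simp]:
  assumes "s \<in> Sym n" shows "inv s \<circ> s = id" "s \<circ> inv s = id" "inv (inv s) = s"
  using assms by (auto simp: Sym_def permutes_inv_o permutes_inv_inv)

lemma Sym_inj: "s \<in> Sym n \<Longrightarrow> inj s"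
  by (simp add: Sym_def permutes_inj)

lemma Sym_image_subset: "s \<in> Sym n \<Longrightarrow> S \<subseteq> {1..n} \<Longrightarrow> s ` S \<subseteq> {1..n}"
  by (auto simp: Sym_def permutes_in_image) (metis atLeastAtMost_iff in_mono permutes_in_image)+

lemma Sym_card_image: "s \<in> Sym n \<Longrightarrow> card (s ` S) = card S"
  by (meson Sym_inj card_image inj_on_subset subset_UNIV)

lemma finite_Sym [simp]: "finite (Sym n)"
  by (simp add: Sym_def finite_permutations)

lemma card_Sym: "card (Sym n) = fact n"
  by (simp add: Sym_def card_permutations)

lemma sum_Sym_right: "t \<in> Sym n \<Longrightarrow> (\<Sum>s\<in>Sym n. F (s \<circ> t)) = (\<Sum>s\<in>Sym n. (F s :: real))"
  unfolding Sym_def by (simp add: sum_permutations_compose_right[symmetric])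

lemma sum_Sym_inv: "(\<Sum>s\<in>Sym n. F (inv s)) = (\<Sum>s\<in>Sym n. (F s :: real))"
  unfolding Sym_def by (rule sum_permutations_inverse[symmetric])

definition cls :: "nat \<Rightarrow> nat set \<Rightarrow> (nat \<Rightarrow> nat) \<Rightarrow> (nat \<Rightarrow> nat) set" where
  "cls n S s = {r \<in> Sym n. \<forall>i\<in>S. r i = s i}"

text \<open>The denominator is the size of the class only for \<open>S \<subseteq> {1..n}\<close> and \<open>s \<in> Sym n\<close>.\<close>

definition CE :: "nat \<Rightarrow> nat set \<Rightarrow> ((nat \<Rightarrow> nat) \<Rightarrow> real) \<Rightarrow> (nat \<Rightarrow> nat) \<Rightarrow> real" where
  "CE n S F s = (\<Sum>r\<in>cls n S s. F r) / fact (n - card S)"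

definition dep :: "nat \<Rightarrow> nat set \<Rightarrow> ((nat \<Rightarrow> nat) \<Rightarrow> real) \<Rightarrow> bool" where
  "dep n S h \<longleftrightarrow> (\<forall>s\<in>Sym n. \<forall>r\<in>Sym n. (\<forall>i\<in>S. r i = s i) \<longrightarrow> h r = h s)"

lemma finite_cls [simp]: "finite (cls n S s)"
  by (simp add: cls_def)

lemma cls_subset: "r \<in> cls n S s \<Longrightarrow> r \<in> Sym n" by (simp add: cls_def)

lemma cls_self: "s \<in> Sym n \<Longrightarrow> s \<in> cls n S s" by (simp add: cls_def)

lemma cls_eq: "r \<in> cls n S s \<Longrightarrow> cls n S r = cls n S s" by (auto simp: cls_def)

lemma cls_sym: "r \<in> Sym n \<Longrightarrow> s \<in> Sym n \<Longrightarrow> r \<in> cls n S s \<longleftrightarrow> s \<in> cls n S r"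
  by (auto simp: cls_def)

lemma card_cls:
  assumes S: "S \<subseteq> {1..n}" and s: "s \<in> Sym n"
  shows "card (cls n S s) = fact (n - card S)"
proof -
  have "bij_betw (\<lambda>k. s \<circ> k) {k. k permutes ({1..n} - S)} (cls n S s)"
  proof (rule bij_betw_byWitness[where f' = "\<lambda>r. inv s \<circ> r"])
    show "\<forall>a\<in>{k. k permutes {1..n} - S}. inv s \<circ> (s \<circ> a) = a"
      using s by (auto simp: fun_eq_iff)
    show "\<forall>a'\<in>cls n S s. s \<circ> (inv s \<circ> a') = a'"
      using s by (auto simp: fun_eq_iff)
    show "(\<lambda>k. s \<circ> k) ` {k. k permutes {1..n} - S} \<subseteq> cls n S s"
    proof
      fix r assume "r \<in> (\<lambda>k. s \<circ> k) ` {k. k permutes {1..n} - S}"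
      then obtain k where k: "k permutes {1..n} - S" and r: "r = s \<circ> k" by auto
      from k have "k permutes {1..n}" by (rule permutes_subset) auto
      then have "r \<in> Sym n" using s r by (simp add: Sym_def permutes_compose)
      moreover have "r i = s i" if "i \<in> S" for i
        using k r that by (simp add: permutes_not_in)
      ultimately show "r \<in> cls n S s" by (simp add: cls_def)
    qed
    show "(\<lambda>r. inv s \<circ> r) ` cls n S s \<subseteq> {k. k permutes {1..n} - S}"
    proof
      fix k assume "k \<in> (\<lambda>r. inv s \<circ> r) ` cls n S s"
      then obtain r where r: "r \<in> Sym n" "\<forall>i\<in>S. r i = s i" and k: "k = inv s \<circ> r"
        by (auto simp: cls_def)
      have p: "k permutes {1..n}"
        using Sym_comp[OF Sym_inv[OF s] r(1)] by (simp add: Sym_def k)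
      have "k permutes {1..n} - S"
      proof (rule permutes_superset[OF p])
        fix x assume "x \<in> {1..n} - ({1..n} - S)"
        then show "k x = x" using r s k by auto
      qed
      then show "k \<in> {k. k permutes {1..n} - S}" by simp
    qed
  qed
  then have "card (cls n S s) = card {k. k permutes ({1..n} - S)}"
    by (metis bij_betw_same_card)
  also have "\<dots> = fact (card ({1..n} - S))"
    by (rule card_permutations) auto
  also have "card ({1..n} - S) = n - card S"
    using S by (simp add: card_Diff_subset finite_subset)
  finally show ?thesis .
qed

lemma CE_empty: "CE n {} F s = (\<Sum>r\<in>Sym n. F r) / fact n"
  by (simp add: CE_def cls_def)

lemma CE_cong: "(\<And>r. r \<in> cls n S s \<Longrightarrow> F r = G r) \<Longrightarrow> CE n S F s = CE n S G s"
  by (simp add: CE_def)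

lemma CE_mono: "(\<And>r. r \<in> cls n S s \<Longrightarrow> F r \<le> G r) \<Longrightarrow> CE n S F s \<le> CE n S G s"
  unfolding CE_def by (intro divide_right_mono sum_mono) auto

lemma CE_nonneg: "(\<And>r. r \<in> cls n S s \<Longrightarrow> 0 \<le> F r) \<Longrightarrow> 0 \<le> CE n S F s"
  unfolding CE_def by (intro divide_nonneg_nonneg sum_nonneg) auto

lemma CE_sum: "CE n S (\<lambda>r. \<Sum>i\<in>I. F i r) s = (\<Sum>i\<in>I. CE n S (F i) s)"
  unfolding CE_def by (subst sum.swap) (simp add: sum_divide_distrib)

lemma CE_add: "CE n S (\<lambda>r. F r + G r) s = CE n S F s + CE n S G s"
  by (simp add: CE_def sum.distrib add_divide_distrib)

lemma CE_diff: "CE n S (\<lambda>r. F r - G r) s = CE n S F s - CE n S G s"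
  by (simp add: CE_def sum_subtractf diff_divide_distrib)

lemma CE_cmult: "CE n S (\<lambda>r. c * F r) s = c * CE n S F s"
  by (simp add: CE_def sum_distrib_left)

lemma CE_divide: "CE n S (\<lambda>r. F r / c) s = CE n S F s / c"
  by (simp add: CE_def sum_divide_distrib[symmetric])

lemma CE_const: "S \<subseteq> {1..n} \<Longrightarrow> s \<in> Sym n \<Longrightarrow> CE n S (\<lambda>r. c) s = c"
  by (simp add: CE_def card_cls)

lemma CE_dep: "dep n S (CE n S F)"
  unfolding dep_def CE_def cls_def by auto

lemma dep_mono: "dep n S h \<Longrightarrow> S \<subseteq> T \<Longrightarrow> dep n T h"
  unfolding dep_def by blast

lemma depD: "dep n S h \<Longrightarrow> s \<in> Sym n \<Longrightarrow> r \<in> Sym n \<Longrightarrow> (\<And>i. i \<in> S \<Longrightarrow> r i = s i) \<Longrightarrow> h r = h s"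
  unfolding dep_def by blast

lemma dep_cls: "dep n S h \<Longrightarrow> s \<in> Sym n \<Longrightarrow> r \<in> cls n S s \<Longrightarrow> h r = h s"
  unfolding dep_def cls_def by blast

lemma CE_pull:
  assumes "dep n S h" "s \<in> Sym n"
  shows "CE n S (\<lambda>r. h r * F r) s = h s * CE n S F s"
proof -
  have "CE n S (\<lambda>r. h r * F r) s = CE n S (\<lambda>r. h s * F r) s"
    by (rule CE_cong) (use dep_cls[OF assms] in auto)
  then show ?thesis by (simp add: CE_cmult)
qed

lemma CE_idem:
  assumes "S \<subseteq> {1..n}" "dep n S h" "s \<in> Sym n"
  shows "CE n S h s = h s"
  using CE_pull[OF assms(2,3), of "\<lambda>_. 1"] CE_const[OF assms(1,3), of 1] by simp

lemma sum_cls_CE: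
  assumes "S \<subseteq> T" "T \<subseteq> {1..n}" "s \<in> Sym n"
  shows "(\<Sum>r\<in>cls n S s. CE n T F r) = (\<Sum>r\<in>cls n S s. F r)"
proof -
  let ?C = "cls n S s"
  have sub: "cls n T r \<subseteq> ?C" if "r \<in> ?C" for r
    using that assms(1) by (auto simp: cls_def)
  have "(\<Sum>r\<in>?C. \<Sum>e\<in>cls n T r. F e) = (\<Sum>r\<in>?C. \<Sum>e\<in>?C. if e \<in> cls n T r then F e else 0)"
  proof (rule sum.cong[OF refl])
    fix r assume "r \<in> ?C"
    then show "(\<Sum>e\<in>cls n T r. F e) = (\<Sum>e\<in>?C. if e \<in> cls n T r then F e else 0)"
      using sub by (simp add: sum.If_cases Int_absorb1)
  qed
  also have "\<dots> = (\<Sum>e\<in>?C. \<Sum>r\<in>?C. if e \<in> cls n T r then F e else 0)"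
    by (rule sum.swap)
  also have "\<dots> = (\<Sum>e\<in>?C. \<Sum>r\<in>?C. if r \<in> cls n T e then F e else 0)"
    by (intro sum.cong refl if_cong) (auto simp: cls_def)
  also have "\<dots> = (\<Sum>e\<in>?C. fact (n - card T) * F e)"
  proof (rule sum.cong[OF refl])
    fix e assume e: "e \<in> ?C"
    then have "(\<Sum>r\<in>?C. if r \<in> cls n T e then F e else 0) = (\<Sum>r\<in>cls n T e. F e)"
      using sub by (simp add: sum.If_cases Int_absorb1)
    then show "(\<Sum>r\<in>?C. if r \<in> cls n T e then F e else 0) = fact (n - card T) * F e"
      using card_cls[OF assms(2) cls_subset[OF e]] by simp
  qed
  finally show ?thesis
    by (simp add: CE_def sum_divide_distrib[symmetric] sum_distrib_left[symmetric])
qed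

lemma CE_tower:
  assumes "S \<subseteq> T" "T \<subseteq> {1..n}" "s \<in> Sym n"
  shows "CE n S (CE n T F) s = CE n S F s"
  using sum_cls_CE[OF assms] by (simp add: CE_def)

lemma sum_Sym_CE:
  assumes "T \<subseteq> {1..n}"
  shows "(\<Sum>r\<in>Sym n. CE n T F r) = (\<Sum>r\<in>Sym n. F r)"
  using sum_cls_CE[of "{}" T n id F] assms by (simp add: cls_def Sym_id)

lemma sum_Sym_CE_pull:
  assumes "T \<subseteq> {1..n}" "dep n T h"
  shows "(\<Sum>r\<in>Sym n. h r * CE n T F r) = (\<Sum>r\<in>Sym n. h r * F r)"
proof -
  have "(\<Sum>r\<in>Sym n. h r * CE n T F r) = (\<Sum>r\<in>Sym n. CE n T (\<lambda>r. h r * F r) r)"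
    using assms by (intro sum.cong) (auto simp: CE_pull)
  then show ?thesis using sum_Sym_CE[OF assms(1)] by simp
qed

lemma bij_cls_right:
  assumes t: "t \<in> Sym n"
  shows "bij_betw (\<lambda>r. r \<circ> t) (cls n (t ` S) s) (cls n S (s \<circ> t))"
proof (rule bij_betw_byWitness[where f' = "\<lambda>r. r \<circ> inv t"])
  show "\<forall>a\<in>cls n (t ` S) s. a \<circ> t \<circ> inv t = a" using t by (auto simp: fun_eq_iff)
  show "\<forall>a'\<in>cls n S (s \<circ> t). a' \<circ> inv t \<circ> t = a'" using t by (auto simp: fun_eq_iff)
  show "(\<lambda>r. r \<circ> t) ` cls n (t ` S) s \<subseteq> cls n S (s \<circ> t)"
    using t by (auto simp: cls_def Sym_comp)
  show "(\<lambda>r. r \<circ> inv t) ` cls n S (s \<circ> t) \<subseteq> cls n (t ` S) s"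
    using t by (auto simp: cls_def Sym_comp Sym_inv)
qed

lemma CE_right:
  assumes t: "t \<in> Sym n"
  shows "CE n (t ` S) (\<lambda>r. F (r \<circ> t)) s = CE n S F (s \<circ> t)"
  using sum.reindex_bij_betw[OF bij_cls_right[OF t], of F S s] Sym_card_image[OF t, of S]
  by (simp add: CE_def)

lemma CE_right':
  assumes t: "t \<in> Sym n"
  shows "CE n S (\<lambda>r. F (r \<circ> inv t)) s = CE n (t ` S) F (s \<circ> inv t)"
proof -
  have "inv t ` (t ` S) = S" using t by (force simp: image_image)
  then show ?thesis using CE_right[OF Sym_inv[OF t], of "t ` S" F s] by simp
qed

text \<open>Here \<open>s\<close> is an arbitrary function: the prescribed values in
  \<open>CE_density\<close> are glued from two permutations and may clash, leaving the class
  empty.\<close>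

lemma card_cls_le:
  assumes "S \<subseteq> {1..n}"
  shows "card (cls n S s) \<le> fact (n - card S)"
proof (cases "cls n S s = {}")
  case False
  then obtain r where r: "r \<in> cls n S s" by auto
  show ?thesis using card_cls[OF assms cls_subset[OF r]] cls_eq[OF r] by simp
qed simp

text \<open>A substitute for independence. Given the values on \<open>V\<close>, those on
  \<open>Y\<close> are drawn from \<open>n - card V\<close> values instead of
  \<open>n - card X\<close>; as a quarter of all values stays free throughout, the probability of
  each pattern on \<open>Y\<close> grows by a factor of at most 4 per point.\<close>

lemma CE_density:
  assumes X: "X \<subseteq> V" and V: "V \<subseteq> {1..n}" and Y: "Y \<subseteq> {1..n}" and VY: "V \<inter> Y = {}"
    and h: "dep n (X \<union> Y) h" and pos: "\<And>r. r \<in> Sym n \<Longrightarrow> 0 \<le> h r" and s: "s \<in> Sym n"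
    and big: "n \<le> 4 * (n - card V - card Y)"
  shows "CE n V h s \<le> 4 ^ card Y * CE n X h s"
proof -
  have fin: "finite V" "finite Y" "finite X" using X V Y by (meson finite_subset_interval finite_subset)+
  have cXY: "card (X \<union> Y) = card X + card Y" using X VY fin by (intro card_Un_disjoint) auto
  have cVY: "card (V \<union> Y) = card V + card Y" using VY fin by (intro card_Un_disjoint) auto
  have cXV: "card X \<le> card V" using X fin by (simp add: card_mono)
  have VYn: "card V + card Y \<le> n"
    using card_mono[of "{1..n}" "V \<union> Y"] V Y cVY by simp
  let ?a = "n - card X - card Y" and ?b = "n - card V - card Y"
  have ea: "n - card X = ?a + card Y" "n - card V = ?b + card Y" using VYn cXV by auto
  have "(\<Sum>r1\<in>cls n V s. h r1) * fact ?a = (\<Sum>r1\<in>cls n V s. \<Sum>r\<in>cls n (X \<union> Y) r1. h r)"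
  proof -
    have "(\<Sum>r\<in>cls n (X \<union> Y) r1. h r) = h r1 * fact ?a" if r1: "r1 \<in> cls n V s" for r1
    proof -
      have "(\<Sum>r\<in>cls n (X \<union> Y) r1. h r) = (\<Sum>r\<in>cls n (X \<union> Y) r1. h r1)"
        by (intro sum.cong refl dep_cls[OF h] cls_subset[OF r1])
      also have "\<dots> = h r1 * fact ?a"
        using card_cls[of "X \<union> Y" n r1] X V Y cls_subset[OF r1] cXY by simp
      finally show ?thesis .
    qed
    then show ?thesis by (simp add: sum_distrib_right)
  qed
  \<comment> \<open>Double counting of the pairs \<open>r1\<close>, \<open>r\<close> that agree on
    \<open>X \<union> Y\<close>: for fixed \<open>r\<close>, such an \<open>r1\<close> is prescribed
    by \<open>s\<close> on \<open>V\<close> and by \<open>r\<close> on \<open>Y\<close>.\<close>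
  also have "\<dots> = (\<Sum>r1\<in>cls n V s. \<Sum>r\<in>cls n X s. if r1 \<in> cls n (V \<union> Y) (\<lambda>i. if i \<in> V then s i else r i) then h r else 0)"
  proof (rule sum.cong[OF refl])
    fix r1 assume r1: "r1 \<in> cls n V s"
    have "cls n (X \<union> Y) r1 = {r \<in> cls n X s. r1 \<in> cls n (V \<union> Y) (\<lambda>i. if i \<in> V then s i else r i)}"
      using r1 X VY by (auto simp: cls_def subset_iff)
    then show "(\<Sum>r\<in>cls n (X \<union> Y) r1. h r) = (\<Sum>r\<in>cls n X s. if r1 \<in> cls n (V \<union> Y) (\<lambda>i. if i \<in> V then s i else r i) then h r else 0)"
      by (simp add: sum.If_cases Int_def)
  qed
  also have "\<dots> = (\<Sum>r\<in>cls n X s. \<Sum>r1\<in>cls n V s. if r1 \<in> cls n (V \<union> Y) (\<lambda>i. if i \<in> V then s i else r i) then h r else 0)"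
    by (rule sum.swap)
  also have "\<dots> \<le> (\<Sum>r\<in>cls n X s. h r * fact ?b)"
  proof (rule sum_mono)
    fix r assume r: "r \<in> cls n X s"
    let ?c = "cls n (V \<union> Y) (\<lambda>i. if i \<in> V then s i else r i)"
    have "(\<Sum>r1\<in>cls n V s. if r1 \<in> ?c then h r else 0) = h r * card (cls n V s \<inter> ?c)"
      by (simp add: sum.If_cases Int_def)
    also have "\<dots> \<le> h r * card ?c"
      using pos[OF cls_subset[OF r]] by (intro mult_left_mono) (auto intro: card_mono)
    also have "\<dots> \<le> h r * fact ?b"
    proof (rule mult_left_mono[OF _ pos[OF cls_subset[OF r]]])
      have "card ?c \<le> fact ?b"
        using card_cls_le[of "V \<union> Y" n "\<lambda>i. if i \<in> V then s i else r i"] V Y cVY by simp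
      then show "real (card ?c) \<le> fact ?b"
        by (metis of_nat_fact of_nat_le_iff)
    qed
    finally show "(\<Sum>r1\<in>cls n V s. if r1 \<in> ?c then h r else 0) \<le> h r * fact ?b" .
  qed
  finally have 1: "(\<Sum>r1\<in>cls n V s. h r1) * fact ?a \<le> (\<Sum>r\<in>cls n X s. h r) * fact ?b"
    by (simp add: sum_distrib_right)
  \<comment> \<open>Two products of \<open>y\<close> consecutive integers are compared factor by
    factor: \<open>a + i \<le> 4 * b \<le> 4 * (b + i)\<close> for \<open>i \<le> y\<close>.\<close>
  have fr: "fact (a + y) * fact b \<le> (4 ^ y * fact (b + y) * fact a :: real)" if "a + y \<le> 4 * b" for a b y :: nat
    using that
  proof (induction y)
    case (Suc y)
    have IH: "fact (a + y) * fact b \<le> (4 ^ y * fact (b + y) * fact a :: real)"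
      using Suc by simp
    have "a + Suc y \<le> 4 * (b + Suc y)" using Suc.prems by simp
    then have c: "real (a + Suc y) \<le> real (4 * (b + Suc y))" by (simp only: of_nat_le_iff)
    have "fact (a + Suc y) * fact b = real (a + Suc y) * (fact (a + y) * fact b)" by simp
    also have "\<dots> \<le> real (4 * (b + Suc y)) * (4 ^ y * fact (b + y) * fact a)"
      by (rule mult_mono[OF c IH]) auto
    finally show ?case by (simp add: algebra_simps)
  qed simp
  have 2: "fact (n - card X) * fact ?b \<le> (4 ^ card Y * fact (n - card V) * fact ?a :: real)"
    using fr[of ?a "card Y" ?b] big ea[symmetric] by simp
  have p0: "0 \<le> (\<Sum>r\<in>cls n X s. h r)" using pos cls_subset by (meson sum_nonneg)
  have "(\<Sum>r1\<in>cls n V s. h r1) * fact ?a * fact (n - card X) \<le> (\<Sum>r\<in>cls n X s. h r) * (fact ?b * fact (n - card X))"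
    using mult_right_mono[OF 1, of "fact (n - card X)"] by (simp add: mult_ac)
  also have "\<dots> \<le> (\<Sum>r\<in>cls n X s. h r) * (4 ^ card Y * fact (n - card V) * fact ?a)"
    using 2 by (intro mult_left_mono[OF _ p0]) (simp add: mult_ac)
  finally have "(\<Sum>r1\<in>cls n V s. h r1) * fact (n - card X) \<le> (\<Sum>r\<in>cls n X s. h r) * (4 ^ card Y * fact (n - card V))"
    using mult_le_cancel_right_pos[of "fact ?a :: real"] by (simp add: mult_ac)
  then show ?thesis unfolding CE_def by (simp add: field_simps)
qed

section \<open>Alternating averages over disjoint transpositions\<close>

text \<open>For \<open>B \<subseteq> {1..m}\<close> this is the product of the disjoint
  transpositions of \<open>x\<close> and \<open>x + m\<close> over \<open>x \<in> B\<close>. A pair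
  is named by its smaller point, so a set of pairs is a subset of \<open>{1..m}\<close>.\<close>

definition sw :: "nat \<Rightarrow> nat set \<Rightarrow> nat \<Rightarrow> nat" where
  "sw m B x = (if x \<in> B then x + m else if m < x \<and> x - m \<in> B then x - m else x)"

definition pts :: "nat \<Rightarrow> nat set \<Rightarrow> nat set" where
  "pts m B = B \<union> (\<lambda>x. x + m) ` B"

abbreviation sdiff :: "'a set \<Rightarrow> 'a set \<Rightarrow> 'a set" where
  "sdiff A B \<equiv> (A - B) \<union> (B - A)"

definition sg :: "'a set \<Rightarrow> real" where
  "sg B = (-1) ^ card B"

lemma sg_empty [simp]: "sg {} = 1" by (simp add: sg_def)

lemma sg_sg [simp]: "sg B * sg B = 1" by (simp add: sg_def flip: power_mult_distrib)

text \<open>The sign is a character of the group of finite sets under symmetric difference, since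
  \<open>card\<close> is additive there modulo 2.\<close>

lemma sg_sdiff:
  assumes "finite A" "finite B" shows "sg (sdiff A B) = sg A * sg B"
proof -
  have "card (sdiff A B) = card (A - B) + card (B - A)"
    using assms by (intro card_Un_disjoint) auto
  moreover have "card A = card (A - B) + card (A \<inter> B)"
    using assms by (subst card_Un_disjoint[symmetric]) (auto intro: arg_cong[of _ _ card])
  moreover have "card B = card (B - A) + card (A \<inter> B)"
    using assms by (subst card_Un_disjoint[symmetric]) (auto intro: arg_cong[of _ _ card])
  ultimately have "card A + card B = card (sdiff A B) + 2 * card (A \<inter> B)" by simp
  then have "(-1 :: real) ^ (card A + card B) = (-1) ^ (card (sdiff A B) + 2 * card (A \<inter> B))" by simp
  then show ?thesis by (simp add: sg_def power_add power_mult)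
qed

lemma sg_Un: "finite A \<Longrightarrow> finite B \<Longrightarrow> A \<inter> B = {} \<Longrightarrow> sg (A \<union> B) = sg A * sg B"
  by (simp add: sg_def card_Un_disjoint power_add)

lemma sum_Pow_sdiff:
  assumes "A \<subseteq> D"
  shows "(\<Sum>C\<in>Pow D. F (sdiff A C)) = (\<Sum>C\<in>Pow D. F C)"
  by (rule sum.reindex_bij_witness[where i = "\<lambda>C. sdiff A C" and j = "\<lambda>C. sdiff A C"])
     (use assms in \<open>auto intro!: arg_cong[of _ _ F]\<close>)

lemma sum_Pow_Un:
  assumes "A \<inter> B = {}"
  shows "(\<Sum>C\<in>Pow (A \<union> B). F C) = (\<Sum>X\<in>Pow A. \<Sum>Y\<in>Pow B. F (X \<union> Y))"
proof -
  have "(\<Sum>X\<in>Pow A. \<Sum>Y\<in>Pow B. F (X \<union> Y)) = (\<Sum>(X,Y)\<in>Pow A \<times> Pow B. F (X \<union> Y))"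
    by (rule sum.cartesian_product)
  also have "\<dots> = (\<Sum>C\<in>Pow (A \<union> B). F C)"
    by (rule sum.reindex_bij_witness[where i = "\<lambda>C. (C \<inter> A, C \<inter> B)" and j = "\<lambda>(X,Y). X \<union> Y"])
       (use assms in \<open>auto intro!: arg_cong[of _ _ F]\<close>)
  finally show ?thesis by simp
qed

lemma sw_empty [simp]: "sw m {} = id" by (auto simp: sw_def fun_eq_iff)

text \<open>The swaps commute and form an elementary abelian 2-group; the signed sums over
  \<open>Pow D\<close> are Fourier sums on it.\<close>

lemma sw_sw:
  assumes "B \<subseteq> {1..m}" "C \<subseteq> {1..m}"
  shows "sw m B \<circ> sw m C = sw m (sdiff B C)"
proof
  fix x
  show "(sw m B \<circ> sw m C) x = sw m (sdiff B C) x"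
    using subsetD[OF assms(1), of x] subsetD[OF assms(2), of x]
      subsetD[OF assms(1), of "x + m"] subsetD[OF assms(2), of "x + m"]
      subsetD[OF assms(1), of "x - m"] subsetD[OF assms(2), of "x - m"]
      subsetD[OF assms(1), of "x - m - m"] subsetD[OF assms(2), of "x - m - m"]
    by (cases "x \<in> B"; cases "x \<in> C"; cases "m < x"; cases "x - m \<in> B"; cases "x - m \<in> C")
       (auto simp: sw_def)
qed

lemma sw_invol [simp]: "B \<subseteq> {1..m} \<Longrightarrow> sw m B \<circ> sw m B = id"
  by (simp add: sw_sw)

lemma sw_fix: "x \<notin> pts m B \<Longrightarrow> sw m B x = x"
  by (auto simp: sw_def pts_def image_iff)

lemma pts_subset: "B \<subseteq> {1..m} \<Longrightarrow> 2 * m \<le> n \<Longrightarrow> pts m B \<subseteq> {1..n}"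
  by (fastforce simp: pts_def)

lemma sw_Sym:
  assumes "B \<subseteq> {1..m}" "2 * m \<le> n"
  shows "sw m B \<in> Sym n"
proof -
  have "bij (sw m B)" using sw_invol[OF assms(1)] by (rule o_bij[of _ _]) (rule sw_invol[OF assms(1)])
  moreover have "sw m B x = x" if "x \<notin> {1..n}" for x
    by (rule sw_fix) (use pts_subset[OF assms] that in auto)
  ultimately show ?thesis unfolding Sym_def mem_Collect_eq permutes_def
    by (metis bij_pointE)
qed

lemma sw_inv: "B \<subseteq> {1..m} \<Longrightarrow> inv (sw m B) = sw m B"
  by (rule inv_unique_comp) auto

lemma sw_pts: 
  assumes "B \<subseteq> U" "U \<subseteq> {1..m}" shows "sw m B ` pts m U = pts m U"
proof -
  have 1: "sw m B x \<in> pts m U" if "x \<in> pts m U" for x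
    using that assms by (fastforce simp: sw_def pts_def)
  have "x \<in> sw m B ` pts m U" if "x \<in> pts m U" for x
  proof -
    have "sw m B (sw m B x) = x" using sw_invol[of B m] assms by (metis comp_apply id_apply order_trans)
    then show ?thesis using 1[OF that] by (metis image_eqI)
  qed
  then show ?thesis using 1 by auto
qed

lemma sw_image_fix:
  assumes "S \<inter> pts m B = {}" shows "sw m B ` S = S"
proof -
  have "sw m B x = x" if "x \<in> S" for x by (rule sw_fix) (use assms that in auto)
  then show ?thesis by force
qed

lemma pts_mono: "B \<subseteq> C \<Longrightarrow> pts m B \<subseteq> pts m C" by (auto simp: pts_def)

lemma pts_Un: "pts m (B \<union> C) = pts m B \<union> pts m C" by (auto simp: pts_def)

lemma pts_disjoint: "B \<subseteq> {1..m} \<Longrightarrow> C \<subseteq> {1..m} \<Longrightarrow> B \<inter> C = {} \<Longrightarrow> pts m B \<inter> pts m C = {}"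
  by (fastforce simp: pts_def)

lemma card_pts: "finite B \<Longrightarrow> card (pts m B) \<le> 2 * card B"
  using card_Un_le[of B "(\<lambda>x. x + m) ` B"] card_image_le[of B "\<lambda>x. x + m"] by (simp add: pts_def)

text \<open>The function \<open>psi\<close> is odd under each swap in \<open>D\<close>, so that along the swaps a sum of such
  functions is a Rademacher chaos; its pairing with \<open>f\<close> is a multiple of the squared norm of \<open>wcoef\<close>.\<close>

definition Del :: "nat \<Rightarrow> nat set \<Rightarrow> ((nat \<Rightarrow> nat) \<Rightarrow> real) \<Rightarrow> (nat \<Rightarrow> nat) \<Rightarrow> real" where
  "Del m D F s = (\<Sum>B\<in>Pow D. sg B * F (s \<circ> sw m B)) / 2 ^ card D"

text \<open>The set \<open>S\<close> collects the points whose values have been prescribed at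
  earlier stages of the induction. Of each pair in \<open>D\<close> only the first point is
  conditioned upon; the second one is averaged out.\<close>

definition wcoef :: "nat \<Rightarrow> nat \<Rightarrow> nat set \<Rightarrow> nat set \<Rightarrow> ((nat \<Rightarrow> nat) \<Rightarrow> real) \<Rightarrow> (nat \<Rightarrow> nat) \<Rightarrow> real" where
  "wcoef n m S D f = CE n (S \<union> D) (Del m D f)"

definition psi :: "nat \<Rightarrow> nat \<Rightarrow> nat set \<Rightarrow> nat set \<Rightarrow> ((nat \<Rightarrow> nat) \<Rightarrow> real) \<Rightarrow> (nat \<Rightarrow> nat) \<Rightarrow> real" where
  "psi n m S D f s = (\<Sum>C\<in>Pow D. sg C * wcoef n m S D f (s \<circ> sw m C))"

lemma wcoef_dep: "dep n (S \<union> D) (wcoef n m S D f)"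
  unfolding wcoef_def by (rule CE_dep)

lemma CE_sw:
  assumes "B \<subseteq> {1..m}" "2 * m \<le> n" "S \<inter> pts m B = {}" "s \<in> Sym n"
  shows "CE n S (\<lambda>r. F (r \<circ> sw m B)) s = CE n S F s"
proof -
  have t: "sw m B \<in> Sym n" by (rule sw_Sym[OF assms(1,2)])
  have "CE n (sw m B ` S) (\<lambda>r. F (r \<circ> sw m B)) s = CE n S F (s \<circ> sw m B)"
    by (rule CE_right[OF t])
  also have "\<dots> = CE n S F s"
  proof (rule depD[OF CE_dep assms(4) Sym_comp[OF assms(4) t]])
    fix i assume "i \<in> S"
    then have "sw m B i = i" using assms(3) by (intro sw_fix) auto
    then show "(s \<circ> sw m B) i = s i" by simp
  qed
  finally show ?thesis using sw_image_fix[OF assms(3)] by simp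
qed

text \<open>Each swap is an involution that preserves \<open>CE n S\<close>, so it can be moved from
  \<open>wcoef\<close> to \<open>f\<close>. The signed sum then rebuilds \<open>Del m D f\<close>,
  whose projection onto the functions of the values on \<open>S \<union> D\<close> is
  \<open>wcoef\<close> itself.\<close>

lemma CE_f_psi:
  assumes D: "D \<subseteq> {1..m}" and m: "2 * m \<le> n" and S: "S \<subseteq> {1..n}" and SD: "S \<inter> pts m D = {}"
    and s: "s \<in> Sym n"
  shows "CE n S (\<lambda>r. f r * psi n m S D f r) s = 2 ^ card D * CE n S (\<lambda>r. (wcoef n m S D f r)\<^sup>2) s"
proof -
  let ?w = "wcoef n m S D f"
  have Dn: "D \<subseteq> {1..n}" using D m by force
  have one: "CE n S (\<lambda>r. f r * ?w (r \<circ> sw m C)) s = CE n S (\<lambda>r. f (r \<circ> sw m C) * ?w r) s" if C: "C \<subseteq> D" for C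
  proof -
    have C1: "C \<subseteq> {1..m}" using C D by auto
    have "CE n S (\<lambda>r. f r * ?w (r \<circ> sw m C)) s
       = CE n S (\<lambda>r. (\<lambda>q. f (q \<circ> sw m C) * ?w q) (r \<circ> sw m C)) s"
      using sw_invol[OF C1] by (simp add: comp_assoc)
    also have "\<dots> = CE n S (\<lambda>q. f (q \<circ> sw m C) * ?w q) s"
      by (rule CE_sw[OF C1 m _ s]) (use SD pts_mono[OF C, of m] in auto)
    finally show ?thesis .
  qed
  have "CE n S (\<lambda>r. f r * psi n m S D f r) s = CE n S (\<lambda>r. \<Sum>C\<in>Pow D. sg C * (f r * ?w (r \<circ> sw m C))) s"
    by (simp add: psi_def sum_distrib_left mult_ac)
  also have "\<dots> = (\<Sum>C\<in>Pow D. sg C * CE n S (\<lambda>r. f r * ?w (r \<circ> sw m C)) s)"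
    by (simp add: CE_sum CE_cmult)
  also have "\<dots> = (\<Sum>C\<in>Pow D. sg C * CE n S (\<lambda>r. f (r \<circ> sw m C) * ?w r) s)"
    by (intro sum.cong refl) (simp add: one)
  also have "\<dots> = CE n S (\<lambda>r. \<Sum>C\<in>Pow D. sg C * (f (r \<circ> sw m C) * ?w r)) s"
    by (simp add: CE_sum CE_cmult)
  also have "\<dots> = CE n S (\<lambda>r. 2 ^ card D * (?w r * Del m D f r)) s"
  proof (rule CE_cong)
    fix r
    have "2 ^ card D * Del m D f r = (\<Sum>C\<in>Pow D. sg C * f (r \<circ> sw m C))"
      by (simp add: Del_def)
    then have "2 ^ card D * (?w r * Del m D f r) = (\<Sum>C\<in>Pow D. sg C * f (r \<circ> sw m C)) * ?w r"
      by (simp add: mult_ac)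
    then show "(\<Sum>C\<in>Pow D. sg C * (f (r \<circ> sw m C) * ?w r)) = 2 ^ card D * (?w r * Del m D f r)"
      by (simp add: sum_distrib_right mult.assoc)
  qed
  also have "\<dots> = 2 ^ card D * CE n S (\<lambda>r. ?w r * Del m D f r) s"
    by (rule CE_cmult)
  also have "CE n S (\<lambda>r. ?w r * Del m D f r) s = CE n S (CE n (S \<union> D) (\<lambda>r. ?w r * Del m D f r)) s"
    by (rule CE_tower[symmetric]) (use S Dn s in auto)
  also have "\<dots> = CE n S (\<lambda>r. (?w r)\<^sup>2) s"
  proof (rule CE_cong)
    fix r assume "r \<in> cls n S s"
    then have "r \<in> Sym n" by (rule cls_subset)
    then show "CE n (S \<union> D) (\<lambda>r. ?w r * Del m D f r) r = (?w r)\<^sup>2"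
      using CE_pull[OF wcoef_dep] by (simp add: wcoef_def power2_eq_square)
  qed
  finally show ?thesis .
qed

text \<open>On \<open>S \<union> D\<close> the swap of \<open>B\<close> acts like that of
  \<open>B \<inter> D\<close>, and \<open>wcoef\<close> depends only on the values there.
  Translating the summation over \<open>C\<close> by \<open>B \<inter> D\<close> then produces the
  sign.\<close>

lemma psi_sw:
  assumes D: "D \<subseteq> {1..m}" and B: "B \<subseteq> {1..m}" and m: "2 * m \<le> n" and SB: "S \<inter> pts m B = {}"
    and SD: "S \<inter> pts m D = {}" and s: "s \<in> Sym n"
  shows "psi n m S D f (s \<circ> sw m B) = sg (B \<inter> D) * psi n m S D f s"
proof -
  let ?w = "wcoef n m S D f"
  have fin: "finite D" "finite B" using D B finite_subset by blast+
  have 1: "?w (s \<circ> sw m B \<circ> sw m C) = ?w (s \<circ> sw m (sdiff (B \<inter> D) C))" if C: "C \<subseteq> D" for C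
  proof -
    have C1: "C \<subseteq> {1..m}" using C D by auto
    have e: "s \<circ> sw m B \<circ> sw m C = s \<circ> sw m (sdiff B C)"
      by (simp add: comp_assoc sw_sw[OF B C1])
    show ?thesis unfolding e
    proof (rule depD[OF wcoef_dep])
      show "s \<circ> sw m (sdiff (B \<inter> D) C) \<in> Sym n" "s \<circ> sw m (sdiff B C) \<in> Sym n"
        by (intro Sym_comp s sw_Sym[OF _ m]; use B C1 in auto)+
      fix i assume i: "i \<in> S \<union> D"
      have "sw m (sdiff B C) i = sw m (sdiff (B \<inter> D) C) i"
      \<comment> \<open>A point of \<open>D\<close> is at most \<open>m\<close>, so
        \<open>sw\<close> moves it only through membership in the set, where \<open>B\<close> and
        \<open>B \<inter> D\<close> agree.\<close>
      proof (cases "i \<in> D")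
        case True
        then have "i \<le> m" using D by auto
        then show ?thesis using True by (auto simp: sw_def)
      next
        case False
        then have iS: "i \<in> S" using i by auto
        have "i \<notin> pts m (B \<union> D)" using iS SB SD by (auto simp: pts_Un)
        moreover have "pts m (sdiff B C) \<subseteq> pts m (B \<union> D)" "pts m (sdiff (B \<inter> D) C) \<subseteq> pts m (B \<union> D)"
          using C by (intro pts_mono; auto)+
        ultimately show ?thesis by (metis subsetD sw_fix)
      qed
      then show "(s \<circ> sw m (sdiff B C)) i = (s \<circ> sw m (sdiff (B \<inter> D) C)) i" by simp
    qed
  qed
  have "psi n m S D f (s \<circ> sw m B) = (\<Sum>C\<in>Pow D. sg C * ?w (s \<circ> sw m (sdiff (B \<inter> D) C)))"
    unfolding psi_def by (intro sum.cong refl) (simp add: 1)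
  also have "\<dots> = (\<Sum>C\<in>Pow D. sg (B \<inter> D) * (sg (sdiff (B \<inter> D) C) * ?w (s \<circ> sw m (sdiff (B \<inter> D) C))))"
  proof (intro sum.cong refl)
    fix C assume "C \<in> Pow D"
    then have "finite C" using fin finite_subset by auto
    then have "sg (sdiff (B \<inter> D) C) = sg (B \<inter> D) * sg C" using fin by (intro sg_sdiff) auto
    then show "sg C * ?w (s \<circ> sw m (sdiff (B \<inter> D) C)) = sg (B \<inter> D) * (sg (sdiff (B \<inter> D) C) * ?w (s \<circ> sw m (sdiff (B \<inter> D) C)))"
      by (simp flip: mult.assoc)
  qed
  also have "\<dots> = sg (B \<inter> D) * (\<Sum>C\<in>Pow D. (sg (sdiff (B \<inter> D) C) * ?w (s \<circ> sw m (sdiff (B \<inter> D) C))))"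
    by (rule sum_distrib_left[symmetric])
  also have "\<dots> = sg (B \<inter> D) * psi n m S D f s"
    unfolding psi_def by (subst sum_Pow_sdiff[where F = "\<lambda>C. sg C * ?w (s \<circ> sw m C)"]) auto
  finally show ?thesis .
qed

lemma psi_dep:
  assumes D: "D \<subseteq> {1..m}" and m: "2 * m \<le> n" and SD: "S \<inter> pts m D = {}"
  shows "dep n (S \<union> pts m D) (psi n m S D f)"
  unfolding dep_def psi_def
proof (intro ballI impI sum.cong refl)
  fix s r C assume s: "s \<in> Sym n" and r: "r \<in> Sym n" and eq: "\<forall>i\<in>S \<union> pts m D. r i = s i" and C: "C \<in> Pow D"
  have t: "sw m C \<in> Sym n" by (rule sw_Sym[OF _ m]) (use C D in auto)
  have "wcoef n m S D f (r \<circ> sw m C) = wcoef n m S D f (s \<circ> sw m C)"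
  proof (rule depD[OF wcoef_dep])
    show "s \<circ> sw m C \<in> Sym n" "r \<circ> sw m C \<in> Sym n" using s r t Sym_comp by auto
    fix i assume "i \<in> S \<union> D"
    then have "sw m C i \<in> S \<union> pts m D"
    proof
      assume "i \<in> S"
      then have "sw m C i = i" using SD pts_mono[of C D m] C by (intro sw_fix) auto
      then show ?thesis using \<open>i \<in> S\<close> by simp
    next
      assume "i \<in> D"
      then have "i \<in> pts m D" by (simp add: pts_def)
      then show ?thesis using sw_pts[of C D m] C D by auto
    qed
    then show "(r \<circ> sw m C) i = (s \<circ> sw m C) i" using eq by simp
  qed
  then show "sg C * wcoef n m S D f (r \<circ> sw m C) = sg C * wcoef n m S D f (s \<circ> sw m C)" by simp
qed

lemma sg_sq [simp]: "(sg B)\<^sup>2 = 1" by (simp add: power2_eq_square)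

lemma psi_sq_le:
  assumes "finite D"
  shows "(psi n m S D f s)\<^sup>2 \<le> 2 ^ card D * (\<Sum>C\<in>Pow D. (wcoef n m S D f (s \<circ> sw m C))\<^sup>2)"
  using sum_squared_le_sum_of_squares[of "\<lambda>C. sg C * wcoef n m S D f (s \<circ> sw m C)" "Pow D"]
  by (simp add: psi_def power_mult_distrib card_Pow assms mult.commute)

text \<open>This lowers the degree in the induction: the alternation over \<open>T\<close> is
  absorbed into the function and the first points of \<open>T\<close> join the prescribed ones,
  which leaves coefficients of degree \<open>card D\<close>.\<close>

lemma wcoef_split:
  assumes T: "T \<subseteq> {1..m}" and D: "D \<subseteq> {1..m}" and TD: "T \<inter> D = {}"
  shows "wcoef n m S (T \<union> D) f s = (\<Sum>B\<in>Pow T. sg B * wcoef n m (S \<union> T) D (\<lambda>r. f (r \<circ> sw m B)) s) / 2 ^ card T"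
proof -
  have fin: "finite T" "finite D" using T D finite_subset by blast+
  have "Del m (T \<union> D) f r = (\<Sum>B\<in>Pow T. sg B * Del m D (\<lambda>r. f (r \<circ> sw m B)) r) / 2 ^ card T" for r
  proof -
    have "(\<Sum>B\<in>Pow (T \<union> D). sg B * f (r \<circ> sw m B)) = (\<Sum>B\<in>Pow T. \<Sum>C\<in>Pow D. sg B * (sg C * f (r \<circ> sw m C \<circ> sw m B)))"
      unfolding sum_Pow_Un[OF TD]
    proof (intro sum.cong refl)
      fix B C assume BC: "B \<in> Pow T" "C \<in> Pow D"
      have "sg (B \<union> C) = sg B * sg C"
        using BC TD fin by (intro sg_Un) (auto intro: finite_subset)
      moreover have "sdiff C B = B \<union> C" using BC TD by auto
      then have "sw m C \<circ> sw m B = sw m (B \<union> C)" using sw_sw[of C m B] BC T D by (metis Pow_iff order_trans)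
      ultimately show "sg (B \<union> C) * f (r \<circ> sw m (B \<union> C)) = sg B * (sg C * f (r \<circ> sw m C \<circ> sw m B))"
        by (simp add: comp_assoc)
    qed
    then show ?thesis
      using TD fin by (simp add: Del_def card_Un_disjoint power_add sum_distrib_left sum_divide_distrib divide_simps mult_ac)
  qed
  then have "Del m (T \<union> D) f = (\<lambda>r. (\<Sum>B\<in>Pow T. sg B * Del m D (\<lambda>r. f (r \<circ> sw m B)) r) / 2 ^ card T)"
    by (rule ext)
  then show ?thesis
    by (simp add: wcoef_def CE_divide CE_sum CE_cmult Un_assoc)
qed

lemma wcoef_split_sq:
  assumes T: "T \<subseteq> {1..m}" and D: "D \<subseteq> {1..m}" and TD: "T \<inter> D = {}"
  shows "(wcoef n m S (T \<union> D) f s)\<^sup>2 \<le> (\<Sum>B\<in>Pow T. (wcoef n m (S \<union> T) D (\<lambda>r. f (r \<circ> sw m B)) s)\<^sup>2) / 2 ^ card T"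
proof -
  have fin: "finite T" using T finite_subset by blast
  let ?u = "\<lambda>B. wcoef n m (S \<union> T) D (\<lambda>r. f (r \<circ> sw m B)) s"
  have "(\<Sum>B\<in>Pow T. sg B * ?u B)\<^sup>2 \<le> 2 ^ card T * (\<Sum>B\<in>Pow T. (?u B)\<^sup>2)"
    using sum_squared_le_sum_of_squares[of "\<lambda>B. sg B * ?u B" "Pow T"]
    by (simp add: power_mult_distrib card_Pow fin mult.commute)
  then show ?thesis unfolding wcoef_split[OF assms]
    by (simp add: power_divide power2_eq_square divide_simps mult_ac)
qed

section \<open>Hypercontractivity and moments\<close>

lemma binomial_step: "Suc j * (n choose Suc j) = (n - j) * (n choose j)"
  using binomial_absorption[of j n] binomial_absorb_comp[of n j] by simp

text \<open>The coefficient form of the two-point inequality behind \<open>bonami\<close>. The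
  quotients of consecutive terms in \<open>i\<close> are compared: the left side grows by
  \<open>(k - i) * (2 * k - 2 * i - 1) / ((i + 1) * (2 * i + 1))\<close>, the right side by
  \<open>2 * k * (k - i) / (i + 1)\<close>.\<close>

lemma binomial_double_le: "((2 * k) choose (2 * i)) \<le> (2 * k) ^ i * (k choose i)"
proof (induction i)
  case (Suc i)
  let ?x = "(2 * k) choose (2 * i)" and ?z = "(2 * k) choose (2 * Suc i)"
  let ?b = "k choose i" and ?b' = "k choose Suc i"
  have 1: "2 * Suc i * ?z = (2 * k - (2 * i + 1)) * ((2 * k) choose (2 * i + 1))"
    using binomial_step[of "2 * i + 1" "2 * k"] by simp
  have 2: "(2 * i + 1) * ((2 * k) choose (2 * i + 1)) = (2 * k - 2 * i) * ?x"
    using binomial_step[of "2 * i" "2 * k"] by simp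
  have 3: "Suc i * ?b' = (k - i) * ?b" by (rule binomial_step)
  have "(2 * i + 1) * (2 * Suc i * ?z) = (2 * k - (2 * i + 1)) * ((2 * i + 1) * ((2 * k) choose (2 * i + 1)))"
    by (simp only: 1 mult.left_commute)
  also have "\<dots> = (2 * k - (2 * i + 1)) * ((2 * k - 2 * i) * ?x)" by (simp only: 2)
  also have "\<dots> \<le> (2 * k) * ((2 * k - 2 * i) * ((2 * k) ^ i * ?b))"
    using Suc.IH by (intro mult_mono) auto
  also have "\<dots> = (2 * k) ^ Suc i * (2 * ((k - i) * ?b))"
    by (simp add: diff_mult_distrib2)
  also have "\<dots> = (2 * k) ^ Suc i * (2 * (Suc i * ?b'))" by (simp only: 3)
  finally have "(2 * i + 1) * (2 * Suc i * ?z) \<le> (2 * k) ^ Suc i * (2 * (Suc i * ?b'))" .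
  moreover have "1 * (2 * Suc i * ?z) \<le> (2 * i + 1) * (2 * Suc i * ?z)"
    by (rule mult_le_mono1) simp
  ultimately have "2 * Suc i * ?z \<le> (2 * k) ^ Suc i * (2 * (Suc i * ?b'))"
    by (simp only: mult_1)
  also have "\<dots> = 2 * Suc i * ((2 * k) ^ Suc i * ?b')" by (simp only: mult_ac)
  finally show ?case by (rule iffD1[OF mult_le_cancel1, THEN mp]) simp
qed simp

lemma even_expansion:
  fixes g h :: real
  shows "(g + h) ^ (2 * k) + (g - h) ^ (2 * k) = 2 * (\<Sum>i\<le>k. real ((2 * k) choose (2 * i)) * (g\<^sup>2) ^ (k - i) * (h\<^sup>2) ^ i)"
proof -
  let ?T = "\<lambda>j. real ((2 * k) choose j) * g ^ (2 * k - j) * (h ^ j + (-h) ^ j)"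
  have "(g + h) ^ (2 * k) + (g - h) ^ (2 * k) = (h + g) ^ (2 * k) + (- h + g) ^ (2 * k)"
    by (simp add: add.commute)
  also have "\<dots> = (\<Sum>j\<le>2 * k. ?T j)"
    unfolding binomial_ring by (simp add: sum.distrib[symmetric] algebra_simps)
  also have "\<dots> = (\<Sum>j\<in>(\<lambda>i. 2 * i) ` {..k}. ?T j)"
  proof (rule sum.mono_neutral_right)
    show "\<forall>j\<in>{..2 * k} - (\<lambda>i. 2 * i) ` {..k}. ?T j = 0"
    proof
      fix j assume j: "j \<in> {..2 * k} - (\<lambda>i. 2 * i) ` {..k}"
      have "odd j"
      proof
        assume "even j"
        then have "j = 2 * (j div 2)" "j div 2 \<in> {..k}" using j by auto
        then show False using j by blast
      qed
      then show "?T j = 0" by simp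
    qed
  qed auto
  also have "\<dots> = (\<Sum>i\<le>k. ?T (2 * i))"
    by (subst sum.reindex) (auto simp: inj_on_def)
  also have "\<dots> = (\<Sum>i\<le>k. 2 * (real ((2 * k) choose (2 * i)) * (g\<^sup>2) ^ (k - i) * (h\<^sup>2) ^ i))"
  proof (rule sum.cong[OF refl])
    fix i assume "i \<in> {..k}"
    then have "2 * k - 2 * i = 2 * (k - i)" by simp
    then show "?T (2 * i) = 2 * (real ((2 * k) choose (2 * i)) * (g\<^sup>2) ^ (k - i) * (h\<^sup>2) ^ i)"
      by (simp add: power_mult)
  qed
  finally show ?thesis by (simp add: sum_distrib_left)
qed

lemma weighted_am_gm_power:
  fixes x y :: real
  assumes "0 \<le> x" "0 \<le> y" "0 < a + b"
  shows "real (a + b) * (x ^ a * y ^ b) \<le> real a * x ^ (a + b) + real b * y ^ (a + b)"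
proof (cases "x = 0 \<or> y = 0")
  case True
  then show ?thesis using assms by (cases "a = 0"; cases "b = 0") (auto simp: power_0_left)
next
  case False
  then have p: "0 < x" "0 < y" using assms by auto
  let ?k = "real (a + b)"
  have k: "0 < ?k" using assms by (simp only: of_nat_0_less_iff)
  have "(x ^ (a + b)) powr (a / ?k) * (y ^ (a + b)) powr (b / ?k)
      \<le> a / ?k * x ^ (a + b) + b / ?k * y ^ (a + b)"
    by (rule Youngs_inequality_0) (use p k in \<open>auto simp: add_divide_distrib[symmetric]\<close>)
  moreover have "(x ^ (a + b)) powr (a / ?k) = x ^ a" "(y ^ (a + b)) powr (b / ?k) = y ^ b"
    using p k by (simp_all add: powr_realpow[symmetric] powr_powr del: of_nat_add)
  ultimately have "x ^ a * y ^ b \<le> (a * x ^ (a + b) + b * y ^ (a + b)) / ?k"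
    by (simp add: add_divide_distrib)
  then show ?thesis using k by (simp add: field_simps)
qed

text \<open>Hoelder's inequality with exponents (a+b)/a and (a+b)/b over a set of mass
  \<open>N\<close>: divide by \<open>A\<close> and \<open>B\<close> and apply weighted AM-GM term by
  term. Vanishing \<open>A\<close> or \<open>B\<close> is separate because the normalisation
  fails.\<close>

lemma sum_power_mixed_le:
  fixes u v :: "'a \<Rightarrow> real"
  assumes fin: "finite I" and u: "\<And>i. i \<in> I \<Longrightarrow> 0 \<le> u i" and v: "\<And>i. i \<in> I \<Longrightarrow> 0 \<le> v i"
    and A: "0 \<le> A" "(\<Sum>i\<in>I. u i ^ (a + b)) \<le> N * A ^ (a + b)"
    and B: "0 \<le> B" "(\<Sum>i\<in>I. v i ^ (a + b)) \<le> N * B ^ (a + b)"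
    and N: "0 \<le> N"
  shows "(\<Sum>i\<in>I. u i ^ a * v i ^ b) \<le> N * (A ^ a * B ^ b)"
proof (cases "a = 0 \<or> b = 0")
  case True
  then show ?thesis using A B by auto
next
  case False
  then have ab: "a > 0" "b > 0" by auto
  show ?thesis
  proof (cases "A = 0 \<or> B = 0")
    case True
    have "u i ^ a * v i ^ b = 0" if i: "i \<in> I" for i
    proof -
      have "u i ^ (a + b) \<le> (\<Sum>i\<in>I. u i ^ (a + b))" "v i ^ (a + b) \<le> (\<Sum>i\<in>I. v i ^ (a + b))"
        using fin i u v by (auto intro!: member_le_sum)
      then have "u i ^ (a + b) \<le> 0 \<or> v i ^ (a + b) \<le> 0"
        using A B True ab by (auto simp: power_0_left)
      then have "u i ^ (a + b) = 0 \<or> v i ^ (a + b) = 0"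
        using u[OF i] v[OF i] by (meson order_antisym zero_le_power)
      then show ?thesis using ab by auto
    qed
    then have "(\<Sum>i\<in>I. u i ^ a * v i ^ b) = 0" by (simp add: sum.neutral)
    then show ?thesis using A B N by simp
  next
    case False
    then have AB: "A > 0" "B > 0" using A B by auto
    let ?k = "real (a + b)"
    have "?k * ((\<Sum>i\<in>I. u i ^ a * v i ^ b) / (A ^ a * B ^ b)) = (\<Sum>i\<in>I. ?k * ((u i / A) ^ a * (v i / B) ^ b))"
      by (simp add: sum_distrib_left sum_divide_distrib power_divide)
    also have "\<dots> \<le> (\<Sum>i\<in>I. a * (u i / A) ^ (a + b) + b * (v i / B) ^ (a + b))"
      using ab AB u v by (intro sum_mono weighted_am_gm_power) auto
    also have "\<dots> = a * ((\<Sum>i\<in>I. u i ^ (a + b)) / A ^ (a + b)) + b * ((\<Sum>i\<in>I. v i ^ (a + b)) / B ^ (a + b))"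
      by (simp add: sum.distrib sum_distrib_left sum_divide_distrib power_divide)
    also have "\<dots> \<le> a * N + b * N"
      using A B AB ab by (intro add_mono mult_left_mono) (auto simp: divide_le_eq)
    also have "\<dots> = ?k * N" by (simp add: algebra_simps)
    finally have "(\<Sum>i\<in>I. u i ^ a * v i ^ b) / (A ^ a * B ^ b) \<le> N"
      by (rule mult_left_le_imp_le) (use ab in simp)
    then show ?thesis using AB by (simp add: divide_le_eq)
  qed
qed

lemma sum_Pow_insert:
  assumes "finite P" "p \<notin> P"
  shows "(\<Sum>B\<in>Pow (insert p P). F B) = (\<Sum>B\<in>Pow P. F B + F (insert p B))"
proof -
  have "(\<Sum>B\<in>Pow (insert p P). F B) = (\<Sum>B\<in>Pow P. F B) + (\<Sum>B\<in>insert p ` Pow P. F B)"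
    unfolding Pow_insert using assms by (intro sum.union_disjoint) auto
  also have "(\<Sum>B\<in>insert p ` Pow P. F B) = (\<Sum>B\<in>Pow P. F (insert p B))"
    using assms(2) by (subst sum.reindex) (auto simp: inj_on_def)
  finally show ?thesis by (simp add: sum.distrib)
qed

lemma sg_insert: "finite B \<Longrightarrow> p \<notin> B \<Longrightarrow> sg (insert p B) = - sg B"
  by (simp add: sg_def)

text \<open>Induction on the coordinates. Splitting off \<open>p\<close> writes the chaos as
  \<open>?G + ?H\<close> or \<open>?G - ?H\<close>, according to the sign of \<open>p\<close>;
  adding both leaves the even powers of \<open>?H\<close>. Hoelder separates the mixed moments, and
  \<open>binomial_double_le\<close> lets the binomial theorem resum them with a factor
  \<open>2 * k\<close> on \<open>?B\<close>.\<close>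

lemma bonami:
  fixes y :: "'a set \<Rightarrow> real"
  assumes "finite P" "0 < k"
  shows "(\<Sum>B\<in>Pow P. (\<Sum>D\<in>Pow P. sg (B \<inter> D) * y D) ^ (2 * k))
     \<le> 2 ^ card P * (\<Sum>D\<in>Pow P. real (2 * k) ^ card D * (y D)\<^sup>2) ^ k"
  using assms(1)
proof (induction P arbitrary: y)
  case empty
  show ?case by (simp add: power_mult)
next
  case (insert p P)
  let ?G = "\<lambda>B. \<Sum>D\<in>Pow P. sg (B \<inter> D) * y D"
  let ?H = "\<lambda>B. \<Sum>D\<in>Pow P. sg (B \<inter> D) * y (insert p D)"
  let ?A = "\<Sum>D\<in>Pow P. real (2 * k) ^ card D * (y D)\<^sup>2"
  let ?B = "\<Sum>D\<in>Pow P. real (2 * k) ^ card D * (y (insert p D))\<^sup>2"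
  have A0: "0 \<le> ?A" "0 \<le> ?B" by (auto intro!: sum_nonneg)
  have IH: "(\<Sum>B\<in>Pow P. ((?G B)\<^sup>2) ^ k) \<le> 2 ^ card P * ?A ^ k"
    "(\<Sum>B\<in>Pow P. ((?H B)\<^sup>2) ^ k) \<le> 2 ^ card P * ?B ^ k"
    using insert.IH[of y] insert.IH[of "\<lambda>D. y (insert p D)"] by (simp_all add: power_mult)
  have e1: "(\<Sum>D\<in>Pow (insert p P). sg (B \<inter> D) * y D) = ?G B + ?H B"
    and e2: "(\<Sum>D\<in>Pow (insert p P). sg (insert p B \<inter> D) * y D) = ?G B - ?H B" if B: "B \<in> Pow P" for B
  proof -
    have pB: "p \<notin> B" using B insert by auto
    show "(\<Sum>D\<in>Pow (insert p P). sg (B \<inter> D) * y D) = ?G B + ?H B"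
      using pB by (simp add: sum_Pow_insert[OF insert(1,2)] sum.distrib)
    have "sg (insert p B \<inter> D) * y D = sg (B \<inter> D) * y D" if "D \<in> Pow P" for D
    proof -
      have "insert p B \<inter> D = B \<inter> D" using that insert(2) by auto
      then show ?thesis by simp
    qed
    moreover have "sg (insert p B \<inter> insert p D) = - sg (B \<inter> D)" if "D \<in> Pow P" for D
    proof -
      have "insert p B \<inter> insert p D = insert p (B \<inter> D)" by auto
      moreover have "finite (B \<inter> D)" using B insert(1) by (auto intro: finite_subset)
      ultimately show ?thesis using pB by (simp add: sg_insert)
    qed
    ultimately have "(\<Sum>D\<in>Pow P. sg (insert p B \<inter> D) * y D) = ?G B"
      "(\<Sum>D\<in>Pow P. sg (insert p B \<inter> insert p D) * y (insert p D)) = - ?H B"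
      unfolding sum_negf[symmetric] by (intro sum.cong refl; simp)+
    then show "(\<Sum>D\<in>Pow (insert p P). sg (insert p B \<inter> D) * y D) = ?G B - ?H B"
      unfolding sum_Pow_insert[OF insert(1,2)] by (simp only: sum.distrib)
  qed
  have "(\<Sum>B\<in>Pow (insert p P). (\<Sum>D\<in>Pow (insert p P). sg (B \<inter> D) * y D) ^ (2 * k))
     = (\<Sum>B\<in>Pow P. (?G B + ?H B) ^ (2 * k) + (?G B - ?H B) ^ (2 * k))"
    by (subst sum_Pow_insert[OF insert(1,2)]) (intro sum.cong refl arg_cong2[of _ _ _ _ "(+)"], simp_all add: e1 e2)
  also have "\<dots> = (\<Sum>B\<in>Pow P. 2 * (\<Sum>i\<le>k. real ((2 * k) choose (2 * i)) * ((?G B)\<^sup>2) ^ (k - i) * ((?H B)\<^sup>2) ^ i))"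
    by (simp only: even_expansion)
  also have "\<dots> = 2 * (\<Sum>i\<le>k. real ((2 * k) choose (2 * i)) * (\<Sum>B\<in>Pow P. ((?G B)\<^sup>2) ^ (k - i) * ((?H B)\<^sup>2) ^ i))"
    unfolding sum_distrib_left[symmetric] by (subst sum.swap) (simp add: sum_distrib_left mult.assoc)
  also have "\<dots> \<le> 2 * (\<Sum>i\<le>k. real ((2 * k) ^ i * (k choose i)) * (2 ^ card P * (?A ^ (k - i) * ?B ^ i)))"
  proof (intro mult_left_mono sum_mono)
    fix i assume i: "i \<in> {..k}"
    then have ki: "(k - i) + i = k" by simp
    have "(\<Sum>B\<in>Pow P. ((?G B)\<^sup>2) ^ (k - i) * ((?H B)\<^sup>2) ^ i) \<le> 2 ^ card P * (?A ^ (k - i) * ?B ^ i)"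
      using A0 IH insert(1) by (intro sum_power_mixed_le) (auto simp: ki)
    then show "real ((2 * k) choose (2 * i)) * (\<Sum>B\<in>Pow P. ((?G B)\<^sup>2) ^ (k - i) * ((?H B)\<^sup>2) ^ i)
      \<le> real ((2 * k) ^ i * (k choose i)) * (2 ^ card P * (?A ^ (k - i) * ?B ^ i))"
      using binomial_double_le[of k i] by (intro mult_mono) (auto intro!: sum_nonneg mult_nonneg_nonneg zero_le_power zero_le_power2 simp only: of_nat_le_iff)
  qed simp
  also have "\<dots> = 2 ^ card (insert p P) * (\<Sum>i\<le>k. real (k choose i) * (real (2 * k) * ?B) ^ i * ?A ^ (k - i))"
  proof -
    have "2 * (\<Sum>i\<le>k. real ((2 * k) ^ i * (k choose i)) * (N * (A ^ (k - i) * B ^ i)))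
       = 2 * N * (\<Sum>i\<le>k. real (k choose i) * (real (2 * k) * B) ^ i * A ^ (k - i))" for A B N :: real
      by (simp add: sum_distrib_left power_mult_distrib mult_ac)
    moreover have "(2::real) ^ card (insert p P) = 2 * 2 ^ card P" using insert by simp
    ultimately show ?thesis by (simp only:)
  qed
  also have "\<dots> = 2 ^ card (insert p P) * (real (2 * k) * ?B + ?A) ^ k"
    by (simp only: binomial_ring)
  also have "real (2 * k) * ?B + ?A = (\<Sum>D\<in>Pow (insert p P). real (2 * k) ^ card D * (y D)\<^sup>2)"
  proof -
    have "card (insert p D) = Suc (card D)" if "D \<in> Pow P" for D
      using that insert(1,2) by (subst card_insert_disjoint) (auto intro: finite_subset)
    then show ?thesis
      unfolding sum_Pow_insert[OF insert(1,2)] by (simp add: sum.distrib sum_distrib_left mult_ac)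
  qed
  finally show ?case .
qed

text \<open>Jensen's inequality for the convex even power with weights proportional to
  \<open>f\<close>; then \<open>f \<le> 1\<close> removes the weight from the moment of
  \<open>g\<close>. The powers of the mean of \<open>f\<close> come from normalising the
  weights.\<close>

lemma CE_holder:
  assumes S: "S \<subseteq> {1..n}" and s: "s \<in> Sym n"
    and f: "\<And>r. r \<in> Sym n \<Longrightarrow> 0 \<le> f r" "\<And>r. r \<in> Sym n \<Longrightarrow> f r \<le> 1" and k: "0 < k"
  shows "(CE n S (\<lambda>r. f r * g r) s) ^ (2 * k) \<le> (CE n S f s) ^ (2 * k - 1) * CE n S (\<lambda>r. g r ^ (2 * k)) s"
proof -
  let ?C = "cls n S s" and ?N = "fact (n - card S) :: real"
  let ?t = "\<Sum>r\<in>?C. f r"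
  have t0: "0 \<le> ?t" using f(1) by (intro sum_nonneg) (auto dest: cls_subset)
  have ne: "?C \<noteq> {}" using cls_self[OF s] by auto
  show ?thesis
  proof (cases "?t = 0")
    case True
    then have z: "f r = 0" if "r \<in> ?C" for r
      using that f(1) by (subst (asm) sum_nonneg_eq_0_iff) (auto dest: cls_subset)
    then have "CE n S (\<lambda>r. f r * g r) s = 0" unfolding CE_def by simp
    moreover have "0 \<le> CE n S f s" "0 \<le> CE n S (\<lambda>r. g r ^ (2 * k)) s"
      using f(1) by (auto intro!: CE_nonneg simp: power_mult dest: cls_subset)
    ultimately show ?thesis using k by (auto intro!: mult_nonneg_nonneg simp: power_0_left)
  next
    case False
    then have t: "0 < ?t" using t0 by simp
    have "(\<Sum>r\<in>?C. (f r / ?t) *\<^sub>R g r) ^ (2 * k) \<le> (\<Sum>r\<in>?C. (f r / ?t) * g r ^ (2 * k))"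
      by (rule convex_on_sum[of ?C UNIV "\<lambda>x. x ^ (2 * k)"])
         (use ne f t convex_power_even[of "2 * k"] in \<open>auto simp: sum_divide_distrib[symmetric] dest: cls_subset\<close>)
    then have "((\<Sum>r\<in>?C. f r * g r) / ?t) ^ (2 * k) \<le> (\<Sum>r\<in>?C. f r * g r ^ (2 * k)) / ?t"
      by (simp add: sum_divide_distrib)
    then have "(\<Sum>r\<in>?C. f r * g r) ^ (2 * k) \<le> ?t ^ (2 * k) * ((\<Sum>r\<in>?C. f r * g r ^ (2 * k)) / ?t)"
      using t by (simp add: power_divide divide_le_eq mult.commute)
    also have "\<dots> = ?t ^ (2 * k - 1) * (\<Sum>r\<in>?C. f r * g r ^ (2 * k))"
      using t k by (simp add: power_eq_if)
    also have "\<dots> \<le> ?t ^ (2 * k - 1) * (\<Sum>r\<in>?C. g r ^ (2 * k))"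
    proof (intro mult_left_mono sum_mono zero_le_power t0)
      fix r assume "r \<in> ?C"
      then have "f r \<le> 1" using f by (auto dest: cls_subset)
      then show "f r * g r ^ (2 * k) \<le> g r ^ (2 * k)"
        using mult_right_mono[of "f r" 1 "g r ^ (2 * k)"] by (simp add: power_mult)
    qed
    finally have "(\<Sum>r\<in>?C. f r * g r) ^ (2 * k) / ?N ^ (2 * k) \<le> ?t ^ (2 * k - 1) * (\<Sum>r\<in>?C. g r ^ (2 * k)) / ?N ^ (2 * k)"
      by (intro divide_right_mono) auto
    moreover have "?N ^ (2 * k) = ?N ^ (2 * k - 1) * ?N" using k by (simp add: power_eq_if)
    ultimately show ?thesis by (simp add: CE_def power_divide)
  qed
qed

text \<open>The moments of the non-negative statistic are controlled by its conditional expectations: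
  one factor is integrated at a time, conditionally on the coordinates met by the others.\<close>

lemma moment_bound:
  fixes y :: "nat set \<Rightarrow> (nat \<Rightarrow> nat) \<Rightarrow> real"
  assumes P: "P \<subseteq> {1..m}" and m: "2 * m \<le> n" and S: "S \<subseteq> {1..n}" and s: "s \<in> Sym n"
    and Ds: "\<And>D. D \<in> Ds \<Longrightarrow> D \<subseteq> P \<and> card D = d"
    and dep: "\<And>D. D \<in> Ds \<Longrightarrow> dep n (S \<union> pts m D) (y D)"
    and pos: "\<And>D r. 0 \<le> y D r"
    and Z0: "0 \<le> Z"
    and Z: "\<And>U r. U \<subseteq> P \<Longrightarrow> card U \<le> N \<Longrightarrow> r \<in> cls n S s \<Longrightarrow> CE n (S \<union> pts m U) (\<lambda>q. \<Sum>D\<in>Ds. y D q) r \<le> Z"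
    and U: "U \<subseteq> P" "card U + d * k \<le> N" and Phi: "dep n (S \<union> pts m U) Phi" "\<And>r. 0 \<le> Phi r"
  shows "CE n S (\<lambda>r. Phi r * (\<Sum>D\<in>Ds. y D r) ^ k) s \<le> Z ^ k * CE n S Phi s"
  using U Phi
proof (induction k arbitrary: U Phi)
  case 0
  then show ?case by simp
next
  case (Suc k)
  have finP: "finite P" using P finite_subset by blast
  let ?Y = "\<lambda>r. \<Sum>D\<in>Ds. y D r"
  \<comment> \<open>One factor is expanded and each term \<open>y D\<close> is absorbed into the
    weight, at the price of \<open>D\<close> joining \<open>U\<close>. After the induction
    hypothesis the terms are collected again, and that factor is averaged given the points of
    \<open>U\<close>, on which the old weight \<open>Phi\<close> depends.\<close>
  have "CE n S (\<lambda>r. Phi r * ?Y r ^ Suc k) s = CE n S (\<lambda>r. \<Sum>D\<in>Ds. (Phi r * y D r) * ?Y r ^ k) s"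
    by (simp add: sum_distrib_left sum_distrib_right mult_ac)
  also have "\<dots> = (\<Sum>D\<in>Ds. CE n S (\<lambda>r. (Phi r * y D r) * ?Y r ^ k) s)" by (rule CE_sum)
  also have "\<dots> \<le> (\<Sum>D\<in>Ds. Z ^ k * CE n S (\<lambda>r. Phi r * y D r) s)"
  proof (rule sum_mono)
    fix D assume D: "D \<in> Ds"
    have c: "card (U \<union> D) \<le> card U + d" using card_Un_le[of U D] Ds[OF D] by simp
    show "CE n S (\<lambda>r. (Phi r * y D r) * ?Y r ^ k) s \<le> Z ^ k * CE n S (\<lambda>r. Phi r * y D r) s"
    proof (rule Suc.IH[of "U \<union> D"])
      show "U \<union> D \<subseteq> P" using Suc.prems Ds[OF D] by auto
      show "card (U \<union> D) + d * k \<le> N" using c Suc.prems by simp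
      have "dep n (S \<union> pts m (U \<union> D)) Phi" "dep n (S \<union> pts m (U \<union> D)) (y D)"
        using Suc.prems(3) dep[OF D] by (auto elim!: dep_mono simp: pts_Un)
      then show "dep n (S \<union> pts m (U \<union> D)) (\<lambda>r. Phi r * y D r)"
        unfolding dep_def by metis
    qed (use Suc.prems pos in auto)
  qed
  also have "\<dots> = Z ^ k * CE n S (\<lambda>r. Phi r * ?Y r) s"
    by (simp add: sum_distrib_left[symmetric] CE_sum[symmetric])
  also have "\<dots> \<le> Z ^ k * (Z * CE n S Phi s)"
  proof (intro mult_left_mono zero_le_power Z0)
    have V: "S \<union> pts m U \<subseteq> {1..n}" using S pts_subset[OF _ m, of U] Suc.prems P by auto
    have "CE n S (\<lambda>r. Phi r * ?Y r) s = CE n S (CE n (S \<union> pts m U) (\<lambda>r. Phi r * ?Y r)) s"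
      by (rule CE_tower[symmetric, OF _ V s]) auto
    also have "\<dots> = CE n S (\<lambda>r. Phi r * CE n (S \<union> pts m U) ?Y r) s"
      by (rule CE_cong, rule CE_pull[OF Suc.prems(3)]) (auto dest: cls_subset)
    also have "\<dots> \<le> CE n S (\<lambda>r. Phi r * Z) s"
    proof (intro CE_mono mult_left_mono Suc.prems)
      fix r assume r: "r \<in> cls n S s"
      show "CE n (S \<union> pts m U) ?Y r \<le> Z"
        by (rule Z[OF _ _ r]) (use Suc.prems in auto)
    qed
    also have "\<dots> = Z * CE n S Phi s" by (subst CE_cmult[symmetric]) (simp add: mult.commute)
    finally show "CE n S (\<lambda>r. Phi r * ?Y r) s \<le> Z * CE n S Phi s" .
  qed
  finally show ?case by (simp add: mult_ac)
qed

section \<open>The upper bound by induction on the degree\<close>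

abbreviation subs :: "nat set \<Rightarrow> nat \<Rightarrow> nat set set" where
  "subs P d \<equiv> {D. D \<subseteq> P \<and> card D = d}"

text \<open>When \<open>S\<close> avoids \<open>pts m P\<close>, \<open>CE_f_psi\<close> makes this
  \<open>2 ^ d\<close> times smaller than the conditional pairing of \<open>f\<close> with the sum
  of all \<open>psi\<close>. It is the quantity bounded by induction.\<close>

definition wt :: "nat \<Rightarrow> nat \<Rightarrow> nat set \<Rightarrow> nat set \<Rightarrow> nat \<Rightarrow> ((nat \<Rightarrow> nat) \<Rightarrow> real) \<Rightarrow> (nat \<Rightarrow> nat) \<Rightarrow> real" where
  "wt n m S P d f s = (\<Sum>D\<in>subs P d. CE n S (\<lambda>r. (wcoef n m S D f r)\<^sup>2) s)"

text \<open>For an indicator the mean square is the mean, so globalness becomes a bound on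
  \<open>f\<close> itself with the squared radius.\<close>

definition spread :: "nat \<Rightarrow> real \<Rightarrow> real \<Rightarrow> ((nat \<Rightarrow> nat) \<Rightarrow> real) \<Rightarrow> bool" where
  "spread n R \<gamma> f \<longleftrightarrow> (\<forall>s\<in>Sym n. 0 \<le> f s \<and> f s \<le> 1 \<and>
     (\<forall>S. S \<subseteq> {1..n} \<longrightarrow> CE n S f s \<le> R ^ card S * \<gamma>))"

text \<open>The class has to be stable under relabelling: swaps enter through
  \<open>wcoef_split\<close>, and arbitrary relabellings through the averaging in the lower
  bound.\<close>

lemma spread_right:
  assumes f: "spread n R \<gamma> f" and t: "t \<in> Sym n"
  shows "spread n R \<gamma> (\<lambda>r. f (r \<circ> t))"
  unfolding spread_def
proof (intro ballI conjI allI impI)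
  fix s assume s: "s \<in> Sym n"
  show "0 \<le> f (s \<circ> t)" "f (s \<circ> t) \<le> 1" using f Sym_comp[OF s t] by (auto simp: spread_def)
  fix S assume S: "S \<subseteq> {1..n}"
  have "CE n S (\<lambda>r. f (r \<circ> t)) s = CE n (inv t ` S) f (s \<circ> t)"
    using CE_right'[OF Sym_inv[OF t], of S f s] t by simp
  also have "\<dots> \<le> R ^ card (inv t ` S) * \<gamma>"
    using f Sym_comp[OF s t] Sym_image_subset[OF Sym_inv[OF t] S] by (auto simp: spread_def)
  finally show "CE n S (\<lambda>r. f (r \<circ> t)) s \<le> R ^ card S * \<gamma>"
    using Sym_card_image[OF Sym_inv[OF t]] by simp
qed

text \<open>The \<open>d\<close>-sets are sorted by their trace \<open>T\<close> on
  \<open>U\<close>. The condition \<open>card T \<le> d\<close> guards the truncated subtraction,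
  which would otherwise admit every larger \<open>T\<close> together with the empty
  \<open>D\<close>.\<close>

lemma sum_subs_split:
  assumes "finite P" "U \<subseteq> P"
  shows "(\<Sum>D\<in>subs P d. h D) = (\<Sum>T\<in>{T. T \<subseteq> U \<and> card T \<le> d}. \<Sum>D\<in>subs (P - U) (d - card T). h (T \<union> D))"
proof -
  have fin: "finite U" "finite {T. T \<subseteq> U \<and> card T \<le> d}" "\<And>k. finite (subs (P - U) k)"
    using assms by (auto intro: finite_subset[of _ "Pow P"] finite_subset)
  have c: "card (T \<union> D) = card T + card D" if "T \<subseteq> U" "D \<subseteq> P - U" for T D
    using that assms fin by (intro card_Un_disjoint) (auto intro: finite_subset)
  have c2: "card (D \<inter> U) + card (D - U) = card D" if "D \<subseteq> P" for D
    using that assms fin by (subst card_Un_disjoint[symmetric]) (auto intro: finite_subset arg_cong[of _ _ card])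
  have "(\<Sum>T\<in>{T. T \<subseteq> U \<and> card T \<le> d}. \<Sum>D\<in>subs (P - U) (d - card T). h (T \<union> D))
     = (\<Sum>(T, D)\<in>(SIGMA T:{T. T \<subseteq> U \<and> card T \<le> d}. subs (P - U) (d - card T)). h (T \<union> D))"
    using fin by (intro sum.Sigma) auto
  also have "\<dots> = (\<Sum>D\<in>subs P d. h D)"
  proof (rule sum.reindex_bij_witness[where i = "\<lambda>D. (D \<inter> U, D - U)" and j = "\<lambda>(T, D). T \<union> D"])
    fix x assume "x \<in> (SIGMA T:{T. T \<subseteq> U \<and> card T \<le> d}. subs (P - U) (d - card T))"
    then obtain T D where x: "x = (T, D)" "T \<subseteq> U" "card T \<le> d" "D \<subseteq> P - U" "card D = d - card T" by auto
    show "((case x of (T, D) \<Rightarrow> T \<union> D) \<inter> U, (case x of (T, D) \<Rightarrow> T \<union> D) - U) = x" using x by auto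
    show "(case x of (T, D) \<Rightarrow> T \<union> D) \<in> subs P d" using x c[of T D] assms by auto
    show "h (case x of (T, D) \<Rightarrow> T \<union> D) = (case x of (T, D) \<Rightarrow> h (T \<union> D))" using x by simp
  next
    fix D assume D: "D \<in> subs P d"
    show "(case (D \<inter> U, D - U) of (T, D) \<Rightarrow> T \<union> D) = D" by auto
    show "(D \<inter> U, D - U) \<in> (SIGMA T:{T. T \<subseteq> U \<and> card T \<le> d}. subs (P - U) (d - card T))"
      using D c2[of D] by auto
  qed
  finally show ?thesis by simp
qed

text \<open>A set of at most \<open>L\<close> elements has at most \<open>L ^ j / fact j\<close>
  subsets of size \<open>j\<close>; times the summand this is \<open>d choose j\<close> copies of
  \<open>L ^ d / fact d\<close>, and the binomial row sums to \<open>2 ^ d\<close>. Thus the terms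
  of lower degree, however numerous, stay within \<open>2 ^ d\<close> of the main size.\<close>

lemma sum_small_subsets_le:
  fixes L :: real
  assumes "finite U" "real (card U) \<le> L"
  shows "(\<Sum>T\<in>{T. T \<subseteq> U \<and> card T \<le> d}. L ^ (d - card T) / fact (d - card T)) \<le> 2 ^ d * L ^ d / fact d"
proof -
  have L: "0 \<le> L" using assms(2) by linarith
  have fin: "finite {T. T \<subseteq> U \<and> card T \<le> d}" using assms(1) by auto
  have "(\<Sum>T\<in>{T. T \<subseteq> U \<and> card T \<le> d}. L ^ (d - card T) / fact (d - card T))
      = (\<Sum>j\<le>d. \<Sum>T\<in>{T \<in> {T. T \<subseteq> U \<and> card T \<le> d}. card T = j}. L ^ (d - card T) / fact (d - card T))"
    by (rule sum.group[symmetric]) (use fin in auto)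
  also have "\<dots> = (\<Sum>j\<le>d. real (card U choose j) * (L ^ (d - j) / fact (d - j)))"
  proof (rule sum.cong[OF refl])
    fix j assume j: "j \<in> {..d}"
    then have "{T \<in> {T. T \<subseteq> U \<and> card T \<le> d}. card T = j} = {T. T \<subseteq> U \<and> card T = j}" by auto
    then show "(\<Sum>T\<in>{T \<in> {T. T \<subseteq> U \<and> card T \<le> d}. card T = j}. L ^ (d - card T) / fact (d - card T))
       = real (card U choose j) * (L ^ (d - j) / fact (d - j))"
      using n_subsets[OF assms(1), of j] by simp
  qed
  also have "\<dots> \<le> (\<Sum>j\<le>d. (L ^ j / fact j) * (L ^ (d - j) / fact (d - j)))"
  proof (intro sum_mono mult_right_mono)
    fix j
    have "real ((card U choose j) * fact j) \<le> real (card U ^ j)"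
      by (simp only: of_nat_le_iff binomial_fact_pow)
    also have "\<dots> \<le> L ^ j" using assms(2) by (simp add: power_mono)
    finally show "real (card U choose j) \<le> L ^ j / fact j" by (simp add: field_simps)
  qed (use L in simp)
  also have "\<dots> = (\<Sum>j\<le>d. real (d choose j) * (L ^ d / fact d))"
  proof (rule sum.cong[OF refl])
    fix j assume "j \<in> {..d}"
    then have j: "j \<le> d" by simp
    then have "L ^ j * L ^ (d - j) = L ^ d" by (simp add: power_add[symmetric])
    then show "(L ^ j / fact j) * (L ^ (d - j) / fact (d - j)) = real (d choose j) * (L ^ d / fact d)"
      by (simp add: binomial_fact[OF j])
  qed
  also have "\<dots> = real (\<Sum>j\<le>d. d choose j) * (L ^ d / fact d)"
    by (simp only: sum_distrib_right of_nat_sum)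
  also have "(\<Sum>j\<le>d. d choose j) = 2 ^ d" by (rule choose_row_sum)
  finally show ?thesis by simp
qed

lemma sum_const_inner:
  "(\<Sum>x\<in>A. \<Sum>y\<in>B. c * g x) = real (card B) * c * (\<Sum>x\<in>A. (g x :: real))"
  by (simp add: sum_distrib_left mult.assoc)

text \<open>The index set is split into \<open>T\<close> inside \<open>U\<close> and
  \<open>D\<close> outside. Swaps in \<open>T\<close> permute \<open>S \<union> pts m U\<close> and
  only move the base permutation; swaps in \<open>D\<close> are invisible to the conditioning. Then
  \<open>wcoef_split_sq\<close> lowers the degree and \<open>CE_density\<close> relaxes the
  conditioning to \<open>S \<union> T\<close>. The factors are \<open>2 ^ (card T + card D)\<close>
  from Cauchy-Schwarz, \<open>2 ^ card D\<close> choices of \<open>C2\<close>, and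
  \<open>4 ^ card D\<close> for the density, divided by \<open>2 ^ card T\<close> from the
  splitting: in all \<open>16 ^ card D\<close>.\<close>

lemma CE_psi_sq_le:
  assumes P: "P \<subseteq> {1..m}" and m: "2 * m \<le> n" and S: "S \<subseteq> {1..n}" and SP: "S \<inter> pts m P = {}"
    and s: "s \<in> Sym n" and TU: "T \<subseteq> U" and U: "U \<subseteq> P" and D: "D \<subseteq> P - U"
    and big: "n \<le> 4 * (n - card (S \<union> pts m U) - card D)"
  shows "CE n (S \<union> pts m U) (\<lambda>r. (psi n m S (T \<union> D) f r)\<^sup>2) s
    \<le> 16 ^ card D * (\<Sum>C\<in>Pow T. \<Sum>B\<in>Pow T.
         CE n (S \<union> T) (\<lambda>r. (wcoef n m (S \<union> T) D (\<lambda>q. f (q \<circ> sw m B)) r)\<^sup>2) (s \<circ> sw m C))"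
proof -
  let ?V = "S \<union> pts m U"
  let ?w = "wcoef n m S (T \<union> D) f"
  let ?wB = "\<lambda>B. wcoef n m (S \<union> T) D (\<lambda>q. f (q \<circ> sw m B))"
  have sub: "T \<subseteq> {1..m}" "D \<subseteq> {1..m}" "U \<subseteq> {1..m}" "T \<inter> D = {}" using P U D TU by auto
  have fin: "finite T" "finite D" using sub by (meson finite_subset_interval finite_subset)+
  have cTD: "card (T \<union> D) = card T + card D" using fin sub by (intro card_Un_disjoint) auto
  have V: "?V \<subseteq> {1..n}" using S pts_subset[OF sub(3) m] by auto
  have VD: "?V \<inter> pts m D = {}"
    using SP pts_mono[of D P m] D pts_disjoint[OF sub(3,2)] by auto
  have DV: "?V \<inter> D = {}" using VD by (auto simp: pts_def)
  have SV: "S \<union> T \<subseteq> ?V" using TU by (auto simp: pts_def)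
  have step: "CE n ?V (\<lambda>r. (?w (r \<circ> sw m (C1 \<union> C2)))\<^sup>2) s
      \<le> 4 ^ card D / 2 ^ card T * (\<Sum>B\<in>Pow T. CE n (S \<union> T) (\<lambda>r. (?wB B r)\<^sup>2) (s \<circ> sw m C1))"
    if C: "C1 \<in> Pow T" "C2 \<in> Pow D" for C1 C2
  proof -
    have C1: "C1 \<subseteq> {1..m}" and C2: "C2 \<subseteq> {1..m}" using C sub by auto
    have t: "sw m C1 \<in> Sym n" by (rule sw_Sym[OF C1 m])
    have s': "s \<circ> sw m C1 \<in> Sym n" by (rule Sym_comp[OF s t])
    have "sdiff C1 C2 = C1 \<union> C2" using C sub by auto
    then have e: "sw m (C1 \<union> C2) = sw m C1 \<circ> sw m C2" using sw_sw[OF C1 C2] by simp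
    have "C1 \<subseteq> P" using C TU U by auto
    then have "S \<inter> pts m C1 = {}" using SP pts_mono[of C1 P m] by auto
    then have im: "sw m C1 ` ?V = ?V"
      using sw_image_fix[of S m C1] sw_pts[of C1 U m] C TU sub by (simp add: image_Un)
    have "CE n ?V (\<lambda>r. (?w (r \<circ> sw m (C1 \<union> C2)))\<^sup>2) s
       = CE n (sw m C1 ` ?V) (\<lambda>r. (\<lambda>q. (?w (q \<circ> sw m C2))\<^sup>2) (r \<circ> sw m C1)) s"
      by (simp add: e im comp_assoc)
    also have "\<dots> = CE n ?V (\<lambda>q. (?w (q \<circ> sw m C2))\<^sup>2) (s \<circ> sw m C1)"
      by (rule CE_right[OF t])
    also have "\<dots> = CE n ?V (\<lambda>q. (?w q)\<^sup>2) (s \<circ> sw m C1)"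
      by (rule CE_sw[OF C2 m _ s']) (use VD pts_mono[of C2 D m] C in auto)
    also have "\<dots> \<le> CE n ?V (\<lambda>q. (\<Sum>B\<in>Pow T. (?wB B q)\<^sup>2) / 2 ^ card T) (s \<circ> sw m C1)"
      by (rule CE_mono, rule wcoef_split_sq[OF sub(1,2,4)])
    also have "\<dots> = (\<Sum>B\<in>Pow T. CE n ?V (\<lambda>q. (?wB B q)\<^sup>2) (s \<circ> sw m C1)) / 2 ^ card T"
      by (simp add: CE_divide CE_sum)
    also have "\<dots> \<le> (\<Sum>B\<in>Pow T. 4 ^ card D * CE n (S \<union> T) (\<lambda>r. (?wB B r)\<^sup>2) (s \<circ> sw m C1)) / 2 ^ card T"
    proof (intro divide_right_mono sum_mono)
      fix B
      have "dep n (S \<union> T \<union> D) (?wB B)" by (rule wcoef_dep)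
      then have "dep n (S \<union> T \<union> D) (\<lambda>q. (?wB B q)\<^sup>2)" unfolding dep_def by metis
      then show "CE n ?V (\<lambda>q. (?wB B q)\<^sup>2) (s \<circ> sw m C1)
         \<le> 4 ^ card D * CE n (S \<union> T) (\<lambda>r. (?wB B r)\<^sup>2) (s \<circ> sw m C1)"
        by (intro CE_density[OF SV V _ DV _ _ s' big]) (use sub m in auto)
    qed simp
    finally show ?thesis by (simp add: sum_distrib_left[symmetric])
  qed
  have "CE n ?V (\<lambda>r. (psi n m S (T \<union> D) f r)\<^sup>2) s
     \<le> CE n ?V (\<lambda>r. 2 ^ card (T \<union> D) * (\<Sum>C\<in>Pow (T \<union> D). (?w (r \<circ> sw m C))\<^sup>2)) s"
    by (rule CE_mono, rule psi_sq_le) (use fin in auto)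
  also have "\<dots> = 2 ^ card (T \<union> D) * (\<Sum>C1\<in>Pow T. \<Sum>C2\<in>Pow D. CE n ?V (\<lambda>r. (?w (r \<circ> sw m (C1 \<union> C2)))\<^sup>2) s)"
    by (simp add: CE_cmult CE_sum sum_Pow_Un[OF sub(4)])
  also have "\<dots> \<le> 2 ^ card (T \<union> D) * (\<Sum>C1\<in>Pow T. \<Sum>C2\<in>Pow D.
      4 ^ card D / 2 ^ card T * (\<Sum>B\<in>Pow T. CE n (S \<union> T) (\<lambda>r. (?wB B r)\<^sup>2) (s \<circ> sw m C1)))"
    by (intro mult_left_mono sum_mono step) auto
  also have "\<dots> = (2 ^ card (T \<union> D) * 2 ^ card D * (4 ^ card D / 2 ^ card T)) *
      (\<Sum>C1\<in>Pow T. \<Sum>B\<in>Pow T. CE n (S \<union> T) (\<lambda>r. (?wB B r)\<^sup>2) (s \<circ> sw m C1))"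
  proof -
    have "real (card (Pow D)) = 2 ^ card D" using fin by (simp add: card_Pow)
    then show ?thesis by (simp only: sum_const_inner mult.assoc)
  qed
  also have "(2 ^ card (T \<union> D) * 2 ^ card D * (4 ^ card D / 2 ^ card T)) = (16 ^ card D :: real)"
  proof -
    have "(16::real) ^ card D = 2 ^ card D * 2 ^ card D * 4 ^ card D" by (simp flip: power_mult_distrib)
    then show ?thesis by (simp add: cTD power_add)
  qed
  finally show ?thesis .
qed

text \<open>The sets \<open>D\<close> are grouped by their trace \<open>T\<close> on
  \<open>U\<close>; by \<open>CE_psi_sq_le\<close> each group is controlled by weights of degree
  \<open>d - card T\<close> with \<open>T\<close> added to the prescribed points.\<close>

lemma CE_Y_le:
  assumes P: "P \<subseteq> {1..m}" and m: "2 * m \<le> n" and S: "S \<subseteq> {1..n}" and SP: "S \<inter> pts m P = {}"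
    and s: "s \<in> Sym n" and U: "U \<subseteq> P"
    and big: "n \<le> 4 * (n - card (S \<union> pts m U) - d)"
    and \<beta>: "\<And>T C B. T \<subseteq> U \<Longrightarrow> card T \<le> d \<Longrightarrow> C \<subseteq> T \<Longrightarrow> B \<subseteq> T \<Longrightarrow>
       wt n m (S \<union> T) (P - U) (d - card T) (\<lambda>q. f (q \<circ> sw m B)) (s \<circ> sw m C) \<le> \<beta> T"
  shows "CE n (S \<union> pts m U) (\<lambda>r. \<Sum>D\<in>subs P d. (psi n m S D f r)\<^sup>2) s
    \<le> 16 ^ d * (\<Sum>T\<in>{T. T \<subseteq> U \<and> card T \<le> d}. \<beta> T)"
proof -
  have fin: "finite P" "finite U" using P U by (meson finite_subset_interval finite_subset)+
  let ?V = "S \<union> pts m U"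
  have "CE n ?V (\<lambda>r. \<Sum>D\<in>subs P d. (psi n m S D f r)\<^sup>2) s
     = (\<Sum>T\<in>{T. T \<subseteq> U \<and> card T \<le> d}. \<Sum>D\<in>subs (P - U) (d - card T). CE n ?V (\<lambda>r. (psi n m S (T \<union> D) f r)\<^sup>2) s)"
    unfolding CE_sum by (rule sum_subs_split[OF fin(1) U])
  also have "\<dots> \<le> (\<Sum>T\<in>{T. T \<subseteq> U \<and> card T \<le> d}. 16 ^ d * \<beta> T)"
  proof (rule sum_mono)
    fix T assume "T \<in> {T. T \<subseteq> U \<and> card T \<le> d}"
    then have T: "T \<subseteq> U" "card T \<le> d" by auto
    have finT: "finite T" using T fin by (meson finite_subset)
    let ?q = "\<lambda>D C B. CE n (S \<union> T) (\<lambda>r. (wcoef n m (S \<union> T) D (\<lambda>q. f (q \<circ> sw m B)) r)\<^sup>2) (s \<circ> sw m C)"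
    \<comment> \<open>Taking \<open>B\<close> and \<open>C\<close> empty shows that
      \<open>\<beta> T\<close> is non-negative, which is needed to enlarge the
      \<open>4 ^ card T\<close> choices of \<open>C\<close> and \<open>B\<close> to
      \<open>16 ^ card T\<close>.\<close>
    have "0 \<le> wt n m (S \<union> T) (P - U) (d - card T) (\<lambda>q. f (q \<circ> sw m {})) (s \<circ> sw m {})"
      unfolding wt_def by (intro sum_nonneg CE_nonneg) auto
    then have b0: "0 \<le> \<beta> T" using \<beta>[OF T, of "{}" "{}"] by simp
    have "(\<Sum>D\<in>subs (P - U) (d - card T). CE n ?V (\<lambda>r. (psi n m S (T \<union> D) f r)\<^sup>2) s)
       \<le> (\<Sum>D\<in>subs (P - U) (d - card T). 16 ^ (d - card T) * (\<Sum>C\<in>Pow T. \<Sum>B\<in>Pow T. ?q D C B))"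
    proof (rule sum_mono)
      fix D assume D: "D \<in> subs (P - U) (d - card T)"
      have "CE n ?V (\<lambda>r. (psi n m S (T \<union> D) f r)\<^sup>2) s \<le> 16 ^ card D * (\<Sum>C\<in>Pow T. \<Sum>B\<in>Pow T. ?q D C B)"
        by (rule CE_psi_sq_le[OF P m S SP s T(1) U]) (use D big in auto)
      then show "CE n ?V (\<lambda>r. (psi n m S (T \<union> D) f r)\<^sup>2) s \<le> 16 ^ (d - card T) * (\<Sum>C\<in>Pow T. \<Sum>B\<in>Pow T. ?q D C B)"
        using D by simp
    qed
    also have "\<dots> = 16 ^ (d - card T) * (\<Sum>C\<in>Pow T. \<Sum>B\<in>Pow T. \<Sum>D\<in>subs (P - U) (d - card T). ?q D C B)"
      unfolding sum_distrib_left[symmetric]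
      by (subst sum.swap, rule arg_cong[where f = "\<lambda>x. _ * x"], rule sum.cong[OF refl], rule sum.swap)
    also have "\<dots> \<le> 16 ^ (d - card T) * (\<Sum>C\<in>Pow T. \<Sum>B\<in>Pow T. \<beta> T)"
      by (intro mult_left_mono sum_mono) (use \<beta>[OF T] in \<open>auto simp: wt_def\<close>)
    also have "\<dots> = 16 ^ (d - card T) * 4 ^ card T * \<beta> T"
    proof -
      have "(4::real) ^ card T = 2 ^ card T * 2 ^ card T" by (simp flip: power_mult_distrib)
      then show ?thesis using finT by (simp add: card_Pow)
    qed
    also have "\<dots> \<le> 16 ^ (d - card T) * 16 ^ card T * \<beta> T"
      by (intro mult_right_mono mult_left_mono power_mono b0) auto
    also have "\<dots> = 16 ^ d * \<beta> T" using T(2) by (simp flip: power_add)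
    finally show "(\<Sum>D\<in>subs (P - U) (d - card T). CE n ?V (\<lambda>r. (psi n m S (T \<union> D) f r)\<^sup>2) s) \<le> 16 ^ d * \<beta> T" .
  qed
  finally show ?thesis by (simp add: sum_distrib_left)
qed

text \<open>Averaging over all swaps of \<open>P\<close> leaves the moment unchanged, because
  \<open>pts m P\<close> avoids \<open>S\<close>. For fixed \<open>r\<close> the sum along the orbit
  of \<open>r\<close> is a chaos with coefficients \<open>psi n m S D f r\<close>, so
  \<open>bonami\<close> applies pointwise; as all \<open>D\<close> have size \<open>d\<close>, its
  weights become a single factor.\<close>

lemma CE_bonami:
  assumes P: "P \<subseteq> {1..m}" and m: "2 * m \<le> n" and S: "S \<subseteq> {1..n}" and SP: "S \<inter> pts m P = {}"
    and s: "s \<in> Sym n" and k: "0 < k"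
  shows "CE n S (\<lambda>r. (\<Sum>D\<in>subs P d. psi n m S D f r) ^ (2 * k)) s
    \<le> real (2 * k) ^ (d * k) * CE n S (\<lambda>r. (\<Sum>D\<in>subs P d. (psi n m S D f r)\<^sup>2) ^ k) s"
proof -
  have fin: "finite P" using P finite_subset by blast
  let ?G = "\<lambda>r. \<Sum>D\<in>subs P d. psi n m S D f r"
  let ?y = "\<lambda>r D. if D \<in> subs P d then psi n m S D f r else 0"
  have sum_y: "(\<Sum>D\<in>Pow P. g D * ?y r D) = (\<Sum>D\<in>subs P d. g D * psi n m S D f r)" for g r
    by (rule sum.mono_neutral_cong_right) (use fin in auto)
  have sum_y2: "(\<Sum>D\<in>Pow P. real (2 * k) ^ card D * (?y r D)\<^sup>2) = real (2 * k) ^ d * (\<Sum>D\<in>subs P d. (psi n m S D f r)\<^sup>2)" for r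
    unfolding sum_distrib_left by (rule sum.mono_neutral_cong_right) (use fin in auto)
  have "2 ^ card P * CE n S (\<lambda>r. ?G r ^ (2 * k)) s = (\<Sum>B\<in>Pow P. CE n S (\<lambda>r. ?G (r \<circ> sw m B) ^ (2 * k)) s)"
  proof -
    have "CE n S (\<lambda>r. ?G (r \<circ> sw m B) ^ (2 * k)) s = CE n S (\<lambda>r. ?G r ^ (2 * k)) s" if "B \<in> Pow P" for B
      by (rule CE_sw[OF _ m _ s]) (use that P SP pts_mono[of B P m] in auto)
    then show ?thesis using fin by (simp add: card_Pow)
  qed
  also have "\<dots> = (\<Sum>B\<in>Pow P. CE n S (\<lambda>r. (\<Sum>D\<in>Pow P. sg (B \<inter> D) * ?y r D) ^ (2 * k)) s)"
  proof (intro sum.cong refl CE_cong)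
    fix B r assume B: "B \<in> Pow P" and r: "r \<in> cls n S s"
    have "?G (r \<circ> sw m B) = (\<Sum>D\<in>subs P d. sg (B \<inter> D) * psi n m S D f r)"
    proof (rule sum.cong[OF refl])
      fix D assume D: "D \<in> subs P d"
      show "psi n m S D f (r \<circ> sw m B) = sg (B \<inter> D) * psi n m S D f r"
        by (rule psi_sw[OF _ _ m _ _ cls_subset[OF r]])
          (use D B P SP pts_mono[of B P m] pts_mono[of D P m] in auto)
    qed
    then show "?G (r \<circ> sw m B) ^ (2 * k) = (\<Sum>D\<in>Pow P. sg (B \<inter> D) * ?y r D) ^ (2 * k)"
      by (simp only: sum_y)
  qed
  also have "\<dots> = CE n S (\<lambda>r. \<Sum>B\<in>Pow P. (\<Sum>D\<in>Pow P. sg (B \<inter> D) * ?y r D) ^ (2 * k)) s"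
    by (simp only: CE_sum)
  also have "\<dots> \<le> CE n S (\<lambda>r. 2 ^ card P * (\<Sum>D\<in>Pow P. real (2 * k) ^ card D * (?y r D)\<^sup>2) ^ k) s"
    by (intro CE_mono bonami fin k)
  also have "\<dots> = 2 ^ card P * (real (2 * k) ^ (d * k) * CE n S (\<lambda>r. (\<Sum>D\<in>subs P d. (psi n m S D f r)\<^sup>2) ^ k) s)"
    by (simp only: sum_y2 CE_cmult power_mult_distrib power_mult)
  finally show ?thesis by simp
qed

text \<open>If the claim fails then \<open>X < Q / K ^ d\<close>, and substituting this makes the
  right-hand side a proper fraction of \<open>Q\<^sup>2\<close>. Here 288 = 9 * 2 * 16 collects
  \<open>exp (2 * real d) \<le> 9 ^ d\<close>, the bound \<open>kd2\<close> and the given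
  \<open>16 ^ d\<close>, and 576 = 2 * 288 includes the \<open>2 ^ d\<close> of the lower-degree
  terms. The exponent \<open>d - 1\<close> on \<open>K\<close> gives those terms a further factor
  \<open>1 / K\<close>.\<close>

lemma numeric_step:
  fixes Q X K L g0 R :: real and k d :: nat
  assumes Q: "0 \<le> Q" and K: "2000 \<le> K" and d: "1 \<le> d" and kd: "real (k * d) \<le> L" and R: "1 \<le> R"
    and X: "X = g0\<^sup>2 * R ^ (2 * d) * L ^ d / fact d"
    and le: "Q\<^sup>2 \<le> g0\<^sup>2 * exp (2 * real d) * real (2 * k) ^ d * (16 ^ d * (Q + 2 ^ d * K ^ (d - 1) * X))"
  shows "Q \<le> K ^ d * X"
proof (rule ccontr)
  assume neg: "\<not> Q \<le> K ^ d * X"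
  have L0: "0 \<le> L" using kd by (meson of_nat_0_le_iff order_trans)
  have X0: "0 \<le> X" unfolding X using L0 R by simp
  have K0: "0 < K" using K by simp
  have Qpos: "0 < Q" using neg X0 K0 by (smt (verit) zero_le_mult_iff zero_le_power)
  \<comment> \<open>With \<open>fact d \<le> d ^ d\<close> and \<open>k * d \<le> L\<close>, the
    power of \<open>k\<close> is traded for \<open>L ^ d / fact d\<close>.\<close>
  have kd2: "real (2 * k) ^ d \<le> 2 ^ d * (L ^ d / fact d)"
  proof -
    have "real k ^ d * fact d \<le> real k ^ d * real d ^ d"
      using fact_le_power[of d, where 'a = real] by (intro mult_left_mono) auto
    also have "\<dots> \<le> L ^ d" using kd by (simp add: power_mult_distrib[symmetric] power_mono)
    finally have "real k ^ d \<le> L ^ d / fact d" by (simp add: field_simps)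
    then have "2 ^ d * real k ^ d \<le> 2 ^ d * (L ^ d / fact d)" by (intro mult_left_mono) auto
    then show ?thesis by (simp add: power_mult_distrib)
  qed
  have e: "exp (2 * real d) \<le> 9 ^ d"
  proof -
    have "exp (1::real) \<le> 3" by (rule exp_le)
    then have "exp (1::real) ^ (2 * d) \<le> 3 ^ (2 * d)" by (intro power_mono) auto
    moreover have "exp (2 * real d) = exp 1 ^ (2 * d)" by (simp add: exp_of_nat_mult[symmetric])
    ultimately show ?thesis by (simp add: power_mult)
  qed
  have gX: "g0\<^sup>2 * (L ^ d / fact d) \<le> X"
  proof -
    have "1 \<le> R ^ (2 * d)" using R by simp
    then have "g0\<^sup>2 * (L ^ d / fact d) * 1 \<le> g0\<^sup>2 * (L ^ d / fact d) * R ^ (2 * d)"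
      using L0 by (intro mult_left_mono) auto
    then show ?thesis unfolding X by (simp add: mult_ac)
  qed
  let ?W = "Q + 2 ^ d * K ^ (d - 1) * X"
  have W0: "0 \<le> ?W" using Q X0 K0 by (intro add_nonneg_nonneg mult_nonneg_nonneg) auto
  have "Q\<^sup>2 \<le> g0\<^sup>2 * exp (2 * real d) * real (2 * k) ^ d * (16 ^ d * ?W)" by (rule le)
  also have "\<dots> \<le> g0\<^sup>2 * 9 ^ d * (2 ^ d * (L ^ d / fact d)) * (16 ^ d * ?W)"
    using e kd2 W0 L0 by (intro mult_right_mono mult_mono mult_left_mono) auto
  also have "\<dots> = 288 ^ d * ?W * (g0\<^sup>2 * (L ^ d / fact d))"
  proof -
    have "(288::real) ^ d = 9 ^ d * 2 ^ d * 16 ^ d" by (simp flip: power_mult_distrib)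
    then show ?thesis by (simp only: mult_ac)
  qed
  also have "\<dots> \<le> 288 ^ d * ?W * X"
    using gX W0 by (intro mult_left_mono) auto
  also have "\<dots> = 288 ^ d * (Q * X) + 576 ^ d * K ^ (d - 1) * X * X"
  proof -
    have "(576::real) ^ d = 288 ^ d * 2 ^ d" by (simp flip: power_mult_distrib)
    then show ?thesis by (simp only: distrib_left distrib_right mult_ac)
  qed
  also have "\<dots> \<le> 288 ^ d * (Q * (Q / K ^ d)) + 576 ^ d * K ^ (d - 1) * (Q / K ^ d) * (Q / K ^ d)"
  proof -
    have XQ: "X \<le> Q / K ^ d" using neg K0 by (simp add: field_simps)
    show ?thesis using XQ X0 Q K0
      by (intro add_mono mult_mono mult_left_mono) auto
  qed
  also have "\<dots> = ((288 / K) ^ d + (576 / K) ^ d * (1 / K)) * Q\<^sup>2"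
  proof -
    have "K ^ d = K ^ (d - 1) * K" using d by (cases d) auto
    then show ?thesis using K0 by (simp add: power_divide power2_eq_square field_simps)
  qed
  also have "\<dots> \<le> (1 / 2 + 1 * (1 / 2000)) * Q\<^sup>2"
  proof (intro mult_right_mono add_mono mult_mono)
    have "(288 / K) ^ d \<le> (288 / K) ^ 1"
      by (rule power_decreasing) (use d K in auto)
    also have "\<dots> \<le> 1 / 2" using K by simp
    finally show "(288 / K) ^ d \<le> 1 / 2" .
    show "(576 / K) ^ d \<le> 1" by (rule power_le_one) (use K in auto)
    show "1 / K \<le> 1 / 2000" using K by (simp add: frac_le)
  qed (use K in auto)
  finally have "Q\<^sup>2 \<le> (1 / 2 + 1 / 2000) * Q\<^sup>2" by simp
  moreover have "0 < Q\<^sup>2" using Qpos by simp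
  ultimately show False by simp
qed

lemma Del_empty [simp]: "Del m {} F = F"
  by (simp add: Del_def fun_eq_iff)

lemma wt_nonneg: "0 \<le> wt n m S P d f s"
  unfolding wt_def by (intro sum_nonneg CE_nonneg) auto

lemma wt_mono:
  assumes "finite P" "P' \<subseteq> P" "s \<in> Sym n" "r \<in> cls n S s"
  shows "wt n m S P' d f r \<le> wt n m S P d f s"
proof -
  have "wt n m S P' d f r = wt n m S P' d f s"
    unfolding wt_def by (intro sum.cong refl dep_cls[OF CE_dep assms(3,4)])
  also have "\<dots> \<le> wt n m S P d f s"
    unfolding wt_def
  proof (rule sum_mono2)
    show "finite (subs P d)" using assms(1) by (auto intro: finite_subset[of _ "Pow P"])
  qed (use assms(2) in \<open>auto intro!: CE_nonneg\<close>)
  finally show ?thesis .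
qed

lemma wt_0:
  assumes "finite P" "S \<subseteq> {1..n}" "s \<in> Sym n"
  shows "wt n m S P 0 f s = (CE n S f s)\<^sup>2"
proof -
  have "subs P 0 = {{}}" using assms(1) by (auto dest: finite_subset)
  moreover have "dep n S (\<lambda>r. (CE n S f r)\<^sup>2)"
    using CE_dep[of n S f] unfolding dep_def by metis
  ultimately show ?thesis using assms by (simp add: wt_def wcoef_def CE_idem)
qed

text \<open>The \<open>k\<close>-th root of the Hoelder-Bonami estimate. The missing power of
  \<open>g0\<close> costs \<open>1 / g0 \<le> exp L\<close>, which \<open>L \<le> 2 * d * k\<close>
  reduces to \<open>exp (2 * d)\<close> after the root.\<close>

lemma level_bound_numeric:
  fixes Q g0 \<gamma> Z L :: real and k d :: nat
  assumes Q: "0 \<le> Q" and Z: "0 \<le> Z" and k: "0 < k" and \<gamma>: "0 < \<gamma>" and g: "\<gamma> \<le> g0"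
    and L: "L = ln (1 / \<gamma>)" "L \<le> 2 * real d * real k"
    and le: "(2 ^ d * Q) ^ (2 * k) \<le> g0 ^ (2 * k - 1) * (real (2 * k) ^ (d * k) * Z ^ k)"
  shows "Q\<^sup>2 \<le> g0\<^sup>2 * exp (2 * real d) * real (2 * k) ^ d * Z"
proof -
  have g0: "0 < g0" using \<gamma> g by simp
  have "1 / g0 \<le> 1 / \<gamma>" using \<gamma> g by (simp add: frac_le)
  also have "1 / \<gamma> = exp L" using \<gamma> L(1) by simp
  also have "\<dots> \<le> exp (2 * real d * real k)" using L(2) by simp
  also have "\<dots> = exp (2 * real d) ^ k" by (simp add: exp_of_nat_mult[symmetric] mult_ac)
  finally have e: "1 / g0 \<le> exp (2 * real d) ^ k" .
  have "(Q\<^sup>2) ^ k = Q ^ (2 * k)" by (simp add: power_mult)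
  also have "\<dots> \<le> (2 ^ d * Q) ^ (2 * k)"
    using Q mult_right_mono[of 1 "2 ^ d" Q] by (intro power_mono) auto
  also have "\<dots> \<le> g0 ^ (2 * k - 1) * (real (2 * k) ^ (d * k) * Z ^ k)" by (rule le)
  also have "g0 ^ (2 * k - 1) = (g0\<^sup>2) ^ k * (1 / g0)"
  proof -
    have "2 * k = Suc (2 * k - 1)" using k by simp
    then have "g0 ^ (2 * k) = g0 * g0 ^ (2 * k - 1)" by (metis power_Suc)
    then show ?thesis using g0 by (simp add: power_mult[symmetric])
  qed
  also have "(g0\<^sup>2) ^ k * (1 / g0) * (real (2 * k) ^ (d * k) * Z ^ k)
      \<le> (g0\<^sup>2) ^ k * exp (2 * real d) ^ k * (real (2 * k) ^ (d * k) * Z ^ k)"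
    using e Z by (intro mult_right_mono mult_left_mono) auto
  also have "\<dots> = (g0\<^sup>2 * exp (2 * real d) * real (2 * k) ^ d * Z) ^ k"
    by (simp only: power_mult_distrib power_mult mult_ac)
  finally have "(Q\<^sup>2) ^ k \<le> (g0\<^sup>2 * exp (2 * real d) * real (2 * k) ^ d * Z) ^ k" .
  then show ?thesis using k Z by (subst (asm) power_mono_iff) auto
qed

text \<open>The bound is shaped for the induction: adding a \<open>j\<close>-set to \<open>S\<close>
  multiplies the first factor by \<open>R ^ (2 * j)\<close>, and lowering the degree by
  \<open>j\<close> takes the same power away from \<open>R ^ (2 * d)\<close>. Likewise
  \<open>card S + d\<close> is unchanged, so the condition on \<open>n\<close> is inherited. The
  function \<open>f\<close> varies because splitting composes it with swaps, while
  \<open>\<gamma>\<close> and hence \<open>L\<close> stay fixed.\<close>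

lemma level_bound:
  assumes R: "1 \<le> R" and \<gamma>: "0 < \<gamma>" and L: "L = ln (1 / \<gamma>)" and m: "4 * m \<le> n"
    and "spread n R \<gamma> f" "S \<subseteq> {1..n}" "P \<subseteq> {1..m}" "S \<inter> pts m P = {}" "s \<in> Sym n"
    "4 * (card S + d) \<le> n" "8 * real d \<le> L"
  shows "wt n m S P d f s \<le> (R ^ card S * \<gamma>)\<^sup>2 * R ^ (2 * d) * 2000 ^ d * L ^ d / fact d"
  using assms(5-)
proof (induction d arbitrary: f S P s rule: less_induct)
  case (less d)
  note f = less.prems(1) and S = less.prems(2) and P = less.prems(3) and SP = less.prems(4)
    and s = less.prems(5) and nd = less.prems(6) and Ld = less.prems(7)
  have finP: "finite P" using P by (rule finite_subset_interval)
  have finS: "finite S" using S by (rule finite_subset_interval)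
  have m2: "2 * m \<le> n" using m by simp
  let ?g = "R ^ card S * \<gamma>"
  have R1: "1 \<le> R ^ card S" using R by simp
  have g: "\<gamma> \<le> ?g" using mult_right_mono[OF R1, of \<gamma>] \<gamma> by simp
  have f01: "0 \<le> f r" "f r \<le> 1" if "r \<in> Sym n" for r using f that by (auto simp: spread_def)
  have CEf: "0 \<le> CE n S f s" "CE n S f s \<le> ?g"
    using f s S f01 by (auto simp: spread_def intro!: CE_nonneg dest: cls_subset)
  show ?case
  proof (cases "d = 0")
    case True
    then show ?thesis using wt_0[OF finP S s, of m f] CEf by (simp add: power_mono)
  next
    case False
    then have d: "1 \<le> d" by simp
    \<comment> \<open>\<open>2 * k\<close> is about \<open>L / d\<close>, so that \<open>\<gamma>\<close> to the power \<open>-1 / (2 * k)\<close> is at most \<open>exp d\<close>\<close>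
    define k where "k = nat \<lceil>L / (2 * real d)\<rceil>"
    have L8: "8 \<le> L" using Ld d by (smt (verit) of_nat_1 of_nat_le_iff)
    have q0: "0 < L / (2 * real d)" using L8 d by simp
    have kr: "real k = real_of_int \<lceil>L / (2 * real d)\<rceil>"
      unfolding k_def using q0 by simp
    have k0: "0 < k" using q0 unfolding k_def by simp
    have kge: "L / (2 * real d) \<le> real k" unfolding kr by (rule le_of_int_ceiling)
    have Lk: "L \<le> 2 * real d * real k"
      using kge d by (simp add: divide_le_eq mult.commute)
    \<comment> \<open>Rounding up adds at most \<open>d\<close> to \<open>L / 2\<close>, which
      \<open>8 * d \<le> L\<close> absorbs. So the \<open>d * k\<close> pairs met in the moment
      bound number at most \<open>L\<close>, as \<open>sum_small_subsets_le\<close>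
      requires.\<close>
    have "real k \<le> L / (2 * real d) + 1" unfolding kr by linarith
    then have "real k * real d \<le> (L / (2 * real d) + 1) * real d" by (intro mult_right_mono) auto
    also have "\<dots> = L / 2 + real d" using d by (simp add: field_simps)
    also have "\<dots> \<le> L" using Ld L8 by simp
    finally have kd: "real (k * d) \<le> L" by simp
    define Q where "Q = wt n m S P d f s"
    have Q0: "0 \<le> Q" unfolding Q_def by (rule wt_nonneg)
    define X where "X = ?g\<^sup>2 * R ^ (2 * d) * L ^ d / fact d"
    have X0: "0 \<le> X" unfolding X_def using R L8 by simp
    \<comment> \<open>A non-empty trace lowers the degree, so at most \<open>d - 1\<close> factors
      2000 occur in the corresponding terms; the spared factor is used in
      \<open>numeric_step\<close>.\<close>
    define c where "c = ?g\<^sup>2 * R ^ (2 * d) * 2000 ^ (d - 1)"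
    have c0: "0 \<le> c" unfolding c_def using R by simp
    define Z where "Z = 16 ^ d * (Q + 2 ^ d * 2000 ^ (d - 1) * X)"
    have Z0: "0 \<le> Z" unfolding Z_def using Q0 X0 by simp
    let ?Y = "\<lambda>r. \<Sum>D\<in>subs P d. (psi n m S D f r)\<^sup>2"
    have Zb: "CE n (S \<union> pts m U) ?Y r \<le> Z"
      if U: "U \<subseteq> P" and cU: "card U \<le> d * k" and r: "r \<in> cls n S s" for U r
    proof -
      have finU: "finite U" using U finP by (rule finite_subset)
      have rS: "r \<in> Sym n" using r by (rule cls_subset)
      \<comment> \<open>The empty trace reproduces the unknown \<open>Q\<close>; all other traces
        fall under the induction hypothesis.\<close>
      let ?\<beta> = "\<lambda>T. if T = {} then Q else c * (L ^ (d - card T) / fact (d - card T))"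
      \<comment> \<open>At most three quarters of the points are used: \<open>card S + d\<close>
        takes a quarter, and \<open>pts m U\<close>, by \<open>4 * m \<le> n\<close>, at most a
        half.\<close>
      have "card U \<le> m" using card_mono[of "{1..m}" U] U P by auto
      then have "card (S \<union> pts m U) \<le> card S + 2 * m"
        using card_Un_le[of S "pts m U"] card_pts[OF finU, of m] by linarith
      then have "4 * card (S \<union> pts m U) + 4 * d \<le> 4 * (card S + d) + 2 * (4 * m)" by simp
      also have "\<dots> \<le> n + 2 * n" using nd m by (intro add_mono mult_le_mono2)
      finally have big: "n \<le> 4 * (n - card (S \<union> pts m U) - d)" by simp
      have "CE n (S \<union> pts m U) ?Y r \<le> 16 ^ d * (\<Sum>T\<in>{T. T \<subseteq> U \<and> card T \<le> d}. ?\<beta> T)"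
      proof (rule CE_Y_le[OF P m2 S SP rS U big])
        fix T C B assume T: "T \<subseteq> U" "card T \<le> d" and C: "C \<subseteq> T" and B: "B \<subseteq> T"
        show "wt n m (S \<union> T) (P - U) (d - card T) (\<lambda>q. f (q \<circ> sw m B)) (r \<circ> sw m C) \<le> ?\<beta> T"
        proof (cases "T = {}")
          case True
          then have "B = {}" "C = {}" using B C by auto
          then show ?thesis using True wt_mono[OF finP _ s r, of "P - U" m d f] by (simp add: Q_def)
        next
          case False
          have finT: "finite T" using T(1) finU by (rule finite_subset)
          then have j: "1 \<le> card T" using False by (simp add: Suc_le_eq card_gt_0_iff)
          have Tm: "T \<subseteq> {1..m}" using T U P by auto
          have BC: "sw m B \<in> Sym n" "sw m C \<in> Sym n"
            using sw_Sym[OF _ m2] B C Tm by (meson order_trans)+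
          have "T \<subseteq> pts m P" using T U by (auto simp: pts_def)
          then have cST: "card (S \<union> T) = card S + card T"
            using SP finS finT by (intro card_Un_disjoint) auto
          have "T \<inter> pts m (P - U) = {}" using Tm T P by (force simp: pts_def)
          then have dis: "(S \<union> T) \<inter> pts m (P - U) = {}"
            using SP pts_mono[of "P - U" P m] by auto
          have "wt n m (S \<union> T) (P - U) (d - card T) (\<lambda>q. f (q \<circ> sw m B)) (r \<circ> sw m C)
            \<le> (R ^ card (S \<union> T) * \<gamma>)\<^sup>2 * R ^ (2 * (d - card T)) * 2000 ^ (d - card T) * L ^ (d - card T) / fact (d - card T)"
          proof (rule less.IH)
            show "d - card T < d" using j d by simp
            show "spread n R \<gamma> (\<lambda>q. f (q \<circ> sw m B))" by (rule spread_right[OF f BC(1)])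
            show "S \<union> T \<subseteq> {1..n}" using S Tm m by force
            show "P - U \<subseteq> {1..m}" using P by auto
            show "(S \<union> T) \<inter> pts m (P - U) = {}" by (rule dis)
            show "r \<circ> sw m C \<in> Sym n" by (rule Sym_comp[OF rS BC(2)])
            show "4 * (card (S \<union> T) + (d - card T)) \<le> n" using cST nd T(2) by simp
            show "8 * real (d - card T) \<le> L" using Ld by simp
          qed
          also have "(R ^ card (S \<union> T) * \<gamma>)\<^sup>2 * R ^ (2 * (d - card T)) = ?g\<^sup>2 * R ^ (2 * d)"
          proof -
            have "R ^ (2 * d) = (R ^ card T)\<^sup>2 * R ^ (2 * (d - card T))"
              using T(2) by (simp add: power_mult[symmetric] power_add[symmetric] algebra_simps)
            then show ?thesis by (simp add: cST power_add power_mult_distrib)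
          qed
          also have "?g\<^sup>2 * R ^ (2 * d) * 2000 ^ (d - card T) * L ^ (d - card T) / fact (d - card T)
             \<le> ?g\<^sup>2 * R ^ (2 * d) * 2000 ^ (d - 1) * L ^ (d - card T) / fact (d - card T)"
            using j R L8 by (intro divide_right_mono mult_right_mono mult_left_mono power_increasing) auto
          finally show ?thesis using False by (simp add: c_def comp_def)
        qed
      qed
      also have "(\<Sum>T\<in>{T. T \<subseteq> U \<and> card T \<le> d}. ?\<beta> T) \<le> Q + c * (2 ^ d * L ^ d / fact d)"
      proof -
        let ?I = "{T. T \<subseteq> U \<and> card T \<le> d}"
        have fin: "finite ?I" using finU by auto
        have "(\<Sum>T\<in>?I. ?\<beta> T) = Q + (\<Sum>T\<in>?I - {{}}. ?\<beta> T)"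
          by (subst sum.remove[OF fin, of "{}"]) auto
        also have "(\<Sum>T\<in>?I - {{}}. ?\<beta> T) = (\<Sum>T\<in>?I - {{}}. c * (L ^ (d - card T) / fact (d - card T)))"
          by (intro sum.cong) auto
        also have "\<dots> \<le> (\<Sum>T\<in>?I. c * (L ^ (d - card T) / fact (d - card T)))"
          using fin c0 L8 by (intro sum_mono2) auto
        also have "\<dots> = c * (\<Sum>T\<in>?I. L ^ (d - card T) / fact (d - card T))"
          by (rule sum_distrib_left[symmetric])
        also have "\<dots> \<le> c * (2 ^ d * L ^ d / fact d)"
        proof (rule mult_left_mono[OF sum_small_subsets_le[OF finU] c0])
          have "real (card U) \<le> real (d * k)" using cU by (simp only: of_nat_le_iff)
          then show "real (card U) \<le> L" using kd by (simp add: mult.commute)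
        qed
        finally show ?thesis by simp
      qed
      also have "16 ^ d * (Q + c * (2 ^ d * L ^ d / fact d)) = Z"
        by (simp add: Z_def c_def X_def mult_ac)
      finally show ?thesis by simp
    qed
    have depy: "dep n (S \<union> pts m D) (\<lambda>r. (psi n m S D f r)\<^sup>2)" if "D \<in> subs P d" for D
    proof -
      have "dep n (S \<union> pts m D) (psi n m S D f)"
        using that P SP pts_mono[of D P m] by (intro psi_dep[OF _ m2]) auto
      then show ?thesis unfolding dep_def by metis
    qed
    \<comment> \<open>The moment bound starts from the trivial weight with empty \<open>U\<close>;
      each of the \<open>k\<close> factors adds at most \<open>d\<close> pairs, whence
      \<open>N = d * k\<close>.\<close>
    have "CE n S (\<lambda>r. 1 * ?Y r ^ k) s \<le> Z ^ k * CE n S (\<lambda>r. 1) s"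
    proof (rule moment_bound[OF P m2 S s, where N = "d * k" and U = "{}" and d = d])
      show "D \<subseteq> P \<and> card D = d" if "D \<in> subs P d" for D using that by simp
      show "CE n (S \<union> pts m U) ?Y r \<le> Z" if "U \<subseteq> P" "card U \<le> d * k" "r \<in> cls n S s" for U r
        using that by (rule Zb)
    qed (use depy Z0 in \<open>simp_all add: dep_def[of n _ "\<lambda>_. 1"]\<close>)
    then have Yk: "CE n S (\<lambda>r. ?Y r ^ k) s \<le> Z ^ k" by (simp add: CE_const[OF S s])
    let ?G = "\<lambda>r. \<Sum>D\<in>subs P d. psi n m S D f r"
    have "CE n S (\<lambda>r. f r * ?G r) s = (\<Sum>D\<in>subs P d. CE n S (\<lambda>r. f r * psi n m S D f r) s)"
      by (simp add: sum_distrib_left CE_sum)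
    also have "\<dots> = (\<Sum>D\<in>subs P d. 2 ^ d * CE n S (\<lambda>r. (wcoef n m S D f r)\<^sup>2) s)"
    proof (rule sum.cong[OF refl])
      fix D assume D: "D \<in> subs P d"
      have "CE n S (\<lambda>r. f r * psi n m S D f r) s = 2 ^ card D * CE n S (\<lambda>r. (wcoef n m S D f r)\<^sup>2) s"
        using D P SP pts_mono[of D P m] by (intro CE_f_psi[OF _ m2 S _ s]) auto
      then show "CE n S (\<lambda>r. f r * psi n m S D f r) s = 2 ^ d * CE n S (\<lambda>r. (wcoef n m S D f r)\<^sup>2) s"
        using D by simp
    qed
    also have "\<dots> = 2 ^ d * Q" by (simp add: Q_def wt_def sum_distrib_left)
    finally have "(2 ^ d * Q) ^ (2 * k) = (CE n S (\<lambda>r. f r * ?G r) s) ^ (2 * k)" by simp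
    also have "\<dots> \<le> (CE n S f s) ^ (2 * k - 1) * CE n S (\<lambda>r. ?G r ^ (2 * k)) s"
      by (rule CE_holder[OF S s f01 k0])
    also have "\<dots> \<le> ?g ^ (2 * k - 1) * (real (2 * k) ^ (d * k) * Z ^ k)"
    proof (rule mult_mono)
      show "(CE n S f s) ^ (2 * k - 1) \<le> ?g ^ (2 * k - 1)" using CEf by (intro power_mono)
      have "CE n S (\<lambda>r. ?G r ^ (2 * k)) s \<le> real (2 * k) ^ (d * k) * CE n S (\<lambda>r. ?Y r ^ k) s"
        by (rule CE_bonami[OF P m2 S SP s k0])
      also have "\<dots> \<le> real (2 * k) ^ (d * k) * Z ^ k"
        using Yk by (intro mult_left_mono) auto
      finally show "CE n S (\<lambda>r. ?G r ^ (2 * k)) s \<le> real (2 * k) ^ (d * k) * Z ^ k" .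
      show "0 \<le> CE n S (\<lambda>r. ?G r ^ (2 * k)) s" by (intro CE_nonneg) (simp add: power_mult)
    qed (use R \<gamma> in simp)
    finally have main: "(2 ^ d * Q) ^ (2 * k) \<le> ?g ^ (2 * k - 1) * (real (2 * k) ^ (d * k) * Z ^ k)" .
    have "Q\<^sup>2 \<le> ?g\<^sup>2 * exp (2 * real d) * real (2 * k) ^ d * Z"
      by (rule level_bound_numeric[OF Q0 Z0 k0 \<gamma> g L Lk main])
    then have "Q \<le> 2000 ^ d * X"
      unfolding Z_def by (intro numeric_step[OF Q0 _ d kd R X_def]) auto
    then show ?thesis by (simp add: Q_def X_def mult_ac)
  qed
qed

section \<open>Orthogonality to low degrees\<close>

text \<open>Orthogonality to all functions of degree below \<open>d\<close>, encoded by vanishing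
  conditional expectations; \<open>low_orth_low_span\<close> and \<open>orth_V_le_iff\<close> give
  the link to inner products.\<close>

definition low_orth :: "nat \<Rightarrow> ((nat \<Rightarrow> nat) \<Rightarrow> real) \<Rightarrow> nat \<Rightarrow> bool" where
  "low_orth n v d \<longleftrightarrow> (\<forall>S. S \<subseteq> {1..n} \<longrightarrow> card S < d \<longrightarrow> (\<forall>s\<in>Sym n. CE n S v s = 0))"

lemma low_orthD: "low_orth n v d \<Longrightarrow> S \<subseteq> {1..n} \<Longrightarrow> card S < d \<Longrightarrow> s \<in> Sym n \<Longrightarrow> CE n S v s = 0"
  unfolding low_orth_def by blast

lemma low_orth_dep:
  assumes "low_orth n v d" "S \<subseteq> {1..n}" "card S < d" "dep n S h"
  shows "(\<Sum>r\<in>Sym n. h r * v r) = 0"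
  using sum_Sym_CE_pull[OF assms(2,4), of v] low_orthD[OF assms(1-3)] by simp

lemma low_orth_right:
  assumes v: "low_orth n v d" and t: "t \<in> Sym n"
  shows "low_orth n (\<lambda>r. v (r \<circ> t)) d"
  unfolding low_orth_def
proof (intro allI impI ballI)
  fix S s assume S: "S \<subseteq> {1..n}" "card S < d" and s: "s \<in> Sym n"
  have "CE n S (\<lambda>r. v (r \<circ> t)) s = CE n (inv t ` S) v (s \<circ> t)"
    using CE_right'[OF Sym_inv[OF t], of S v s] t by simp
  also have "\<dots> = 0"
    using S Sym_card_image[OF Sym_inv[OF t], of S]
    by (intro low_orthD[OF v] Sym_image_subset Sym_inv Sym_comp s t) auto
  finally show "CE n S (\<lambda>r. v (r \<circ> t)) s = 0" .
qed

lemma CE_left: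
  assumes t: "t \<in> Sym n"
  shows "CE n S (\<lambda>r. v (t \<circ> r)) s = CE n S v (t \<circ> s)"
proof -
  have "bij_betw (\<lambda>r. t \<circ> r) (cls n S s) (cls n S (t \<circ> s))"
  proof (rule bij_betw_byWitness[where f' = "\<lambda>r. inv t \<circ> r"])
    show "\<forall>a\<in>cls n S s. inv t \<circ> (t \<circ> a) = a" "\<forall>a'\<in>cls n S (t \<circ> s). t \<circ> (inv t \<circ> a') = a'"
      using t by (auto simp: fun_eq_iff)
    show "(\<lambda>r. t \<circ> r) ` cls n S s \<subseteq> cls n S (t \<circ> s)" "(\<lambda>r. inv t \<circ> r) ` cls n S (t \<circ> s) \<subseteq> cls n S s"
      using t by (auto simp: cls_def Sym_comp Sym_inv)
  qed
  from sum.reindex_bij_betw[OF this, of v] show ?thesis by (simp add: CE_def)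
qed

lemma low_orth_left:
  assumes "low_orth n v d" "t \<in> Sym n"
  shows "low_orth n (\<lambda>r. v (t \<circ> r)) d"
  using assms by (auto simp: low_orth_def CE_left Sym_comp)

text \<open>Prescribing the values of \<open>r\<close> on \<open>S\<close> prescribes equally many
  values of \<open>inv r\<close>, on the image of \<open>S\<close>. Hence points and values may be
  interchanged.\<close>

lemma low_orth_inv:
  assumes v: "low_orth n v d"
  shows "low_orth n (\<lambda>r. v (inv r)) d"
  unfolding low_orth_def
proof (intro allI impI ballI)
  fix S s assume S: "S \<subseteq> {1..n}" "card S < d" and s: "s \<in> Sym n"
  have "bij_betw inv (cls n S s) (cls n (s ` S) (inv s))"
  proof (rule bij_betw_byWitness[where f' = inv])
    show "\<forall>a\<in>cls n S s. inv (inv a) = a" "\<forall>a'\<in>cls n (s ` S) (inv s). inv (inv a') = a'"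
      by (auto dest: cls_subset)
    show "inv ` cls n S s \<subseteq> cls n (s ` S) (inv s)"
    proof
      fix q assume "q \<in> inv ` cls n S s"
      then obtain r where r: "r \<in> cls n S s" "q = inv r" by auto
      have rS: "r \<in> Sym n" using r by (auto dest: cls_subset)
      have "inv r (s i) = inv s (s i)" if "i \<in> S" for i
      proof -
        have "s i = r i" using r that by (simp add: cls_def)
        then have "inv r (s i) = i" using rS by simp
        then show ?thesis using s by simp
      qed
      then show "q \<in> cls n (s ` S) (inv s)" using r rS by (auto simp: cls_def Sym_inv)
    qed
    show "inv ` cls n (s ` S) (inv s) \<subseteq> cls n S s"
    proof
      fix q assume "q \<in> inv ` cls n (s ` S) (inv s)"
      then obtain r where r: "r \<in> cls n (s ` S) (inv s)" "q = inv r" by auto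
      have rS: "r \<in> Sym n" using r by (auto dest: cls_subset)
      have "inv r i = s i" if "i \<in> S" for i
      proof -
        have "r (s i) = i" using r that s by (simp add: cls_def)
        then show ?thesis using rS by (metis Sym_inv_app(1))
      qed
      then show "q \<in> cls n S s" using r rS by (auto simp: cls_def Sym_inv)
    qed
  qed
  from sum.reindex_bij_betw[OF this, of v]
  have "CE n S (\<lambda>r. v (inv r)) s = CE n (s ` S) v (inv s)"
    by (simp add: CE_def Sym_card_image[OF s])
  also have "\<dots> = 0"
    using S Sym_card_image[OF s, of S] by (intro low_orthD[OF v] Sym_image_subset Sym_inv s) auto
  finally show "CE n S (\<lambda>r. v (inv r)) s = 0" .
qed

lemma low_orth_twist:
  assumes "low_orth n v d" "t \<in> Sym n"
  shows "low_orth n (\<lambda>r. v (t \<circ> inv r)) d"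
  using low_orth_inv[OF low_orth_left[OF assms]] .

section \<open>Inclusion-exclusion for two systems of prescribed values\<close>

lemma Sym_extend:
  assumes A: "A \<subseteq> {1..n}" and f: "inj_on f A" "f ` A \<subseteq> {1..n}"
  shows "\<exists>s\<in>Sym n. \<forall>i\<in>A. s i = f i"
proof -
  have fin: "finite A" "finite (f ` A)" using A f by (meson finite_subset_interval finite_subset)+
  have "card ({1..n} - A) = card ({1..n} - f ` A)"
    using A f fin by (simp add: card_Diff_subset card_image)
  then obtain g where g: "bij_betw g ({1..n} - A) ({1..n} - f ` A)"
    using finite_same_card_bij[of "{1..n} - A" "{1..n} - f ` A"] by auto
  let ?s = "\<lambda>x. if x \<in> A then f x else if x \<in> {1..n} then g x else x"
  have "bij_betw ?s A (f ` A)"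
    using f(1) by (subst bij_betw_cong[of A _ f]) (auto simp: bij_betw_def)
  moreover have "bij_betw ?s ({1..n} - A) ({1..n} - f ` A)"
    using g by (subst bij_betw_cong[of _ _ g]) auto
  ultimately have "bij_betw ?s (A \<union> ({1..n} - A)) (f ` A \<union> ({1..n} - f ` A))"
    by (rule bij_betw_combine) auto
  then have "bij_betw ?s {1..n} {1..n}" using A f(2) by (simp add: Un_absorb1 Un_Diff_cancel)
  then have "?s permutes {1..n}" by (rule bij_imp_permutes) (use A in auto)
  then show ?thesis by (intro bexI[of _ ?s]) (auto simp: Sym_def)
qed

text \<open>The two prescriptions are compatible exactly when they agree on
  \<open>X \<inter> I\<close> and give distinct points distinct values; the second condition is the
  disjointness of the images. A common extension then exists by \<open>Sym_extend\<close>, and the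
  set is its class.\<close>

lemma card_two_constraints:
  assumes X: "X \<subseteq> {1..n}" and I: "I \<subseteq> {1..n}" and th: "th \<in> Sym n" and e: "e \<in> Sym n"
  shows "card {s \<in> cls n X th. e \<in> cls n I s} =
    (if e \<in> cls n (X \<inter> I) th \<and> e ` (I - X) \<inter> th ` (X - I) = {} then fact (n - card (X \<union> I)) else 0)"
    (is "card ?A = (if ?c then _ else 0)")
proof (cases ?c)
  case True
  let ?f = "\<lambda>x. if x \<in> X then th x else e x"
  have inj: "inj_on ?f (X \<union> I)"
  proof (rule inj_onI)
    fix x y assume xy: "x \<in> X \<union> I" "y \<in> X \<union> I" "?f x = ?f y"
    have *: "x = y" if "x \<in> X" "y \<in> I" "y \<notin> X" "th x = e y" for x y
    proof (cases "x \<in> I")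
      case True2: True
      then have "e x = th x" using True that by (auto simp: cls_def)
      then have "e x = e y" using that by simp
      then show ?thesis using Sym_inj[OF e] by (simp add: inj_eq)
    next
      case False
      then have "th x \<in> th ` (X - I)" using that by (intro imageI) auto
      moreover have "e y \<in> e ` (I - X)" using that by (intro imageI) auto
      ultimately show ?thesis using True that(4) by auto
    qed
    show "x = y"
      using xy *[of x y] *[of y x] Sym_inj[OF th] Sym_inj[OF e] by (auto simp: inj_eq split: if_splits)
  qed
  have "?f ` (X \<union> I) \<subseteq> {1..n}"
    using Sym_image_subset[OF th X] Sym_image_subset[OF e I] by auto
  then obtain s0 where s0: "s0 \<in> Sym n" "\<forall>i\<in>X \<union> I. s0 i = ?f i"
    using Sym_extend[OF Un_least[OF X I] inj] by blast
  have th_e: "th i = e i" if "i \<in> X" "i \<in> I" for i using True that by (auto simp: cls_def)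
  have s0X: "s0 i = th i" if "i \<in> X" for i using s0 that by auto
  have s0I: "s0 i = e i" if "i \<in> I" for i using s0 that th_e by (cases "i \<in> X") auto
  have "?A = cls n (X \<union> I) s0"
    using e by (auto simp: cls_def s0X s0I)
  then show ?thesis using card_cls[of "X \<union> I" n s0] X I s0 True by simp
next
  case False
  have "?A = {}"
  proof (rule ccontr)
    assume "?A \<noteq> {}"
    then obtain s where s: "s \<in> Sym n" "\<forall>i\<in>X. s i = th i" "\<forall>i\<in>I. e i = s i"
      by (auto simp: cls_def)
    have "e \<in> cls n (X \<inter> I) th" using s e by (auto simp: cls_def)
    moreover have "e ` (I - X) \<inter> th ` (X - I) = {}"
    proof (rule ccontr)
      assume "e ` (I - X) \<inter> th ` (X - I) \<noteq> {}"
      then obtain i x where ix: "i \<in> I - X" "x \<in> X - I" "e i = th x" by auto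
      then have "s i = s x" using s by auto
      then have "i = x" using Sym_inj[OF s(1)] by (simp add: inj_eq)
      then show False using ix by auto
    qed
    ultimately show False using False by simp
  qed
  then show ?thesis using False by (simp only: if_False card.empty)
qed

text \<open>The kernel of a product of two conditional expectations: every \<open>e\<close>
  compatible with the prescription of \<open>th\<close> on \<open>X\<close> has the same weight, the
  others have none.\<close>

lemma CE_CE:
  assumes X: "X \<subseteq> {1..n}" and I: "I \<subseteq> {1..n}" and th: "th \<in> Sym n"
  shows "CE n X (CE n I v) th = fact (n - card (X \<union> I)) / (fact (n - card X) * fact (n - card I)) *
    (\<Sum>e\<in>{e \<in> cls n (X \<inter> I) th. e ` (I - X) \<inter> th ` (X - I) = {}}. v e)"
proof -
  let ?E = "{e \<in> cls n (X \<inter> I) th. e ` (I - X) \<inter> th ` (X - I) = {}}"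
  have "(\<Sum>s\<in>cls n X th. \<Sum>e\<in>cls n I s. v e) = (\<Sum>s\<in>cls n X th. \<Sum>e\<in>Sym n. if e \<in> cls n I s then v e else 0)"
  proof (rule sum.cong[OF refl])
    fix s
    have "cls n I s \<subseteq> Sym n" by (auto simp: cls_def)
    then show "(\<Sum>e\<in>cls n I s. v e) = (\<Sum>e\<in>Sym n. if e \<in> cls n I s then v e else 0)"
      by (simp add: sum.If_cases Int_absorb1)
  qed
  also have "\<dots> = (\<Sum>e\<in>Sym n. \<Sum>s\<in>cls n X th. if e \<in> cls n I s then v e else 0)" by (rule sum.swap)
  also have "\<dots> = (\<Sum>e\<in>Sym n. real (card {s \<in> cls n X th. e \<in> cls n I s}) * v e)"
    by (intro sum.cong refl) (simp add: sum.If_cases Int_def)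
  also have "\<dots> = (\<Sum>e\<in>Sym n. if e \<in> ?E then fact (n - card (X \<union> I)) * v e else 0)"
    by (intro sum.cong refl) (simp add: card_two_constraints[OF X I th])
  also have "\<dots> = (\<Sum>e\<in>?E. fact (n - card (X \<union> I)) * v e)"
  proof -
    have "?E \<subseteq> Sym n" by (auto simp: cls_def)
    then show ?thesis by (simp add: sum.If_cases Int_absorb1)
  qed
  also have "\<dots> = fact (n - card (X \<union> I)) * (\<Sum>e\<in>?E. v e)" by (rule sum_distrib_left[symmetric])
  finally show ?thesis
    by (simp add: CE_def sum_divide_distrib[symmetric])
qed

lemma sum_sg_Pow:
  assumes "finite F" shows "(\<Sum>Y\<in>Pow F. sg Y) = (if F = {} then 1 else 0)"
proof (cases "F = {}")
  case False
  then obtain p where p: "p \<in> F" by auto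
  have fin: "finite (F - {p})" using assms by simp
  have "(\<Sum>Y\<in>Pow (insert p (F - {p})). sg Y) = (\<Sum>Y\<in>Pow (F - {p}). sg Y + sg (insert p Y))"
    by (rule sum_Pow_insert[OF fin]) simp
  also have "\<dots> = 0"
  proof (rule sum.neutral, rule ballI)
    fix Y assume "Y \<in> Pow (F - {p})"
    then have "finite Y" "p \<notin> Y" using fin by (auto dest: finite_subset)
    then show "sg Y + sg (insert p Y) = 0" by (simp add: sg_insert)
  qed
  finally show ?thesis using p False by (simp add: insert_absorb)
qed simp

text \<open>The summation condition only involves the values of the inverse permutation on \<open>th ` K \<union> Y\<close>.\<close>

lemma low_orth_mixed:
  assumes v: "low_orth n v d" and K: "K \<subseteq> {1..n}" and Y: "Y \<subseteq> {1..n}" and c: "card K + card Y < d"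
    and th: "th \<in> Sym n"
  shows "(\<Sum>e\<in>{e \<in> cls n K th. Y \<subseteq> e ` W}. v e) = 0"
proof -
  let ?h = "\<lambda>e. if (\<forall>i\<in>K. e i = th i) \<and> Y \<subseteq> e ` W then 1 else (0::real)"
  have sub: "th ` K \<union> Y \<subseteq> {1..n}" using Sym_image_subset[OF th K] Y by auto
  have "card (th ` K \<union> Y) \<le> card K + card Y"
    using card_Un_le[of "th ` K" Y] Sym_card_image[OF th, of K] by simp
  then have c': "card (th ` K \<union> Y) < d" using c by simp
  have dep: "dep n (th ` K \<union> Y) (\<lambda>z. ?h (inv z))"
    unfolding dep_def
  proof (intro ballI impI)
    fix s r assume s: "s \<in> Sym n" and r: "r \<in> Sym n" and eq: "\<forall>i\<in>th ` K \<union> Y. r i = s i"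
    have 1: "inv z i = th i \<longleftrightarrow> z (th i) = i" if "z \<in> Sym n" for z i
      using that by (metis Sym_inv_app)
    have 2: "Y \<subseteq> inv z ` W \<longleftrightarrow> z ` Y \<subseteq> W" if z: "z \<in> Sym n" for z
    proof
      assume "Y \<subseteq> inv z ` W"
      then show "z ` Y \<subseteq> W" using z by force
    next
      assume "z ` Y \<subseteq> W"
      then show "Y \<subseteq> inv z ` W" using z by (force simp: image_iff)
    qed
    have 3: "r ` Y = s ` Y" using eq by (auto simp: image_iff)
    have 4: "(\<forall>i\<in>K. inv r i = th i) \<longleftrightarrow> (\<forall>i\<in>K. inv s i = th i)"
      using eq by (simp add: 1[OF r] 1[OF s])
    show "?h (inv r) = ?h (inv s)" unfolding 2[OF r] 2[OF s] 3 4 ..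
  qed
  have "(\<Sum>e\<in>{e \<in> cls n K th. Y \<subseteq> e ` W}. v e) = (\<Sum>e\<in>Sym n. ?h e * v e)"
    by (rule sum.mono_neutral_cong_left) (auto simp: cls_def)
  also have "\<dots> = (\<Sum>e\<in>Sym n. ?h (inv e) * v (inv e))" by (rule sum_Sym_inv[symmetric])
  also have "\<dots> = 0" by (rule low_orth_dep[OF low_orth_inv[OF v] sub c' dep])
  finally show ?thesis .
qed

text \<open>Inclusion-exclusion over the points of \<open>th ` (X - I)\<close> that are hit: every term but the last one is
  orthogonal to \<open>v\<close>.\<close>

lemma sum_disjoint_images:
  assumes v: "low_orth n v d" and X: "X \<subseteq> {1..n}" and th: "th \<in> Sym n" and c: "card X \<le> d"
  shows "(\<Sum>e\<in>{e \<in> cls n (X \<inter> I) th. e ` (I - X) \<inter> th ` (X - I) = {}}. v e) =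
    (if card X < d then 0 else
       sg (X - I) * (\<Sum>e\<in>{e \<in> cls n (X \<inter> I) th. th ` (X - I) \<subseteq> e ` (I - X)}. v e))"
proof -
  let ?K = "X \<inter> I" and ?Z = "th ` (X - I)" and ?W = "I - X"
  have finX: "finite X" using X by (rule finite_subset_interval)
  have finZ: "finite ?Z" using finX by simp
  have cX: "card ?K + card ?Z = card X"
    using finX Sym_card_image[OF th, of "X - I"]
    by (simp add: card_Un_disjoint[symmetric] Int_Diff_Un Int_Diff_disjoint)
  have Zn: "?Z \<subseteq> {1..n}" using Sym_image_subset[OF th, of "X - I"] X by auto
  have "(\<Sum>e\<in>{e \<in> cls n ?K th. e ` ?W \<inter> ?Z = {}}. v e)
      = (\<Sum>e\<in>cls n ?K th. (\<Sum>Y\<in>Pow (e ` ?W \<inter> ?Z). sg Y) * v e)"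
  proof -
    have "(\<Sum>Y\<in>Pow (e ` ?W \<inter> ?Z). sg Y) * v e = (if e ` ?W \<inter> ?Z = {} then v e else 0)" for e
      using finZ by (subst sum_sg_Pow) auto
    then show ?thesis by (simp only: sum.inter_filter[OF finite_cls])
  qed
  also have "\<dots> = (\<Sum>e\<in>cls n ?K th. \<Sum>Y\<in>Pow ?Z. if Y \<subseteq> e ` ?W then sg Y * v e else 0)"
  proof (rule sum.cong[OF refl])
    fix e
    have "(\<Sum>Y\<in>Pow (e ` ?W \<inter> ?Z). sg Y * v e) = (\<Sum>Y\<in>Pow ?Z. if Y \<subseteq> e ` ?W then sg Y * v e else 0)"
      using finZ by (intro sum.mono_neutral_cong_left) auto
    then show "(\<Sum>Y\<in>Pow (e ` ?W \<inter> ?Z). sg Y) * v e = (\<Sum>Y\<in>Pow ?Z. if Y \<subseteq> e ` ?W then sg Y * v e else 0)"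
      by (simp add: sum_distrib_right)
  qed
  also have "\<dots> = (\<Sum>Y\<in>Pow ?Z. sg Y * (\<Sum>e\<in>{e \<in> cls n ?K th. Y \<subseteq> e ` ?W}. v e))"
    by (subst sum.swap) (simp add: sum.If_cases Int_def sum_distrib_left)
  also have "\<dots> = (\<Sum>Y\<in>Pow ?Z. if Y = ?Z \<and> \<not> card X < d then sg ?Z * (\<Sum>e\<in>{e \<in> cls n ?K th. ?Z \<subseteq> e ` ?W}. v e) else 0)"
  proof (rule sum.cong[OF refl])
    fix Y assume Y: "Y \<in> Pow ?Z"
    show "sg Y * (\<Sum>e\<in>{e \<in> cls n ?K th. Y \<subseteq> e ` ?W}. v e)
      = (if Y = ?Z \<and> \<not> card X < d then sg ?Z * (\<Sum>e\<in>{e \<in> cls n ?K th. ?Z \<subseteq> e ` ?W}. v e) else 0)"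
    proof (cases "Y = ?Z \<and> \<not> card X < d")
      case False
      have le: "card Y \<le> card ?Z" using Y finZ by (intro card_mono) auto
      have "card ?K + card Y < d"
      proof (cases "Y = ?Z")
        case True
        then show ?thesis using False cX by simp
      next
        case neq: False
        then have "card Y < card ?Z" using Y finZ by (intro psubset_card_mono) auto
        then show ?thesis using cX c by simp
      qed
      then have "(\<Sum>e\<in>{e \<in> cls n ?K th. Y \<subseteq> e ` ?W}. v e) = 0"
        by (intro low_orth_mixed[OF v _ _ _ th]) (use X Y Zn in auto)
      then show ?thesis by (simp only: False if_False mult_zero_right)
    qed simp
  qed
  also have "\<dots> = (if card X < d then 0 else sg ?Z * (\<Sum>e\<in>{e \<in> cls n ?K th. ?Z \<subseteq> e ` ?W}. v e))"
    using finZ by (simp add: sum.delta)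
  also have "sg ?Z = sg (X - I)" by (simp add: sg_def Sym_card_image[OF th])
  finally show ?thesis .
qed

text \<open>For any set \<open>I\<close> of points, \<open>CE n I\<close> thus preserves
  orthogonality to the degrees below \<open>d\<close>.\<close>

lemma CE_CE_low:
  assumes v: "low_orth n v d" and X: "X \<subseteq> {1..n}" and I: "I \<subseteq> {1..n}" and th: "th \<in> Sym n" and c: "card X < d"
  shows "CE n X (CE n I v) th = 0"
  using sum_disjoint_images[OF v X th, of I] c by (simp add: CE_CE[OF X I th])

lemma permutes_Sym: "k permutes B \<Longrightarrow> B \<subseteq> {1..n} \<Longrightarrow> k \<in> Sym n"
  unfolding Sym_def by (auto intro: permutes_subset)

text \<open>By cardinality \<open>e\<close> maps \<open>B\<close> onto the image of \<open>B\<close>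
  under \<open>th\<close>, so on \<open>S\<close> it is \<open>th\<close> preceded by a
  rearrangement \<open>k\<close> of \<open>B\<close>; different \<open>k\<close> give disjoint
  classes.\<close>

lemma cls_permuted_Union:
  assumes S: "S \<subseteq> {1..n}" and B: "B \<subseteq> S" and th: "th \<in> Sym n"
  shows "(\<Sum>e\<in>{e \<in> cls n (S - B) th. th ` B \<subseteq> e ` B}. G e) = (\<Sum>k\<in>{k. k permutes B}. \<Sum>e\<in>cls n S (th \<circ> k). (G e :: real))"
proof -
  have finB: "finite B" using S B by (meson finite_subset_interval finite_subset)
  have eq: "{e \<in> cls n (S - B) th. th ` B \<subseteq> e ` B} = (\<Union>k\<in>{k. k permutes B}. cls n S (th \<circ> k))"
  proof (intro equalityI subsetI)
    fix e assume e: "e \<in> {e \<in> cls n (S - B) th. th ` B \<subseteq> e ` B}"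
    then have eS: "e \<in> Sym n" by (auto dest: cls_subset)
    have im: "th ` B = e ` B"
      using e finB Sym_card_image[OF th, of B] Sym_card_image[OF eS, of B] by (intro card_subset_eq) auto
    let ?k = "\<lambda>x. if x \<in> B then inv th (e x) else x"
    have "?k permutes B"
    proof (rule inj_imp_permutes)
      show "inj_on ?k B"
      proof (rule inj_onI)
        fix x y assume "x \<in> B" "y \<in> B" "?k x = ?k y"
        then have "inv th (e x) = inv th (e y)" by simp
        then have "e x = e y" using th by (metis Sym_inv_app(2))
        then show "x = y" using Sym_inj[OF eS] by (simp add: inj_eq)
      qed
      fix x assume x: "x \<in> B"
      then obtain b where "b \<in> B" "e x = th b" using im by (metis imageE image_eqI)
      then show "?k x \<in> B" using x th by simp
    qed (use finB in auto)
    moreover have "e \<in> cls n S (th \<circ> ?k)"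
      using e th eS by (auto simp: cls_def)
    ultimately show "e \<in> (\<Union>k\<in>{k. k permutes B}. cls n S (th \<circ> k))" by blast
  next
    fix e assume "e \<in> (\<Union>k\<in>{k. k permutes B}. cls n S (th \<circ> k))"
    then obtain k where k: "k permutes B" "e \<in> cls n S (th \<circ> k)" by auto
    have "e i = th i" if "i \<in> S - B" for i
      using k that by (auto simp: cls_def permutes_not_in)
    moreover have "th ` B \<subseteq> e ` B"
    proof
      fix y assume "y \<in> th ` B"
      then obtain b where b: "b \<in> B" "y = th b" by auto
      obtain c where c: "c \<in> B" "k c = b" using k(1) b(1) by (metis permutes_image imageE)
      then have "e c = y" using k(2) b B by (auto simp: cls_def)
      then show "y \<in> e ` B" using c by auto
    qed
    ultimately show "e \<in> {e \<in> cls n (S - B) th. th ` B \<subseteq> e ` B}" using k by (auto simp: cls_def)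
  qed
  show ?thesis unfolding eq
  proof (rule sum.UNION_disjoint)
    show "finite {k. k permutes B}" using finB by (rule finite_permutations)
    show "\<forall>i\<in>{k. k permutes B}. \<forall>j\<in>{k. k permutes B}. i \<noteq> j \<longrightarrow> cls n S (th \<circ> i) \<inter> cls n S (th \<circ> j) = {}"
    proof (intro ballI impI, rule ccontr)
      fix i j assume ij: "i \<in> {k. k permutes B}" "j \<in> {k. k permutes B}" "i \<noteq> j" "cls n S (th \<circ> i) \<inter> cls n S (th \<circ> j) \<noteq> {}"
      then obtain e where e: "e \<in> cls n S (th \<circ> i)" "e \<in> cls n S (th \<circ> j)" by auto
      have "i x = j x" for x
      proof (cases "x \<in> B")
        case True
        then have "th (i x) = th (j x)" using e B by (auto simp: cls_def)
        then show ?thesis using Sym_inj[OF th] by (simp add: inj_eq)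
      next
        case False
        then show ?thesis using ij by (simp add: permutes_not_in)
      qed
      then show False using ij(3) by auto
    qed
  qed auto
qed

text \<open>The source of both positivity facts. The left side is a product of conditional
  expectations on \<open>S\<close> and on its image under \<open>t\<close>, which share
  \<open>S - B\<close>. Inclusion-exclusion leaves only the permutations that fill all values of
  \<open>th\<close> on \<open>B\<close> from the image of \<open>B\<close>, with the sign
  \<open>sg B\<close>; undoing \<open>t\<close> makes them rearrangements of \<open>B\<close>. Up to
  this sign and a positive constant, swapping \<open>B\<close> out is therefore summation over the
  permutations of \<open>B\<close>.\<close>

lemma CE_swap_out:
  assumes G: "low_orth n G (card S)" and S: "S \<subseteq> {1..n}" and B: "B \<subseteq> S" and t: "t \<in> Sym n" "t \<circ> t = id"
    and fix_t: "\<And>i. i \<in> S - B \<Longrightarrow> t i = i" and out: "t ` B \<inter> S = {}" and th: "th \<in> Sym n"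
  shows "CE n S (\<lambda>s. CE n S G (s \<circ> t)) th =
    sg B * (fact (n - card (S \<union> t ` S)) / fact (n - card S)) * (\<Sum>k\<in>{k. k permutes B}. CE n S G (th \<circ> k))"
proof -
  have tt: "t (t x) = x" for x using t(2) by (metis comp_apply id_apply)
  have tS: "t ` S = (S - B) \<union> t ` B"
  proof -
    have "t ` (S - B) = S - B" using fix_t by force
    moreover have "t ` S = t ` (S - B) \<union> t ` B" using B by (metis Diff_partition image_Un sup_commute)
    ultimately show ?thesis by simp
  qed
  have I: "S \<inter> t ` S = S - B" "S - t ` S = B" "t ` S - S = t ` B"
    using B out unfolding tS by auto
  have tSn: "t ` S \<subseteq> {1..n}" by (rule Sym_image_subset[OF t(1) S])
  have v: "low_orth n (\<lambda>r. G (r \<circ> t)) (card S)" by (rule low_orth_right[OF G t(1)])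
  have "CE n S (\<lambda>s. CE n S G (s \<circ> t)) th = CE n S (CE n (t ` S) (\<lambda>r. G (r \<circ> t))) th"
  proof -
    have "CE n (t ` S) (\<lambda>r. G (r \<circ> t)) = (\<lambda>s. CE n S G (s \<circ> t))" by (rule ext) (rule CE_right[OF t(1)])
    then show ?thesis by simp
  qed
  also have "\<dots> = fact (n - card (S \<union> t ` S)) / (fact (n - card S) * fact (n - card S)) *
     (sg B * (\<Sum>e\<in>{e \<in> cls n (S - B) th. th ` B \<subseteq> e ` (t ` B)}. G (e \<circ> t)))"
    unfolding CE_CE[OF S tSn th] using sum_disjoint_images[OF v S th, of "t ` S"]
    by (simp add: I Sym_card_image[OF t(1)])
  also have "(\<Sum>e\<in>{e \<in> cls n (S - B) th. th ` B \<subseteq> e ` (t ` B)}. G (e \<circ> t))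
     = (\<Sum>e\<in>{e \<in> cls n (S - B) th. th ` B \<subseteq> e ` B}. G e)"
  proof (rule sum.reindex_bij_witness[where i = "\<lambda>e. e \<circ> t" and j = "\<lambda>e. e \<circ> t"])
    fix e assume "e \<in> {e \<in> cls n (S - B) th. th ` B \<subseteq> e ` t ` B}"
    then show "e \<circ> t \<circ> t = e" "e \<circ> t \<in> {e \<in> cls n (S - B) th. th ` B \<subseteq> e ` B}"
      using t fix_t by (auto simp: cls_def Sym_comp comp_assoc image_comp)
  next
    fix e assume e: "e \<in> {e \<in> cls n (S - B) th. th ` B \<subseteq> e ` B}"
    have "(e \<circ> t) ` t ` B = e ` B" by (simp add: image_image tt)
    then show "e \<circ> t \<circ> t = e" "e \<circ> t \<in> {e \<in> cls n (S - B) th. th ` B \<subseteq> e ` t ` B}"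
      using e t fix_t by (auto simp: cls_def Sym_comp comp_assoc)
  qed simp
  also have "\<dots> = (\<Sum>k\<in>{k. k permutes B}. fact (n - card S) * CE n S G (th \<circ> k))"
    unfolding cls_permuted_Union[OF S B th] by (simp add: CE_def)
  finally show ?thesis by (simp add: sum_distrib_left[symmetric] comp_def mult_ac)
qed

text \<open>Summation over a group of translations is a positive multiple of the orthogonal
  projection onto the invariant functions.\<close>

lemma group_average_nonneg:
  fixes h :: "(nat \<Rightarrow> nat) \<Rightarrow> real"
  assumes B: "B \<subseteq> {1..n}"
  shows "0 \<le> (\<Sum>s\<in>Sym n. h s * (\<Sum>k\<in>{k. k permutes B}. h (s \<circ> k)))"
proof -
  let ?P = "{k. k permutes B}"
  have finB: "finite B" using B by (rule finite_subset_interval)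
  let ?H = "\<lambda>s. \<Sum>k\<in>?P. h (s \<circ> k)"
  have H: "?H (s \<circ> k) = ?H s" if "k \<in> ?P" for s k
  proof -
    have "?H (s \<circ> k) = (\<Sum>q\<in>?P. h (s \<circ> (k \<circ> q)))" by (simp add: comp_assoc)
    also have "\<dots> = ?H s"
      using that by (intro sum.reindex_bij_witness[where i = "\<lambda>q. inv k \<circ> q" and j = "\<lambda>q. k \<circ> q"])
        (auto simp: permutes_compose permutes_inv permutes_inv_o comp_assoc[symmetric] permutes_inverses)
    finally show ?thesis .
  qed
  have "0 \<le> (\<Sum>s\<in>Sym n. (?H s)\<^sup>2)" by (intro sum_nonneg) simp
  also have "\<dots> = (\<Sum>s\<in>Sym n. \<Sum>k\<in>?P. h (s \<circ> k) * ?H s)"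
    by (simp add: power2_eq_square sum_distrib_right)
  also have "\<dots> = (\<Sum>k\<in>?P. \<Sum>s\<in>Sym n. h (s \<circ> k) * ?H (s \<circ> k))"
    by (subst sum.swap) (intro sum.cong refl, simp only: H)
  also have "\<dots> = (\<Sum>k\<in>?P. \<Sum>s\<in>Sym n. h s * ?H s)"
  proof (rule sum.cong[OF refl])
    fix k assume "k \<in> ?P"
    then have "k \<in> Sym n" using permutes_Sym[OF _ B] by blast
    from sum_Sym_right[OF this, of "\<lambda>s. h s * ?H s"]
    show "(\<Sum>s\<in>Sym n. h (s \<circ> k) * ?H (s \<circ> k)) = (\<Sum>s\<in>Sym n. h s * ?H s)" .
  qed
  also have "\<dots> = real (card ?P) * (\<Sum>s\<in>Sym n. h s * ?H s)" by simp
  finally have "0 \<le> real (card ?P) * (\<Sum>s\<in>Sym n. h s * ?H s)" .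
  moreover have "0 < card ?P" using finB by (simp add: card_permutations)
  ultimately show ?thesis by (simp add: zero_le_mult_iff)
qed

text \<open>Expanding the square, the correlation of two swaps depends only on their symmetric
  difference \<open>B\<close>, so the alternating norm is a sum of the terms \<open>?c B\<close>. In
  \<open>?c B\<close> the sign \<open>sg B\<close> meets the one from \<open>CE_swap_out\<close>,
  leaving a non-negative group average; keeping only the empty \<open>B\<close> gives the
  bound.\<close>

lemma Del_CE_lower:
  assumes G: "low_orth n G (card D)" and D: "D \<subseteq> {1..m}" and m: "2 * m \<le> n"
  shows "(\<Sum>s\<in>Sym n. (CE n D G s)\<^sup>2) \<le> 2 ^ card D * (\<Sum>s\<in>Sym n. (Del m D (CE n D G) s)\<^sup>2)"
proof -
  let ?h = "CE n D G"
  have Dn: "D \<subseteq> {1..n}" using D m by force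
  have finD: "finite D" using D by (rule finite_subset_interval)
  have swS: "sw m B \<in> Sym n" if "B \<in> Pow D" for B using that D by (intro sw_Sym[OF _ m]) auto
  let ?c = "\<lambda>B. sg B * (\<Sum>s\<in>Sym n. ?h s * ?h (s \<circ> sw m B))"
  have c0: "0 \<le> ?c B" if B: "B \<in> Pow D" for B
  proof -
    have BD: "B \<subseteq> D" and Bm: "B \<subseteq> {1..m}" using B D by auto
    have "(\<Sum>s\<in>Sym n. ?h s * ?h (s \<circ> sw m B)) = (\<Sum>s\<in>Sym n. ?h s * CE n D (\<lambda>s. ?h (s \<circ> sw m B)) s)"
      by (rule sum_Sym_CE_pull[OF Dn CE_dep, symmetric])
    also have "\<dots> = (\<Sum>s\<in>Sym n. ?h s * (sg B * (fact (n - card (D \<union> sw m B ` D)) / fact (n - card D)) * (\<Sum>k\<in>{k. k permutes B}. ?h (s \<circ> k))))"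
    proof (intro sum.cong refl arg_cong2[of _ _ _ _ "(*)"] CE_swap_out[OF G Dn BD swS[OF B] sw_invol[OF Bm]])
      show "sw m B i = i" if "i \<in> D - B" for i
        using that D Bm by (intro sw_fix) (fastforce simp: pts_def)
      show "sw m B ` B \<inter> D = {}" using D Bm by (fastforce simp: sw_def)
    qed
    also have "\<dots> = sg B * ((fact (n - card (D \<union> sw m B ` D)) / fact (n - card D)) * (\<Sum>s\<in>Sym n. ?h s * (\<Sum>k\<in>{k. k permutes B}. ?h (s \<circ> k))))"
    proof -
      have "(\<Sum>s\<in>A. p s * (a * b * q s)) = a * (b * (\<Sum>s\<in>A. p s * q s))"
        for a b :: real and p q :: "(nat \<Rightarrow> nat) \<Rightarrow> real" and A
        by (simp add: sum_distrib_left mult_ac)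
      then show ?thesis .
    qed
    finally have "?c B = (sg B * sg B) * ((fact (n - card (D \<union> sw m B ` D)) / fact (n - card D)) * (\<Sum>s\<in>Sym n. ?h s * (\<Sum>k\<in>{k. k permutes B}. ?h (s \<circ> k))))"
      by (simp only: mult.assoc)
    also have "0 \<le> \<dots>"
      unfolding sg_sg using BD Dn by (intro mult_nonneg_nonneg group_average_nonneg) auto
    finally show ?thesis .
  qed
  have "(\<Sum>s\<in>Sym n. (\<Sum>B\<in>Pow D. sg B * ?h (s \<circ> sw m B))\<^sup>2)
     = (\<Sum>s\<in>Sym n. \<Sum>A\<in>Pow D. \<Sum>B\<in>Pow D. sg A * sg B * (?h (s \<circ> sw m A) * ?h (s \<circ> sw m B)))"
    by (simp add: power2_eq_square sum_product mult_ac)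
  also have "\<dots> = (\<Sum>A\<in>Pow D. \<Sum>B\<in>Pow D. sg A * sg B * (\<Sum>s\<in>Sym n. ?h (s \<circ> sw m A) * ?h (s \<circ> sw m B)))"
    unfolding sum_distrib_left
    by (subst sum.swap, rule sum.cong[OF refl], rule sum.swap)
  also have "\<dots> = (\<Sum>A\<in>Pow D. \<Sum>B\<in>Pow D. ?c (sdiff A B))"
  proof (intro sum.cong refl)
    fix A B assume A: "A \<in> Pow D" and B: "B \<in> Pow D"
    have Am: "A \<subseteq> {1..m}" "B \<subseteq> {1..m}" using A B D by auto
    have fin: "finite A" "finite B" using A B finD by (auto intro: finite_subset)
    have "(\<Sum>s\<in>Sym n. ?h (s \<circ> sw m A) * ?h (s \<circ> sw m B))
        = (\<Sum>s\<in>Sym n. (\<lambda>q. ?h q * ?h (q \<circ> sw m (sdiff A B))) (s \<circ> sw m A))"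
    proof (intro sum.cong refl)
      fix s
      have "sdiff A (sdiff A B) = B" by auto
      then have "sw m A \<circ> sw m (sdiff A B) = sw m B"
        using sw_sw[of A m "sdiff A B"] Am by (metis Diff_subset Un_least order_trans)
      then show "?h (s \<circ> sw m A) * ?h (s \<circ> sw m B) = (\<lambda>q. ?h q * ?h (q \<circ> sw m (sdiff A B))) (s \<circ> sw m A)"
        by (simp add: comp_assoc)
    qed
    also have "\<dots> = (\<Sum>s\<in>Sym n. ?h s * ?h (s \<circ> sw m (sdiff A B)))"
      by (rule sum_Sym_right[OF swS[OF A]])
    finally show "sg A * sg B * (\<Sum>s\<in>Sym n. ?h (s \<circ> sw m A) * ?h (s \<circ> sw m B)) = ?c (sdiff A B)"
      by (simp only: sg_sdiff[OF fin])
  qed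
  also have "\<dots> = (\<Sum>A\<in>Pow D. \<Sum>B\<in>Pow D. ?c B)"
    by (intro sum.cong refl sum_Pow_sdiff[where F = ?c]) auto
  also have "\<dots> = 2 ^ card D * (\<Sum>B\<in>Pow D. ?c B)" using finD by (simp add: card_Pow)
  also have "\<dots> \<ge> 2 ^ card D * ?c {}"
    using finD c0 by (intro mult_left_mono member_le_sum) auto
  finally have "2 ^ card D * (\<Sum>s\<in>Sym n. (?h s)\<^sup>2) \<le> (\<Sum>s\<in>Sym n. (\<Sum>B\<in>Pow D. sg B * ?h (s \<circ> sw m B))\<^sup>2)"
    by (simp add: power2_eq_square)
  also have "\<dots> = (2 ^ card D)\<^sup>2 * (\<Sum>s\<in>Sym n. (Del m D ?h s)\<^sup>2)"
    by (simp add: Del_def power_divide sum_divide_distrib[symmetric])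
  finally show ?thesis by (simp add: power2_eq_square mult.assoc)
qed

section \<open>Exchanging the roles of permutation and relabelling\<close>

lemma Sym_inv_o: "s \<in> Sym n \<Longrightarrow> t \<in> Sym n \<Longrightarrow> inv (s \<circ> t) = inv t \<circ> inv s"
  by (rule o_inv_distrib) (auto simp: Sym_def permutes_bij)

text \<open>The substitution of \<open>th \<circ> inv t \<circ> inv r \<circ> s\<close> for
  \<open>r\<close> turns an average over permutations near \<open>s\<close> into one over
  relabellings near \<open>th \<circ> inv t\<close>.\<close>

lemma CE_twist:
  assumes s: "s \<in> Sym n" and th: "th \<in> Sym n" and t: "t \<in> Sym n"
  shows "CE n S (\<lambda>r. f (r \<circ> t \<circ> inv th)) s = CE n S (\<lambda>e. f (s \<circ> inv e)) (th \<circ> inv t)"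
proof -
  have "(\<Sum>r\<in>cls n S s. f (r \<circ> t \<circ> inv th)) = (\<Sum>e\<in>cls n S (th \<circ> inv t). f (s \<circ> inv e))"
  proof (rule sum.reindex_bij_witness[where i = "\<lambda>e. s \<circ> inv e \<circ> th \<circ> inv t" and j = "\<lambda>r. th \<circ> inv t \<circ> inv r \<circ> s"])
    fix r assume r: "r \<in> cls n S s"
    then have rS: "r \<in> Sym n" by (rule cls_subset)
    have i: "inv (th \<circ> inv t \<circ> inv r \<circ> s) = inv s \<circ> r \<circ> t \<circ> inv th"
      using s th t rS by (simp add: Sym_inv_o[where n = n] Sym_comp Sym_inv fun_eq_iff)
    show "s \<circ> inv (th \<circ> inv t \<circ> inv r \<circ> s) \<circ> th \<circ> inv t = r"
      unfolding i using s th t rS by (simp add: fun_eq_iff)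
    show "f (s \<circ> inv (th \<circ> inv t \<circ> inv r \<circ> s)) = f (r \<circ> t \<circ> inv th)"
      unfolding i using s by (intro arg_cong[of _ _ f]) (simp add: fun_eq_iff)
    have "inv r (s i) = i" if "i \<in> S" for i
    proof -
      have "r i = s i" using r that by (simp add: cls_def)
      then show ?thesis using Sym_inv_app(1)[OF rS, of i] by simp
    qed
    then show "th \<circ> inv t \<circ> inv r \<circ> s \<in> cls n S (th \<circ> inv t)"
      using s th t rS by (auto simp: cls_def intro!: Sym_comp Sym_inv)
  next
    fix e assume e: "e \<in> cls n S (th \<circ> inv t)"
    then have eS: "e \<in> Sym n" by (rule cls_subset)
    have i: "inv (s \<circ> inv e \<circ> th \<circ> inv t) = t \<circ> inv th \<circ> e \<circ> inv s"
      using s th t eS by (simp add: Sym_inv_o[where n = n] Sym_comp Sym_inv fun_eq_iff)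
    show "th \<circ> inv t \<circ> inv (s \<circ> inv e \<circ> th \<circ> inv t) \<circ> s = e"
      unfolding i using s th t eS by (simp add: fun_eq_iff)
    have "inv e (th (inv t i)) = i" if "i \<in> S" for i
    proof -
      have "e i = th (inv t i)" using e that by (simp add: cls_def)
      then show ?thesis using Sym_inv_app(1)[OF eS, of i] by simp
    qed
    then show "s \<circ> inv e \<circ> th \<circ> inv t \<in> cls n S s"
      using s th t eS by (auto simp: cls_def intro!: Sym_comp Sym_inv)
  qed
  then show ?thesis by (simp add: CE_def)
qed

text \<open>In \<open>wcoef\<close> the alternation comes first and the conditioning second, while
  \<open>Del_CE_lower\<close> needs the opposite order. Read as a function of the relabelling
  \<open>th\<close>, the same number has that order.\<close>

lemma CE_Del_twist:
  assumes s: "s \<in> Sym n" and th: "th \<in> Sym n" and D: "D \<subseteq> {1..m}" and m: "2 * m \<le> n"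
  shows "CE n D (Del m D (\<lambda>r. f (r \<circ> inv th))) s = Del m D (CE n D (\<lambda>e. f (s \<circ> inv e))) th"
proof -
  have "CE n D (Del m D (\<lambda>r. f (r \<circ> inv th))) s
     = (\<Sum>B\<in>Pow D. sg B * CE n D (\<lambda>r. f (r \<circ> sw m B \<circ> inv th)) s) / 2 ^ card D"
    unfolding Del_def CE_divide CE_sum CE_cmult ..
  also have "\<dots> = (\<Sum>B\<in>Pow D. sg B * CE n D (\<lambda>e. f (s \<circ> inv e)) (th \<circ> sw m B)) / 2 ^ card D"
  proof (intro arg_cong2[of _ _ _ _ "(/)"] sum.cong refl arg_cong2[of _ _ _ _ "(*)"])
    fix B assume "B \<in> Pow D"
    then have B: "B \<subseteq> {1..m}" using D by auto
    show "CE n D (\<lambda>r. f (r \<circ> sw m B \<circ> inv th)) s = CE n D (\<lambda>e. f (s \<circ> inv e)) (th \<circ> sw m B)"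
      using CE_twist[OF s th sw_Sym[OF B m], of D f] sw_inv[OF B] by simp
  qed
  finally show ?thesis by (simp add: Del_def)
qed

lemma CE_twist_id:
  assumes "s \<in> Sym n" "th \<in> Sym n"
  shows "CE n S (\<lambda>e. v (s \<circ> inv e)) th = CE n S (\<lambda>r. v (r \<circ> inv th)) s"
  using CE_twist[OF assms Sym_id, of S v] by simp

text \<open>The witness exchanges \<open>I - J\<close> with \<open>J - I\<close> along a bijection
  and fixes all else, the form that \<open>CE_swap_out\<close> requires with
  \<open>B = I - J\<close>.\<close>

lemma exists_swap_perm:
  assumes I: "I \<subseteq> {1..n}" "J \<subseteq> {1..n}" "card I = card J"
  shows "\<exists>t\<in>Sym n. t \<circ> t = id \<and> t ` I = J \<and> (\<forall>i\<in>I - (I - J). t i = i) \<and> t ` (I - J) \<inter> I = {}"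
proof -
  have fin: "finite I" "finite J" using I by (meson finite_subset_interval finite_subset)+
  have "card (I - J) = card (J - I)"
    using I(3) fin by (metis card_Diff_subset_Int Int_commute finite_Int)
  then obtain b where b: "bij_betw b (I - J) (J - I)"
    using finite_same_card_bij[of "I - J" "J - I"] fin by auto
  let ?c = "inv_into (I - J) b"
  define t where "t x = (if x \<in> I - J then b x else if x \<in> J - I then ?c x else x)" for x
  have b1: "b x \<in> J - I" "?c (b x) = x" if "x \<in> I - J" for x
    using b that bij_betw_inv_into_left[OF b that] by (auto simp: bij_betw_def)
  have c1: "?c x \<in> I - J" "b (?c x) = x" if "x \<in> J - I" for x
    using bij_betw_inv_into[OF b] that bij_betw_inv_into_right[OF b that] by (auto simp: bij_betw_def)
  have tt: "t (t x) = x" for x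
    using b1[of x] c1[of x] by (auto simp: t_def)
  then have inv: "t \<circ> t = id" by (auto simp: fun_eq_iff tt)
  have "bij t" by (rule o_bij[OF inv inv])
  moreover have "t x = x" if "x \<notin> {1..n}" for x using that I by (auto simp: t_def)
  ultimately have tS: "t \<in> Sym n" unfolding Sym_def mem_Collect_eq permutes_def by (metis bij_pointE)
  have "t ` (I - J) = b ` (I - J)" by (intro image_cong refl) (simp add: t_def)
  then have B: "t ` (I - J) = J - I" using b by (simp add: bij_betw_def)
  have "t ` (I \<inter> J) = I \<inter> J" by (force simp: t_def)
  then have "t ` ((I - J) \<union> (I \<inter> J)) = (J - I) \<union> (I \<inter> J)" unfolding image_Un B by simp
  moreover have "(I - J) \<union> (I \<inter> J) = I" "(J - I) \<union> (I \<inter> J) = J" by auto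
  ultimately have im: "t ` I = J" by simp
  show ?thesis
  proof (intro bexI[OF _ tS] conjI)
    show "t ` (I - J) \<inter> I = {}" unfolding B by auto
  qed (use inv im in \<open>auto simp: t_def\<close>)
qed

text \<open>After averaging over relabellings, the correlation depends symmetrically on points and on values. The
  identity \<open>CE_swap_out\<close>, applied once to the points and once to the values, produces the
  sign \<open>sg B\<close> twice and leaves the square of a group average.\<close>

lemma pair_correlation_nonneg:
  assumes v: "low_orth n v d" and I: "I \<subseteq> {1..n}" "card I = d" and J: "J \<subseteq> {1..n}" "card J = d"
  shows "0 \<le> (\<Sum>th\<in>Sym n. \<Sum>s\<in>Sym n. CE n (th ` I) v s * CE n (th ` J) v s)"
proof -
  obtain t where t: "t \<in> Sym n" "t \<circ> t = id" "t ` I = J" "\<forall>i\<in>I - (I - J). t i = i" "t ` (I - J) \<inter> I = {}"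
    using exists_swap_perm[of I n J] I J by auto
  define B where "B = I - J"
  have B: "B \<subseteq> I" "B \<subseteq> {1..n}" using I by (auto simp: B_def)
  have finB: "finite B" using B(2) by (rule finite_subset_interval)
  let ?P = "{k. k permutes B}"
  \<comment> \<open>By the next fact but one, the same number is a conditional expectation in the
    variable \<open>th\<close>; this is the symmetry between points and values.\<close>
  define \<Gamma> where "\<Gamma> th s = CE n I (\<lambda>r. v (r \<circ> inv th)) s"  for th s :: "nat \<Rightarrow> nat"
  define c where "c = (fact (n - card (I \<union> t ` I)) / fact (n - card I) :: real)"
  have \<Gamma>': "\<Gamma> th s = CE n I (\<lambda>e. v (s \<circ> inv e)) th" if "s \<in> Sym n" "th \<in> Sym n" for th s
    using CE_twist_id[OF that] by (simp add: \<Gamma>_def)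
  have PS: "k \<in> Sym n" if "k \<in> ?P" for k using that permutes_Sym[OF _ B(2)] by blast
  have move: "CE n (k ` I) (\<lambda>r. v (r \<circ> inv th)) s = \<Gamma> (th \<circ> k) (s \<circ> k)"
    if "s \<in> Sym n" "th \<in> Sym n" "k \<in> Sym n" for s th k :: "nat \<Rightarrow> nat"
  proof -
    have "(\<lambda>r. v (r \<circ> inv th)) = (\<lambda>r. (\<lambda>q. v (q \<circ> inv (th \<circ> k))) (r \<circ> k))"
    proof (rule ext)
      fix r :: "nat \<Rightarrow> nat"
      have "r \<circ> k \<circ> inv (th \<circ> k) = r \<circ> inv th"
        using that by (simp add: Sym_inv_o[where n = n] fun_eq_iff)
      then show "v (r \<circ> inv th) = (\<lambda>q. v (q \<circ> inv (th \<circ> k))) (r \<circ> k)" by simp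
    qed
    then show ?thesis using CE_right[OF that(3), of I "\<lambda>q. v (q \<circ> inv (th \<circ> k))" s] by (simp add: \<Gamma>_def)
  qed
  \<comment> \<open>Applying \<open>k\<close> in both arguments only permutes the points inside
    \<open>I\<close>, on which the conditioning is symmetric.\<close>
  have invar: "\<Gamma> (th \<circ> k) (s \<circ> k) = \<Gamma> th s" if "s \<in> Sym n" "th \<in> Sym n" "k \<in> ?P" for s th k
  proof -
    have "k permutes I" using that(3) B(1) by (auto intro: permutes_subset)
    then have "k ` I = I" by (rule permutes_image)
    then show ?thesis using move[OF that(1,2) PS[OF that(3)]] by (simp add: \<Gamma>_def)
  qed
  have fixt: "t i = i" if "i \<in> I - B" for i using t(4) that by (auto simp: B_def)
  have out: "t ` B \<inter> I = {}" using t(5) by (simp add: B_def)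
  have swap1: "(\<Sum>th\<in>Sym n. \<Gamma> th s * \<Gamma> (th \<circ> t) s') = sg B * c * (\<Sum>th\<in>Sym n. \<Gamma> th s * (\<Sum>k\<in>?P. \<Gamma> (th \<circ> k) s'))"
    if s: "s \<in> Sym n" "s' \<in> Sym n" for s s'
  proof -
    let ?G = "\<lambda>(q::nat \<Rightarrow> nat) (e::nat \<Rightarrow> nat). v (q \<circ> inv e)"
    have "(\<Sum>th\<in>Sym n. \<Gamma> th s * \<Gamma> (th \<circ> t) s') = (\<Sum>th\<in>Sym n. CE n I (?G s) th * CE n I (?G s') (th \<circ> t))"
      by (intro sum.cong refl) (simp add: \<Gamma>' s t(1) Sym_comp)
    also have "\<dots> = (\<Sum>th\<in>Sym n. CE n I (?G s) th * CE n I (\<lambda>th. CE n I (?G s') (th \<circ> t)) th)"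
      by (rule sum_Sym_CE_pull[OF I(1) CE_dep, symmetric])
    also have "\<dots> = (\<Sum>th\<in>Sym n. CE n I (?G s) th * (sg B * c * (\<Sum>k\<in>?P. CE n I (?G s') (th \<circ> k))))"
      unfolding c_def
      by (intro sum.cong refl arg_cong2[of _ _ _ _ "(*)"] CE_swap_out[OF _ I(1) B(1) t(1,2) fixt out])
         (use low_orth_twist[OF v s(2)] I in auto)
    also have "\<dots> = (\<Sum>th\<in>Sym n. \<Gamma> th s * (sg B * c * (\<Sum>k\<in>?P. \<Gamma> (th \<circ> k) s')))"
      by (intro sum.cong refl arg_cong2[of _ _ _ _ "(*)"]) (simp_all add: \<Gamma>' s PS Sym_comp)
    finally show ?thesis by (simp add: sum_distrib_left mult_ac)
  qed
  have swap2: "(\<Sum>s\<in>Sym n. \<Gamma> th s * \<Gamma> th' (s \<circ> t)) = sg B * c * (\<Sum>s\<in>Sym n. \<Gamma> th s * (\<Sum>k\<in>?P. \<Gamma> th' (s \<circ> k)))"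
    if th: "th \<in> Sym n" "th' \<in> Sym n" for th th'
  proof -
    let ?G = "\<lambda>(q::nat \<Rightarrow> nat) (r::nat \<Rightarrow> nat). v (r \<circ> inv q)"
    have "(\<Sum>s\<in>Sym n. \<Gamma> th s * \<Gamma> th' (s \<circ> t)) = (\<Sum>s\<in>Sym n. CE n I (?G th) s * CE n I (\<lambda>s. CE n I (?G th') (s \<circ> t)) s)"
      unfolding \<Gamma>_def by (rule sum_Sym_CE_pull[OF I(1) CE_dep, symmetric])
    also have "\<dots> = (\<Sum>s\<in>Sym n. CE n I (?G th) s * (sg B * c * (\<Sum>k\<in>?P. CE n I (?G th') (s \<circ> k))))"
      unfolding c_def
      by (intro sum.cong refl arg_cong2[of _ _ _ _ "(*)"] CE_swap_out[OF _ I(1) B(1) t(1,2) fixt out])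
         (use low_orth_right[OF v Sym_inv[OF th(2)]] I in auto)
    finally show ?thesis by (simp add: sum_distrib_left mult_ac \<Gamma>_def)
  qed
  have "(\<Sum>th\<in>Sym n. \<Sum>s\<in>Sym n. CE n (th ` I) v s * CE n (th ` J) v s)
     = (\<Sum>th\<in>Sym n. \<Sum>s\<in>Sym n. \<Gamma> th s * \<Gamma> (th \<circ> t) (s \<circ> t))"
  proof (rule sum.cong[OF refl])
    fix th assume th: "th \<in> Sym n"
    have "(\<Sum>s\<in>Sym n. CE n (th ` I) v s * CE n (th ` J) v s)
       = (\<Sum>s\<in>Sym n. CE n (th ` I) v (s \<circ> inv th) * CE n (th ` J) v (s \<circ> inv th))"
      by (rule sum_Sym_right[OF Sym_inv[OF th], symmetric])
    also have "\<dots> = (\<Sum>s\<in>Sym n. \<Gamma> th s * \<Gamma> (th \<circ> t) (s \<circ> t))"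
    proof (rule sum.cong[OF refl])
      fix s assume s: "s \<in> Sym n"
      show "CE n (th ` I) v (s \<circ> inv th) * CE n (th ` J) v (s \<circ> inv th) = \<Gamma> th s * \<Gamma> (th \<circ> t) (s \<circ> t)"
        using move[OF s th t(1)] by (simp add: \<Gamma>_def CE_right'[OF th, symmetric] t(3))
    qed
    finally show "(\<Sum>s\<in>Sym n. CE n (th ` I) v s * CE n (th ` J) v s) = (\<Sum>s\<in>Sym n. \<Gamma> th s * \<Gamma> (th \<circ> t) (s \<circ> t))" .
  qed
  also have "\<dots> = (\<Sum>s\<in>Sym n. \<Sum>th\<in>Sym n. \<Gamma> th s * \<Gamma> (th \<circ> t) (s \<circ> t))" by (rule sum.swap)
  also have "\<dots> = (\<Sum>s\<in>Sym n. sg B * c * (\<Sum>th\<in>Sym n. \<Gamma> th s * (\<Sum>k\<in>?P. \<Gamma> (th \<circ> k) (s \<circ> t))))"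
    by (intro sum.cong refl swap1) (use t(1) in \<open>auto intro: Sym_comp\<close>)
  also have "\<dots> = sg B * c * (\<Sum>s\<in>Sym n. \<Sum>th\<in>Sym n. \<Sum>k\<in>?P. \<Gamma> th s * \<Gamma> (th \<circ> k) (s \<circ> t))"
    by (simp add: sum_distrib_left)
  also have "(\<Sum>s\<in>Sym n. \<Sum>th\<in>Sym n. \<Sum>k\<in>?P. \<Gamma> th s * \<Gamma> (th \<circ> k) (s \<circ> t))
     = (\<Sum>th\<in>Sym n. \<Sum>k\<in>?P. \<Sum>s\<in>Sym n. \<Gamma> th s * \<Gamma> (th \<circ> k) (s \<circ> t))"
    by (subst sum.swap, rule sum.cong[OF refl], rule sum.swap)
  also have "\<dots> = (\<Sum>th\<in>Sym n. \<Sum>k\<in>?P. sg B * c * (\<Sum>s\<in>Sym n. \<Gamma> th s * (\<Sum>k'\<in>?P. \<Gamma> (th \<circ> k) (s \<circ> k'))))"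
    by (intro sum.cong refl swap2) (auto intro: Sym_comp PS)
  also have "\<dots> = sg B * c * (\<Sum>th\<in>Sym n. \<Sum>k\<in>?P. \<Sum>s\<in>Sym n. \<Sum>k'\<in>?P. \<Gamma> th s * \<Gamma> (th \<circ> k) (s \<circ> k'))"
    by (simp add: sum_distrib_left)
  also have "(\<Sum>th\<in>Sym n. \<Sum>k\<in>?P. \<Sum>s\<in>Sym n. \<Sum>k'\<in>?P. \<Gamma> th s * \<Gamma> (th \<circ> k) (s \<circ> k'))
     = (\<Sum>th\<in>Sym n. \<Sum>s\<in>Sym n. \<Sum>k'\<in>?P. \<Sum>k\<in>?P. \<Gamma> th s * \<Gamma> (th \<circ> k) (s \<circ> k'))"
    by (rule sum.cong[OF refl], subst sum.swap, rule sum.cong[OF refl], rule sum.swap)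
  \<comment> \<open>By \<open>invar\<close> the second group variable is absorbed into the first, so
    the double sum is \<open>card ?P\<close> copies of a single one, to which
    \<open>group_average_nonneg\<close> applies.\<close>
  also have "\<dots> = (\<Sum>th\<in>Sym n. \<Sum>s\<in>Sym n. \<Sum>k'\<in>?P. \<Sum>k\<in>?P. \<Gamma> th s * \<Gamma> (th \<circ> k) s)"
  proof (rule sum.cong[OF refl], rule sum.cong[OF refl], rule sum.cong[OF refl])
    fix th s k' assume th: "th \<in> Sym n" and s: "s \<in> Sym n" and k': "k' \<in> ?P"
    show "(\<Sum>k\<in>?P. \<Gamma> th s * \<Gamma> (th \<circ> k) (s \<circ> k')) = (\<Sum>k\<in>?P. \<Gamma> th s * \<Gamma> (th \<circ> k) s)"
    proof (rule sum.reindex_bij_witness[where i = "\<lambda>q. q \<circ> k'" and j = "\<lambda>q. q \<circ> inv k'"])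
      fix k assume k: "k \<in> ?P"
      show "k \<circ> inv k' \<circ> k' = k" "k \<circ> k' \<circ> inv k' = k"
        using PS[OF k'] by (simp_all add: fun_eq_iff)
      show m: "k \<circ> inv k' \<in> ?P" "k \<circ> k' \<in> ?P"
        using k k' by (simp_all add: permutes_compose permutes_inv)
      have "\<Gamma> (th \<circ> (k \<circ> inv k') \<circ> k') (s \<circ> k') = \<Gamma> (th \<circ> (k \<circ> inv k')) s"
        by (rule invar[OF s _ k']) (intro Sym_comp th PS m)
      moreover have "th \<circ> (k \<circ> inv k') \<circ> k' = th \<circ> k" using PS[OF k'] by (simp add: fun_eq_iff)
      ultimately show "\<Gamma> th s * \<Gamma> (th \<circ> (k \<circ> inv k')) s = \<Gamma> th s * \<Gamma> (th \<circ> k) (s \<circ> k')" by simp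
    qed
  qed
  also have "\<dots> = real (card ?P) * (\<Sum>s\<in>Sym n. \<Sum>th\<in>Sym n. \<Gamma> th s * (\<Sum>k\<in>?P. \<Gamma> (th \<circ> k) s))"
    by (subst sum.swap) (simp add: sum_distrib_left)
  also have "sg B * c * (sg B * c * (real (card ?P) * (\<Sum>s\<in>Sym n. \<Sum>th\<in>Sym n. \<Gamma> th s * (\<Sum>k\<in>?P. \<Gamma> (th \<circ> k) s))))
     = (sg B * sg B) * (c * c) * real (card ?P) * (\<Sum>s\<in>Sym n. \<Sum>th\<in>Sym n. \<Gamma> th s * (\<Sum>k\<in>?P. \<Gamma> (th \<circ> k) s))"
    by (simp only: mult_ac)
  also have "0 \<le> \<dots>"
  proof -
    have "0 \<le> (\<Sum>s\<in>Sym n. \<Sum>th\<in>Sym n. \<Gamma> th s * (\<Sum>k\<in>?P. \<Gamma> (th \<circ> k) s))"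
      by (rule sum_nonneg) (rule group_average_nonneg[OF B(2), where h = "\<lambda>th. \<Gamma> th _"])
    then show ?thesis unfolding sg_sg by (intro mult_nonneg_nonneg) (simp_all add: c_def)
  qed
  finally show ?thesis .
qed

section \<open>Averaging over relabellings\<close>

lemma bij_subs_image:
  assumes "t \<in> Sym n"
  shows "bij_betw (\<lambda>I. t ` I) (subs {1..n} d) (subs {1..n} d)"
proof (rule bij_betw_byWitness[where f' = "\<lambda>I. inv t ` I"])
  show "\<forall>a\<in>subs {1..n} d. inv t ` t ` a = a" "\<forall>a'\<in>subs {1..n} d. t ` inv t ` a' = a'"
    using assms by (auto simp: image_image)
  have "t ` I \<in> subs {1..n} d" if "t \<in> Sym n" "I \<in> subs {1..n} d" for t I
    using Sym_image_subset[OF that(1), of I] Sym_card_image[OF that(1), of I] that(2) by simp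
  then show "(\<lambda>I. t ` I) ` subs {1..n} d \<subseteq> subs {1..n} d" "(\<lambda>I. inv t ` I) ` subs {1..n} d \<subseteq> subs {1..n} d"
    using assms Sym_inv[OF assms] by blast+
qed

text \<open>With \<open>A\<close> the sum of the operators \<open>CE n I\<close>, this compares the
  inner product of \<open>A v\<close> and \<open>v\<close> with the squared norm of
  \<open>A v\<close>. Both sides are invariant under relabelling; after averaging, all pair
  correlations are non-negative, and the diagonal ones make up the left side.\<close>

lemma sum_CE_sq_le:
  assumes v: "low_orth n v d"
  shows "(\<Sum>I\<in>subs {1..n} d. \<Sum>s\<in>Sym n. (CE n I v s)\<^sup>2) \<le> (\<Sum>s\<in>Sym n. (\<Sum>I\<in>subs {1..n} d. CE n I v s)\<^sup>2)"
proof -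
  let ?D = "subs {1..n} d"
  have re: "(\<Sum>I\<in>?D. F (th ` I)) = (\<Sum>I\<in>?D. F I)" if "th \<in> Sym n" for th and F :: "nat set \<Rightarrow> real"
    by (rule sum.reindex_bij_betw[OF bij_subs_image[OF that]])
  have "real (fact n) * (\<Sum>I\<in>?D. \<Sum>s\<in>Sym n. (CE n I v s)\<^sup>2)
     = (\<Sum>th\<in>Sym n. \<Sum>I\<in>?D. \<Sum>s\<in>Sym n. (CE n (th ` I) v s)\<^sup>2)"
  proof -
    have "(\<Sum>th\<in>Sym n. \<Sum>I\<in>?D. \<Sum>s\<in>Sym n. (CE n (th ` I) v s)\<^sup>2) = (\<Sum>th\<in>Sym n. \<Sum>I\<in>?D. \<Sum>s\<in>Sym n. (CE n I v s)\<^sup>2)"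
      by (intro sum.cong refl re)
    then show ?thesis by (simp add: card_Sym)
  qed
  also have "\<dots> = (\<Sum>I\<in>?D. \<Sum>th\<in>Sym n. \<Sum>s\<in>Sym n. (CE n (th ` I) v s)\<^sup>2)" by (rule sum.swap)
  also have "\<dots> \<le> (\<Sum>I\<in>?D. \<Sum>J\<in>?D. \<Sum>th\<in>Sym n. \<Sum>s\<in>Sym n. CE n (th ` I) v s * CE n (th ` J) v s)"
  proof (rule sum_mono)
    fix I assume I: "I \<in> ?D"
    have fin: "finite ?D" by (auto intro: finite_subset[of _ "Pow {1..n}"])
    have "(\<Sum>th\<in>Sym n. \<Sum>s\<in>Sym n. CE n (th ` I) v s * CE n (th ` I) v s)
      \<le> (\<Sum>J\<in>?D. \<Sum>th\<in>Sym n. \<Sum>s\<in>Sym n. CE n (th ` I) v s * CE n (th ` J) v s)"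
      by (rule member_le_sum[OF I _ fin]) (use I pair_correlation_nonneg[OF v] in auto)
    then show "(\<Sum>th\<in>Sym n. \<Sum>s\<in>Sym n. (CE n (th ` I) v s)\<^sup>2)
      \<le> (\<Sum>J\<in>?D. \<Sum>th\<in>Sym n. \<Sum>s\<in>Sym n. CE n (th ` I) v s * CE n (th ` J) v s)"
      by (simp add: power2_eq_square)
  qed
  also have "\<dots> = (\<Sum>th\<in>Sym n. \<Sum>s\<in>Sym n. (\<Sum>I\<in>?D. CE n (th ` I) v s)\<^sup>2)"
  proof -
    have "(\<Sum>I\<in>?D. \<Sum>J\<in>?D. \<Sum>th\<in>Sym n. \<Sum>s\<in>Sym n. CE n (th ` I) v s * CE n (th ` J) v s)
       = (\<Sum>I\<in>?D. \<Sum>th\<in>Sym n. \<Sum>s\<in>Sym n. \<Sum>J\<in>?D. CE n (th ` I) v s * CE n (th ` J) v s)"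
      by (rule sum.cong[OF refl], subst sum.swap, rule sum.cong[OF refl], rule sum.swap)
    also have "\<dots> = (\<Sum>th\<in>Sym n. \<Sum>s\<in>Sym n. \<Sum>I\<in>?D. \<Sum>J\<in>?D. CE n (th ` I) v s * CE n (th ` J) v s)"
      by (subst sum.swap, rule sum.cong[OF refl], rule sum.swap)
    finally show ?thesis by (simp add: power2_eq_square sum_product)
  qed
  also have "\<dots> = (\<Sum>th\<in>Sym n. \<Sum>s\<in>Sym n. (\<Sum>I\<in>?D. CE n I v s)\<^sup>2)"
    by (intro sum.cong refl arg_cong[of _ _ "\<lambda>x. x\<^sup>2"] re)
  also have "\<dots> = real (fact n) * (\<Sum>s\<in>Sym n. (\<Sum>I\<in>?D. CE n I v s)\<^sup>2)" by (simp add: card_Sym)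
  finally show ?thesis by (rule mult_left_le_imp_le) simp
qed

lemma sum_CE_sq_average:
  assumes D: "D \<in> subs {1..n} d"
  shows "real (n choose d) * (\<Sum>th\<in>Sym n. \<Sum>s\<in>Sym n. (CE n (th ` D) v s)\<^sup>2)
    = fact n * (\<Sum>I\<in>subs {1..n} d. \<Sum>s\<in>Sym n. (CE n I v s)\<^sup>2)"
proof -
  let ?D = "subs {1..n} d" and ?X = "\<lambda>I. \<Sum>s\<in>Sym n. (CE n I v s)\<^sup>2"
  have "(\<Sum>th\<in>Sym n. ?X (th ` I)) = (\<Sum>th\<in>Sym n. ?X (th ` D))" if I: "I \<in> ?D" for I
  proof -
    obtain t where t: "t \<in> Sym n" "t ` D = I" using exists_swap_perm[of D n I] D I by auto
    have "(\<Sum>th\<in>Sym n. ?X ((th \<circ> t) ` D)) = (\<Sum>th\<in>Sym n. ?X (th ` D))"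
      by (rule sum_Sym_right[OF t(1)])
    then show ?thesis unfolding image_comp[symmetric] t(2) .
  qed
  then have "(\<Sum>I\<in>?D. \<Sum>th\<in>Sym n. ?X (th ` I)) = real (card ?D) * (\<Sum>th\<in>Sym n. ?X (th ` D))" by simp
  moreover have "(\<Sum>I\<in>?D. \<Sum>th\<in>Sym n. ?X (th ` I)) = (\<Sum>th\<in>Sym n. \<Sum>I\<in>?D. ?X (th ` I))" by (rule sum.swap)
  moreover have "\<dots> = (\<Sum>th\<in>Sym n. \<Sum>I\<in>?D. ?X I)"
    by (intro sum.cong refl sum.reindex_bij_betw[OF bij_subs_image, of _ n ?X d])
  ultimately show ?thesis using n_subsets[of "{1..n}" d] by (simp add: card_Sym)
qed

section \<open>Low-degree functions\<close>

text \<open>Orthogonal projection onto a finite span by Gram-Schmidt: \<open>p\<close> is the part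
  of the new vector orthogonal to the old ones, and \<open>u\<close> the old residual.\<close>

lemma exists_projection:
  fixes b :: "'i \<Rightarrow> 'a \<Rightarrow> real"
  assumes "finite Idx"
  shows "\<exists>c. \<forall>j\<in>Idx. (\<Sum>r\<in>\<Omega>. (f r - (\<Sum>i\<in>Idx. c i * b i r)) * b j r) = 0"
  using assms
proof (induction Idx arbitrary: f)
  case empty
  then show ?case by simp
next
  case (insert x Idx)
  obtain c1 where c1: "\<And>j. j \<in> Idx \<Longrightarrow> (\<Sum>r\<in>\<Omega>. (f r - (\<Sum>i\<in>Idx. c1 i * b i r)) * b j r) = 0"
    using insert.IH by blast
  obtain c2 where c2: "\<And>j. j \<in> Idx \<Longrightarrow> (\<Sum>r\<in>\<Omega>. (b x r - (\<Sum>i\<in>Idx. c2 i * b i r)) * b j r) = 0"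
    using insert.IH by blast
  define u where "u r = f r - (\<Sum>i\<in>Idx. c1 i * b i r)" for r
  define p where "p r = b x r - (\<Sum>i\<in>Idx. c2 i * b i r)" for r
  \<comment> \<open>For a vector dependent on the old ones the denominator vanishes and the quotient
    is 0 by convention, so the old projection is kept.\<close>
  define a where "a = (\<Sum>r\<in>\<Omega>. u r * p r) / (\<Sum>r\<in>\<Omega>. p r * p r)"
  define c where "c i = (if i = x then a else c1 i - a * c2 i)" for i
  have res: "f r - (\<Sum>i\<in>insert x Idx. c i * b i r) = u r - a * p r" for r
  proof -
    have "(\<Sum>i\<in>Idx. c i * b i r) = (\<Sum>i\<in>Idx. c1 i * b i r - a * (c2 i * b i r))"
      using insert.hyps by (intro sum.cong refl) (auto simp: c_def algebra_simps)
    then show ?thesis using insert.hyps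
      by (simp add: sum_subtractf sum_distrib_left[symmetric] u_def p_def c_def algebra_simps)
  qed
  have ub: "(\<Sum>r\<in>\<Omega>. (u r - a * p r) * b j r) = 0" if "j \<in> Idx" for j
  proof -
    have "(\<Sum>r\<in>\<Omega>. (u r - a * p r) * b j r) = (\<Sum>r\<in>\<Omega>. u r * b j r) - a * (\<Sum>r\<in>\<Omega>. p r * b j r)"
      by (simp add: algebra_simps sum_subtractf sum_distrib_left)
    then show ?thesis using c1[OF that] c2[OF that] by (simp add: u_def p_def)
  qed
  have up: "(\<Sum>r\<in>\<Omega>. (u r - a * p r) * p r) = 0"
  proof -
    have e: "(\<Sum>r\<in>\<Omega>. (u r - a * p r) * p r) = (\<Sum>r\<in>\<Omega>. u r * p r) - a * (\<Sum>r\<in>\<Omega>. p r * p r)"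
      by (simp add: algebra_simps sum_subtractf sum_distrib_left)
    show ?thesis
    proof (cases "(\<Sum>r\<in>\<Omega>. p r * p r) = 0")
      case True
      have "(\<Sum>r\<in>\<Omega>. u r * p r) = 0"
      proof (cases "finite \<Omega>")
        case fin: True
        then have "p r = 0" if "r \<in> \<Omega>" for r
          using True that by (subst (asm) sum_nonneg_eq_0_iff) auto
        then show ?thesis by (intro sum.neutral) auto
      qed simp
      then show ?thesis using e True by simp
    next
      case False
      then show ?thesis using e by (simp add: a_def)
    qed
  qed
  have ux: "(\<Sum>r\<in>\<Omega>. (u r - a * p r) * b x r) = 0"
  proof -
    have "(\<Sum>r\<in>\<Omega>. (u r - a * p r) * b x r)
       = (\<Sum>r\<in>\<Omega>. (u r - a * p r) * p r + (\<Sum>i\<in>Idx. c2 i * ((u r - a * p r) * b i r)))"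
      by (intro sum.cong refl) (simp add: p_def algebra_simps sum_distrib_left sum_subtractf sum.distrib)
    also have "\<dots> = (\<Sum>r\<in>\<Omega>. (u r - a * p r) * p r) + (\<Sum>i\<in>Idx. c2 i * (\<Sum>r\<in>\<Omega>. (u r - a * p r) * b i r))"
    proof -
      have "(\<Sum>r\<in>\<Omega>. \<Sum>i\<in>Idx. c2 i * ((u r - a * p r) * b i r)) = (\<Sum>i\<in>Idx. \<Sum>r\<in>\<Omega>. c2 i * ((u r - a * p r) * b i r))"
        by (rule sum.swap)
      then show ?thesis by (simp only: sum.distrib sum_distrib_left)
    qed
    also have "\<dots> = 0" using up ub by simp
    finally show ?thesis .
  qed
  show ?case
  proof (intro exI ballI)
    fix j assume "j \<in> insert x Idx"
    then show "(\<Sum>r\<in>\<Omega>. (f r - (\<Sum>i\<in>insert x Idx. c i * b i r)) * b j r) = 0"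
      unfolding res using ux ub by auto
  qed
qed

text \<open>The indexing is redundant, since all permutations of a class yield the same indicator.
  The strict inequality makes \<open>d = 0\<close> the zero space, matching
  \<open>V_le n (int d - 1)\<close>.\<close>

definition low_idx :: "nat \<Rightarrow> nat \<Rightarrow> (nat set \<times> (nat \<Rightarrow> nat)) set" where
  "low_idx n d = {S. S \<subseteq> {1..n} \<and> card S < d} \<times> Sym n"

definition ind :: "nat \<Rightarrow> nat set \<times> (nat \<Rightarrow> nat) \<Rightarrow> (nat \<Rightarrow> nat) \<Rightarrow> real" where
  "ind n i r = (if r \<in> cls n (fst i) (snd i) then 1 else 0)"

definition low_span :: "nat \<Rightarrow> nat \<Rightarrow> ((nat \<Rightarrow> nat) \<Rightarrow> real) \<Rightarrow> bool" where
  "low_span n d h \<longleftrightarrow> (\<exists>c. \<forall>r\<in>Sym n. h r = (\<Sum>i\<in>low_idx n d. c i * ind n i r))"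

lemma finite_low_idx [simp]: "finite (low_idx n d)"
  unfolding low_idx_def by (intro finite_cartesian_product finite_Sym) (auto intro: finite_subset[of _ "Pow {1..n}"])

lemma sum_ind: "(\<Sum>r\<in>Sym n. v r * ind n (S, s) r) = (\<Sum>r\<in>cls n S s. v r)"
proof -
  have "(\<Sum>r\<in>Sym n. v r * ind n (S, s) r) = (\<Sum>r\<in>Sym n. if r \<in> cls n S s then v r else 0)"
    by (intro sum.cong) (auto simp: ind_def)
  also have "\<dots> = (\<Sum>r\<in>cls n S s. v r)"
    by (rule sum.mono_neutral_cong_right) (auto simp: cls_def)
  finally show ?thesis .
qed

lemma low_orth_iff_ind:
  "low_orth n v d \<longleftrightarrow> (\<forall>i\<in>low_idx n d. (\<Sum>r\<in>Sym n. v r * ind n i r) = 0)"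
  by (auto simp: low_orth_def low_idx_def CE_def sum_ind)

lemma low_orth_low_span:
  assumes "low_orth n v d" "low_span n d h"
  shows "(\<Sum>r\<in>Sym n. v r * h r) = 0"
proof -
  obtain c where c: "\<forall>r\<in>Sym n. h r = (\<Sum>i\<in>low_idx n d. c i * ind n i r)" using assms(2) by (auto simp: low_span_def)
  have "(\<Sum>r\<in>Sym n. v r * h r) = (\<Sum>r\<in>Sym n. \<Sum>i\<in>low_idx n d. c i * (v r * ind n i r))"
    using c by (simp add: sum_distrib_left mult_ac)
  also have "\<dots> = (\<Sum>i\<in>low_idx n d. c i * (\<Sum>r\<in>Sym n. v r * ind n i r))"
    by (subst sum.swap) (simp add: sum_distrib_left)
  also have "\<dots> = 0" using assms(1) by (simp add: low_orth_iff_ind)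
  finally show ?thesis .
qed

lemma low_span_add: "low_span n d h \<Longrightarrow> low_span n d k \<Longrightarrow> low_span n d (\<lambda>r. h r + k r)"
  unfolding low_span_def
proof (elim exE)
  fix a b assume "\<forall>r\<in>Sym n. h r = (\<Sum>i\<in>low_idx n d. a i * ind n i r)" "\<forall>r\<in>Sym n. k r = (\<Sum>i\<in>low_idx n d. b i * ind n i r)"
  then show "\<exists>c. \<forall>r\<in>Sym n. h r + k r = (\<Sum>i\<in>low_idx n d. c i * ind n i r)"
    by (intro exI[of _ "\<lambda>i. a i + b i"]) (auto simp: sum.distrib distrib_right)
qed

lemma low_span_cmult: "low_span n d h \<Longrightarrow> low_span n d (\<lambda>r. a * h r)"
  unfolding low_span_def
proof (elim exE)
  fix c assume "\<forall>r\<in>Sym n. h r = (\<Sum>i\<in>low_idx n d. c i * ind n i r)"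
  then show "\<exists>c. \<forall>r\<in>Sym n. a * h r = (\<Sum>i\<in>low_idx n d. c i * ind n i r)"
    by (intro exI[of _ "\<lambda>i. a * c i"]) (auto simp: sum_distrib_left mult.assoc)
qed

lemma low_span_diff: "low_span n d h \<Longrightarrow> low_span n d k \<Longrightarrow> low_span n d (\<lambda>r. h r - k r)"
  using low_span_add[OF _ low_span_cmult[of n d k "-1"]] by simp

lemma low_span_0: "low_span n d (\<lambda>r. 0)"
  unfolding low_span_def by (intro exI[of _ "\<lambda>i. 0"]) simp

lemma low_span_sum: "(\<And>i. i \<in> I \<Longrightarrow> low_span n d (h i)) \<Longrightarrow> low_span n d (\<lambda>r. \<Sum>i\<in>I. h i r)"
  by (induction I rule: infinite_finite_induct) (auto intro: low_span_0 low_span_add)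

lemma low_span_ind: "i \<in> low_idx n d \<Longrightarrow> low_span n d (ind n i)"
  unfolding low_span_def
  by (intro exI[of _ "\<lambda>j. if j = i then 1 else 0"]) (simp add: if_distrib[of "\<lambda>x. x * _"] sum.delta cong: if_cong)

lemma low_span_cong: "(\<And>r. r \<in> Sym n \<Longrightarrow> h r = k r) \<Longrightarrow> low_span n d h = low_span n d k"
  unfolding low_span_def by simp

lemma low_span_mono:
  assumes "low_span n d h" "d \<le> e" shows "low_span n e h"
proof -
  obtain c where c: "\<forall>r\<in>Sym n. h r = (\<Sum>i\<in>low_idx n d. c i * ind n i r)" using assms(1) by (auto simp: low_span_def)
  have "low_span n e (\<lambda>r. \<Sum>i\<in>low_idx n d. c i * ind n i r)"
    using assms(2) by (intro low_span_sum low_span_cmult low_span_ind) (auto simp: low_idx_def)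
  then show ?thesis using c low_span_cong[of n h] by simp
qed

lemma low_span_dep:
  assumes "dep n S h" "S \<subseteq> {1..n}" "card S < d"
  shows "low_span n d h"
proof -
  \<comment> \<open>Each class is represented by all of its \<open>fact (n - card S)\<close>
    elements, hence the division.\<close>
  have "h r = (\<Sum>s\<in>Sym n. (h s / fact (n - card S)) * ind n (S, s) r)" if r: "r \<in> Sym n" for r
  proof -
    have "(\<Sum>s\<in>Sym n. (h s / fact (n - card S)) * ind n (S, s) r) = (\<Sum>s\<in>Sym n. (h s / fact (n - card S)) * ind n (S, r) s)"
      using r cls_sym by (intro sum.cong refl) (auto simp: ind_def)
    also have "\<dots> = CE n S h r" by (simp add: sum_ind[symmetric] CE_def sum_divide_distrib)
    also have "\<dots> = h r" by (rule CE_idem[OF assms(2,1) r])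
    finally show ?thesis by simp
  qed
  then have "low_span n d h = low_span n d (\<lambda>r. \<Sum>s\<in>Sym n. (h s / fact (n - card S)) * ind n (S, s) r)"
    by (rule low_span_cong)
  moreover have "low_span n d (\<lambda>r. \<Sum>s\<in>Sym n. (h s / fact (n - card S)) * ind n (S, s) r)"
    using assms by (intro low_span_sum low_span_cmult low_span_ind) (auto simp: low_idx_def)
  ultimately show ?thesis by simp
qed

lemma ind_dep: "dep n (fst i) (ind n i)"
  unfolding dep_def ind_def cls_def by auto

lemma low_span_right:
  assumes h: "low_span n d h" and t: "t \<in> Sym n"
  shows "low_span n d (\<lambda>r. h (r \<circ> t))"
proof -
  obtain c where c: "\<forall>r\<in>Sym n. h r = (\<Sum>i\<in>low_idx n d. c i * ind n i r)" using h by (auto simp: low_span_def)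
  have "low_span n d (\<lambda>r. \<Sum>i\<in>low_idx n d. c i * ind n i (r \<circ> t))"
  proof (intro low_span_sum low_span_cmult)
    fix i assume i: "i \<in> low_idx n d"
    have "dep n (t ` fst i) (\<lambda>r. ind n i (r \<circ> t))"
      unfolding dep_def by (auto intro!: depD[OF ind_dep] Sym_comp t)
    moreover have "t ` fst i \<subseteq> {1..n}" using i by (intro Sym_image_subset[OF t]) (auto simp: low_idx_def)
    moreover have "card (t ` fst i) < d" using i by (auto simp: low_idx_def Sym_card_image[OF t])
    ultimately show "low_span n d (\<lambda>r. ind n i (r \<circ> t))" by (rule low_span_dep)
  qed
  then show ?thesis using c t by (subst low_span_cong[of n _ "\<lambda>r. \<Sum>i\<in>low_idx n d. c i * ind n i (r \<circ> t)"]) (auto simp: Sym_comp)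
qed

lemma low_span_split:
  obtains p where "low_span n d p" "low_orth n (\<lambda>r. f r - p r) d"
proof -
  obtain c where "\<forall>j\<in>low_idx n d. (\<Sum>r\<in>Sym n. (f r - (\<Sum>i\<in>low_idx n d. c i * ind n i r)) * ind n j r) = 0"
    using exists_projection[OF finite_low_idx[of n d], where \<Omega> = "Sym n" and f = f and b = "ind n"] by blast
  then show ?thesis
    by (intro that[of "\<lambda>r. \<Sum>i\<in>low_idx n d. c i * ind n i r"])
       (auto simp: low_orth_iff_ind intro!: low_span_sum low_span_cmult low_span_ind)
qed

lemma low_orth_linear:
  "low_orth n v d \<Longrightarrow> low_orth n w d \<Longrightarrow> low_orth n (\<lambda>r. v r - w r) d"
  by (simp add: low_orth_def CE_diff)

lemma low_orth_sum:
  "(\<And>i. i \<in> I \<Longrightarrow> low_orth n (v i) d) \<Longrightarrow> low_orth n (\<lambda>r. \<Sum>i\<in>I. c i * v i r) d"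
  by (simp add: low_orth_def CE_sum CE_cmult)

lemma low_span_low_orth_zero:
  assumes "low_span n d v" "low_orth n v d" "r \<in> Sym n"
  shows "v r = 0"
proof -
  have "(\<Sum>r\<in>Sym n. v r * v r) = 0" by (rule low_orth_low_span[OF assms(2,1)])
  then show ?thesis using assms(3) by (subst (asm) sum_nonneg_eq_0_iff) auto
qed

text \<open>The operator \<open>A = (\<Sum>I. CE n I)\<close> satisfies \<open>A\<^sup>2 \<ge> A\<close> and is injective on the functions of pure
  degree \<open>d\<close>, hence \<open>A \<ge> 1\<close> there. The spectral theorem is avoided by writing \<open>g = A v\<close> and
  applying the Cauchy-Schwarz inequality to \<open>\<langle>A v, g\<rangle>\<close>.\<close>

lemma norm_le_sum_CE:
  assumes g1: "low_span n (Suc d) g" and g2: "low_orth n g d"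
  shows "(\<Sum>s\<in>Sym n. (g s)\<^sup>2) \<le> (\<Sum>I\<in>subs {1..n} d. \<Sum>s\<in>Sym n. (CE n I g s)\<^sup>2)"
proof -
  define DD where "DD = subs {1..n} d"
  define A where "A h r = (\<Sum>I\<in>DD. CE n I h r)" for h :: "(nat \<Rightarrow> nat) \<Rightarrow> real" and r
  have Dn: "I \<subseteq> {1..n}" "card I = d" if "I \<in> DD" for I using that unfolding DD_def by blast+
  have self: "(\<Sum>r\<in>Sym n. A h r * k r) = (\<Sum>I\<in>DD. \<Sum>r\<in>Sym n. CE n I h r * CE n I k r)" for h k
  proof -
    have "(\<Sum>r\<in>Sym n. A h r * k r) = (\<Sum>I\<in>DD. \<Sum>r\<in>Sym n. CE n I h r * k r)"
      unfolding A_def sum_distrib_right by (rule sum.swap)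
    also have "\<dots> = (\<Sum>I\<in>DD. \<Sum>r\<in>Sym n. CE n I h r * CE n I k r)"
      by (intro sum.cong[OF refl] sum_Sym_CE_pull[symmetric] Dn CE_dep)
    finally show ?thesis .
  qed
  have sym: "(\<Sum>r\<in>Sym n. A h r * k r) = (\<Sum>r\<in>Sym n. A k r * h r)" for h k
    unfolding self by (simp add: mult.commute)
  have A_span: "low_span n (Suc d) (A h)" for h
    unfolding A_def by (intro low_span_sum low_span_dep[OF CE_dep]) (use Dn in auto)
  have A_orth: "low_orth n (A h) d" if h: "low_orth n h d" for h
    unfolding low_orth_def A_def CE_sum
    by (intro allI impI ballI sum.neutral CE_CE_low[OF h]) (use Dn in auto)
  have A_sum: "A (\<lambda>r. \<Sum>i\<in>I. c i * v i r) r = (\<Sum>i\<in>I. c i * A (v i) r)"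
    for I :: "'i set" and c v r
    unfolding A_def CE_sum CE_cmult sum_distrib_left by (rule sum.swap)
  have "\<exists>p. low_span n d p \<and> low_orth n (\<lambda>r. ind n i r - p r) d" for i
    using low_span_split by blast
  then obtain p where p: "\<And>i. low_span n d (p i)" "\<And>i. low_orth n (\<lambda>r. ind n i r - p i r) d"
    by metis
  define u where "u i r = ind n i r - p i r" for i r
  have u: "low_orth n (u i) d" for i unfolding u_def[abs_def] by (rule p(2))
  \<comment> \<open>Here \<open>g\<close> is projected onto the span of the functions
    \<open>A (u j)\<close>. Showing that the residual \<open>w\<close> vanishes puts
    \<open>g\<close> into the range of \<open>A\<close>.\<close>
  obtain c where c: "\<And>j. j \<in> low_idx n (Suc d) \<Longrightarrow>
      (\<Sum>r\<in>Sym n. (g r - (\<Sum>i\<in>low_idx n (Suc d). c i * A (u i) r)) * A (u j) r) = 0"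
    using exists_projection[OF finite_low_idx[of n "Suc d"], where \<Omega> = "Sym n" and f = g and b = "\<lambda>i. A (u i)"] by blast
  define v where "v r = (\<Sum>i\<in>low_idx n (Suc d). c i * u i r)" for r
  define w where "w r = g r - A v r" for r
  have Av: "A v r = (\<Sum>i\<in>low_idx n (Suc d). c i * A (u i) r)" for r
    using A_sum[of c u "low_idx n (Suc d)" r] by (simp add: v_def[abs_def])
  have v_orth: "low_orth n v d" unfolding v_def[abs_def] by (intro low_orth_sum u)
  have w_orth: "low_orth n w d" unfolding w_def[abs_def] by (intro low_orth_linear g2 A_orth v_orth)
  have w_span: "low_span n (Suc d) w" unfolding w_def[abs_def] by (intro low_span_diff g1 A_span)
  \<comment> \<open>An indicator is \<open>u j + p j\<close>: the part \<open>p j\<close> has degree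
    below \<open>d\<close>, and for \<open>u j\<close> the operator is moved across and the choice
    of \<open>c\<close> applies. Then the inner product of \<open>A w\<close> with \<open>w\<close>
    is 0, which forces every \<open>CE n I w\<close> to vanish.\<close>
  have "low_orth n (A w) (Suc d)"
    unfolding low_orth_iff_ind
  proof
    fix j assume j: "j \<in> low_idx n (Suc d)"
    have "(\<Sum>r\<in>Sym n. A w r * ind n j r) = (\<Sum>r\<in>Sym n. A w r * u j r) + (\<Sum>r\<in>Sym n. A w r * p j r)"
      by (simp add: u_def algebra_simps sum.distrib[symmetric])
    also have "(\<Sum>r\<in>Sym n. A w r * p j r) = 0"
      by (rule low_orth_low_span[OF A_orth[OF w_orth] p(1)])
    also have "(\<Sum>r\<in>Sym n. A w r * u j r) = (\<Sum>r\<in>Sym n. w r * A (u j) r)"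
      by (subst sym) (simp add: mult.commute)
    also have "\<dots> = 0" using c[OF j] by (simp add: w_def Av)
    finally show "(\<Sum>r\<in>Sym n. A w r * ind n j r) = 0" by simp
  qed
  then have "(\<Sum>r\<in>Sym n. A w r * w r) = 0" using w_span by (rule low_orth_low_span)
  then have sq: "(\<Sum>I\<in>DD. \<Sum>r\<in>Sym n. CE n I w r * CE n I w r) = 0" by (simp add: self)
  have finD: "finite DD" unfolding DD_def by (rule finite_subset[of _ "Pow {1..n}"]) auto
  have z: "CE n I w r = 0" if "I \<in> DD" "r \<in> Sym n" for I r
  proof -
    have "(\<Sum>r\<in>Sym n. CE n I w r * CE n I w r) = 0"
      using sq that(1) finD by (subst (asm) sum_nonneg_eq_0_iff) (auto intro!: sum_nonneg)
    then show ?thesis using that(2) by (subst (asm) sum_nonneg_eq_0_iff) auto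
  qed
  have "low_orth n w (Suc d)"
    unfolding low_orth_def
  proof (intro allI impI ballI)
    fix S s assume S: "S \<subseteq> {1..n}" "card S < Suc d" and s: "s \<in> Sym n"
    show "CE n S w s = 0"
    proof (cases "card S = d")
      case True
      then have "S \<in> DD" using S unfolding DD_def by blast
      then show ?thesis using z s by blast
    next
      case False
      then show ?thesis using S by (intro low_orthD[OF w_orth _ _ s]) auto
    qed
  qed
  then have "w r = 0" if "r \<in> Sym n" for r
    using low_span_low_orth_zero[OF w_span _ that] by blast
  then have gA: "g r = A v r" if "r \<in> Sym n" for r using that by (simp add: w_def)
  let ?N = "\<Sum>s\<in>Sym n. (g s)\<^sup>2"
  have le: "(\<Sum>I\<in>DD. \<Sum>s\<in>Sym n. (CE n I v s)\<^sup>2) \<le> ?N"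
    using sum_CE_sq_le[OF v_orth] gA unfolding DD_def[symmetric] by (simp add: A_def)
  have "?N = (\<Sum>r\<in>Sym n. A v r * g r)" using gA by (simp add: power2_eq_square)
  also have "\<dots> = (\<Sum>(I, r)\<in>DD \<times> Sym n. CE n I v r * CE n I g r)"
    unfolding self by (rule sum.cartesian_product)
  finally have "?N\<^sup>2 = (\<Sum>i\<in>DD \<times> Sym n. CE n (fst i) v (snd i) * CE n (fst i) g (snd i))\<^sup>2"
    by (simp add: case_prod_beta)
  also have "\<dots> \<le> (\<Sum>i\<in>DD \<times> Sym n. (CE n (fst i) v (snd i))\<^sup>2) * (\<Sum>i\<in>DD \<times> Sym n. (CE n (fst i) g (snd i))\<^sup>2)"
    by (rule Cauchy_Schwarz_ineq_sum)
  also have "\<dots> = (\<Sum>I\<in>DD. \<Sum>s\<in>Sym n. (CE n I v s)\<^sup>2) * (\<Sum>I\<in>DD. \<Sum>s\<in>Sym n. (CE n I g s)\<^sup>2)"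
    by (simp add: sum.cartesian_product case_prod_beta)
  also have "\<dots> \<le> ?N * (\<Sum>I\<in>DD. \<Sum>s\<in>Sym n. (CE n I g s)\<^sup>2)"
    by (rule mult_right_mono[OF le]) (intro sum_nonneg, simp)
  finally have "?N * ?N \<le> ?N * (\<Sum>I\<in>DD. \<Sum>s\<in>Sym n. (CE n I g s)\<^sup>2)" by (simp add: power2_eq_square)
  moreover have "0 \<le> ?N" "0 \<le> (\<Sum>I\<in>DD. \<Sum>s\<in>Sym n. (CE n I g s)\<^sup>2)" by (intro sum_nonneg; simp)+
  ultimately show ?thesis unfolding DD_def[symmetric]
    by (cases "?N = 0") (auto simp: mult_le_cancel_left)
qed

section \<open>Polynomial degree and the level inequality\<close>

lemma mpoly_eval_superset:
  assumes "finite K" "Poly_Mapping.keys P \<subseteq> K"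
  shows "mpoly_eval P a = (\<Sum>m\<in>K. Poly_Mapping.lookup P m * monom_eval m a)"
  unfolding mpoly_eval_def
  by (rule sum.mono_neutral_left) (use assms in \<open>auto simp: in_keys_iff\<close>)

lemma mpoly_eval_add: "mpoly_eval (P + Q) a = mpoly_eval P a + mpoly_eval Q a"
proof -
  let ?K = "Poly_Mapping.keys P \<union> Poly_Mapping.keys Q"
  have "mpoly_eval (P + Q) a = (\<Sum>m\<in>?K. Poly_Mapping.lookup (P + Q) m * monom_eval m a)"
    by (rule mpoly_eval_superset) (use Poly_Mapping.keys_add[of P Q] in auto)
  then show ?thesis
    by (simp add: lookup_add distrib_right sum.distrib mpoly_eval_superset[of ?K P] mpoly_eval_superset[of ?K Q])
qed

lemma mpoly_eval_single: "mpoly_eval (Poly_Mapping.single m c) a = c * monom_eval m a"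
  by (simp add: mpoly_eval_def)

definition low_poly :: "nat \<Rightarrow> nat \<Rightarrow> (((nat \<times> nat) \<Rightarrow>\<^sub>0 nat) \<Rightarrow>\<^sub>0 real) \<Rightarrow> bool" where
  "low_poly n d P \<longleftrightarrow> (\<forall>m \<in> Poly_Mapping.keys P.
     Poly_Mapping.keys m \<subseteq> {1..n} \<times> {1..n} \<and> int (monom_degree m) \<le> int d - 1)"

text \<open>On permutations this square-free monomial evaluates to the indicator of
  \<open>cls n S s\<close>, which links degrees of polynomials with numbers of prescribed
  values.\<close>

definition graph_monom :: "nat set \<Rightarrow> (nat \<Rightarrow> nat) \<Rightarrow> ((nat \<times> nat) \<Rightarrow>\<^sub>0 nat)" where
  "graph_monom S s = (\<Sum>x\<in>S. Poly_Mapping.single (x, s x) 1)"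

lemma lookup_graph_monom:
  assumes "finite S"
  shows "Poly_Mapping.lookup (graph_monom S s) v = (if v \<in> (\<lambda>x. (x, s x)) ` S then 1 else 0)"
proof -
  have "Poly_Mapping.lookup (graph_monom S s) v = (\<Sum>x\<in>S. if (x, s x) = v then 1 else 0)"
    unfolding graph_monom_def by (simp add: lookup_sum lookup_single when_def del: One_nat_def)
  also have "\<dots> = (\<Sum>x\<in>S. if x = fst v then (if s (fst v) = snd v then 1 else 0) else 0)"
    by (intro sum.cong refl) (auto simp: prod_eq_iff)
  also have "\<dots> = (if v \<in> (\<lambda>x. (x, s x)) ` S then 1 else 0)"
    using assms by (auto simp: sum.delta image_iff prod_eq_iff)
  finally show ?thesis .
qed

lemma keys_graph_monom:
  assumes "finite S"
  shows "Poly_Mapping.keys (graph_monom S s) = (\<lambda>x. (x, s x)) ` S"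
  by (auto simp: in_keys_iff lookup_graph_monom[OF assms] split: if_splits)

lemma degree_graph_monom:
  assumes "finite S" shows "monom_degree (graph_monom S s) = card S"
  unfolding monom_degree_def keys_graph_monom[OF assms] lookup_graph_monom[OF assms]
  by (simp add: card_image inj_on_def)

lemma eval_graph_monom:
  assumes "finite S" "r \<in> Sym n"
  shows "monom_eval (graph_monom S s) (\<lambda>(i, j). coord i j r) = ind n (S, s) r"
proof -
  have "monom_eval (graph_monom S s) (\<lambda>(i, j). coord i j r) = (\<Prod>x\<in>S. coord x (s x) r)"
    unfolding monom_eval_def keys_graph_monom[OF assms(1)] lookup_graph_monom[OF assms(1)]
    by (subst prod.reindex) (auto simp: inj_on_def)
  also have "\<dots> = ind n (S, s) r"
    using assms by (auto simp: ind_def cls_def coord_def intro!: prod.neutral prod_zero)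
  finally show ?thesis .
qed

lemma low_span_poly:
  assumes "low_span n d h"
  shows "\<exists>P. low_poly n d P \<and> (\<forall>r\<in>Sym n. h r = mpoly_eval P (\<lambda>(i, j). coord i j r))"
proof -
  obtain c where c: "\<forall>r\<in>Sym n. h r = (\<Sum>i\<in>low_idx n d. c i * ind n i r)" using assms by (auto simp: low_span_def)
  have "\<exists>P. low_poly n d P \<and> (\<forall>r\<in>Sym n. (\<Sum>i\<in>Idx. c i * ind n i r) = mpoly_eval P (\<lambda>(i, j). coord i j r))"
    if "Idx \<subseteq> low_idx n d" for Idx
    using finite_subset[OF that finite_low_idx] that
  proof (induction Idx rule: finite_induct)
    case empty
    show ?case by (intro exI[of _ 0]) (simp add: low_poly_def mpoly_eval_def)
  next
    case (insert i Idx)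
    then obtain P where P: "low_poly n d P" "\<forall>r\<in>Sym n. (\<Sum>i\<in>Idx. c i * ind n i r) = mpoly_eval P (\<lambda>(i, j). coord i j r)"
      by auto
    obtain S s where i: "i = (S, s)" "S \<subseteq> {1..n}" "card S < d" "s \<in> Sym n" using insert.prems by (auto simp: low_idx_def)
    have fin: "finite S" using i(2) by (rule finite_subset_interval)
    let ?P = "Poly_Mapping.single (graph_monom S s) (c i) + P"
    have "(\<lambda>x. (x, s x)) ` S \<subseteq> {1..n} \<times> {1..n}"
      using i(2) Sym_image_subset[OF i(4,2)] by auto
    then have "low_poly n d (Poly_Mapping.single (graph_monom S s) (c i))"
      using i(3) by (auto simp: low_poly_def keys_graph_monom[OF fin] degree_graph_monom[OF fin] split: if_splits)
    then have "low_poly n d ?P"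
      using P(1) Poly_Mapping.keys_add[of "Poly_Mapping.single (graph_monom S s) (c i)" P]
      unfolding low_poly_def by blast
    moreover have "\<forall>r\<in>Sym n. (\<Sum>i\<in>insert i Idx. c i * ind n i r) = mpoly_eval ?P (\<lambda>(i, j). coord i j r)"
      using P(2) insert.hyps by (simp add: mpoly_eval_add mpoly_eval_single eval_graph_monom[OF fin] i(1))
    ultimately show ?case by blast
  qed
  then obtain P where "low_poly n d P" "\<forall>r\<in>Sym n. (\<Sum>i\<in>low_idx n d. c i * ind n i r) = mpoly_eval P (\<lambda>(i, j). coord i j r)"
    by blast
  then show ?thesis using c by auto
qed

text \<open>A monomial depends only on the values at the first indices of its variables, and there
  are at most as many of them as its degree, whatever the exponents and repetitions.\<close>

lemma low_poly_span:
  assumes P: "low_poly n d P" and h: "\<And>r. r \<in> Sym n \<Longrightarrow> h r = mpoly_eval P (\<lambda>(i, j). coord i j r)"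
  shows "low_span n d h"
proof -
  have "low_span n d (\<lambda>r. mpoly_eval P (\<lambda>(i, j). coord i j r))"
    unfolding mpoly_eval_def
  proof (intro low_span_sum low_span_cmult)
    fix m assume m: "m \<in> Poly_Mapping.keys P"
    then have k: "Poly_Mapping.keys m \<subseteq> {1..n} \<times> {1..n}" "int (monom_degree m) \<le> int d - 1"
      using P by (auto simp: low_poly_def)
    have "card (fst ` Poly_Mapping.keys m) \<le> card (Poly_Mapping.keys m)" by (rule card_image_le) simp
    also have "\<dots> = (\<Sum>v\<in>Poly_Mapping.keys m. 1)" by simp
    also have "\<dots> \<le> monom_degree m"
      unfolding monom_degree_def by (intro sum_mono) (simp add: in_keys_iff)
    finally have "card (fst ` Poly_Mapping.keys m) < d" using k(2) by linarith
    moreover have "fst ` Poly_Mapping.keys m \<subseteq> {1..n}" using k(1) by auto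
    moreover have "dep n (fst ` Poly_Mapping.keys m) (\<lambda>r. monom_eval m (\<lambda>(i, j). coord i j r))"
      unfolding dep_def monom_eval_def coord_def
      by (intro ballI impI prod.cong refl) (auto simp: case_prod_beta)
    ultimately show "low_span n d (\<lambda>r. monom_eval m (\<lambda>(i, j). coord i j r))"
      by (intro low_span_dep)
  qed
  then show ?thesis using low_span_cong[of n h] h by simp
qed

lemma V_le_iff: "h \<in> V_le n (int d - 1) \<longleftrightarrow> h \<in> L2 n \<and> low_span n d h"
proof
  assume "h \<in> V_le n (int d - 1)"
  then show "h \<in> L2 n \<and> low_span n d h"
    unfolding V_le_def by (auto intro!: low_poly_span simp: low_poly_def)
next
  assume "h \<in> L2 n \<and> low_span n d h"
  then show "h \<in> V_le n (int d - 1)"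
    using low_span_poly[of n d h] unfolding V_le_def low_poly_def by blast
qed

section \<open>Uniform norms, projections and levels\<close>

lemma Expect_eq:
  assumes "finite U" "U \<noteq> {}"
  shows "Expect U f = (\<Sum>r\<in>U. f r) / card U"
  using assms by (simp add: Expect_def integral_pmf_of_set)

lemma Sym_nonempty: "Sym n \<noteq> {}" using Sym_id by auto

lemma ip_eq: "ip n f g = (\<Sum>r\<in>Sym n. f r * g r) / fact n"
  by (simp add: ip_def Expect_eq Sym_nonempty card_Sym)

lemma Lnorm_2_sq:
  assumes "finite U" "U \<noteq> {}"
  shows "(Lnorm 2 U f)\<^sup>2 = (\<Sum>r\<in>U. (f r)\<^sup>2) / card U"
proof -
  have "Expect U (\<lambda>r. \<bar>f r\<bar> powr 2) = (\<Sum>r\<in>U. (f r)\<^sup>2) / card U"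
    using assms by (simp add: Expect_eq)
  moreover have "0 \<le> (\<Sum>r\<in>U. (f r)\<^sup>2) / card U" by (simp add: sum_nonneg)
  ultimately show ?thesis by (simp add: Lnorm_def powr_half_sqrt)
qed

lemma orth_V_le_iff:
  "(\<forall>h\<in>V_le n (int d - 1). ip n v h = 0) \<longleftrightarrow> low_orth n v d"
proof
  assume "low_orth n v d"
  then show "\<forall>h\<in>V_le n (int d - 1). ip n v h = 0"
    by (auto simp: V_le_iff ip_eq low_orth_low_span)
next
  assume *: "\<forall>h\<in>V_le n (int d - 1). ip n v h = 0"
  show "low_orth n v d" unfolding low_orth_iff_ind
  proof
    fix i assume "i \<in> low_idx n d"
    then have "ind n i \<in> V_le n (int d - 1)"
      by (auto simp: V_le_iff low_span_ind L2_def ind_def cls_def)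
    then show "(\<Sum>r\<in>Sym n. v r * ind n i r) = 0" using * by (auto simp: ip_eq)
  qed
qed

text \<open>Discharges the definite description. Existence comes from \<open>low_span_split\<close>
  after extension by zero outside \<open>Sym n\<close>; two candidates differ by a function both
  inside and orthogonal to the space, and agree outside by membership in
  \<open>L2 n\<close>.\<close>

lemma proj_le_props:
  fixes f :: "(nat \<Rightarrow> nat) \<Rightarrow> real" and n d :: nat
  defines "g \<equiv> proj_le n (int d - 1) f"
  shows "low_span n d g" "low_orth n (\<lambda>r. f r - g r) d"
proof -
  let ?Q = "\<lambda>g. g \<in> V_le n (int d - 1) \<and> (\<forall>h \<in> V_le n (int d - 1). ip n (\<lambda>s. f s - g s) h = 0)"
  have Q: "?Q g \<longleftrightarrow> g \<in> L2 n \<and> low_span n d g \<and> low_orth n (\<lambda>r. f r - g r) d" for g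
    unfolding orth_V_le_iff V_le_iff by blast
  obtain p where p: "low_span n d p" "low_orth n (\<lambda>r. f r - p r) d" by (rule low_span_split)
  let ?p = "\<lambda>r. if r \<in> Sym n then p r else 0"
  have "low_span n d ?p" using p(1) low_span_cong[of n ?p p] by simp
  moreover have "low_orth n (\<lambda>r. f r - ?p r) d"
    using p(2) unfolding low_orth_iff_ind by simp
  ultimately have ex: "?Q ?p" unfolding Q by (auto simp: L2_def)
  have uniq: "g1 = g2" if "?Q g1" "?Q g2" for g1 g2
  proof
    fix r
    show "g1 r = g2 r"
    proof (cases "r \<in> Sym n")
      case True
      have "low_orth n (\<lambda>r. g1 r - g2 r) d"
        using low_orth_linear[of n "\<lambda>r. f r - g2 r" d "\<lambda>r. f r - g1 r"] that unfolding Q by simp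
      moreover have "low_span n d (\<lambda>r. g1 r - g2 r)" using that unfolding Q by (blast intro: low_span_diff)
      ultimately show ?thesis using low_span_low_orth_zero[of n d "\<lambda>r. g1 r - g2 r" r] True by simp
    qed (use that in \<open>auto simp: Q L2_def\<close>)
  qed
  have "?Q g" unfolding g_def proj_le_def by (rule theI[of ?Q, OF ex]) (rule uniq[OF _ ex])
  then show "low_span n d g" "low_orth n (\<lambda>r. f r - g r) d" unfolding Q by blast+
qed

text \<open>The remainder \<open>f - g\<close> splits into a part orthogonal to degree
  \<open>d\<close> and below and a part of degree below \<open>d\<close>: the first is killed by
  conditioning on \<open>d\<close> points, the second by alternation.\<close>

lemma level_decomposition:
  fixes f :: "(nat \<Rightarrow> nat) \<Rightarrow> real" and n d :: nat
  defines "g \<equiv> level n (int d) f"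
  shows "low_span n (Suc d) g" "low_orth n g d"
    "\<exists>u p. low_orth n u (Suc d) \<and> low_span n d p \<and> (\<forall>r. f r - g r = u r + p r)"
proof -
  let ?p1 = "proj_le n (int (Suc d) - 1) f" and ?p0 = "proj_le n (int d - 1) f"
  have g: "g = (\<lambda>r. ?p1 r - ?p0 r)" by (simp add: g_def level_def)
  note P1 = proj_le_props[where d = "Suc d" and n = n and f = f]
  note P0 = proj_le_props[where d = d and n = n and f = f]
  show "low_span n (Suc d) g" unfolding g
    by (rule low_span_diff[OF P1(1) low_span_mono[OF P0(1)]]) simp
  have "low_orth n (\<lambda>r. f r - ?p1 r) d" using P1(2) unfolding low_orth_def by simp
  from low_orth_linear[OF P0(2) this] show "low_orth n g d" unfolding g by simp
  show "\<exists>u p. low_orth n u (Suc d) \<and> low_span n d p \<and> (\<forall>r. f r - g r = u r + p r)"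
    using P1(2) P0(1) by (intro exI[of _ "\<lambda>r. f r - ?p1 r"] exI[of _ ?p0]) (simp add: g)
qed

text \<open>An indicator that depends on fewer than \<open>card D\<close> points misses both points
  of some pair in \<open>D\<close>; swapping this pair is a sign-reversing involution on the
  terms.\<close>

lemma Del_low_span:
  assumes h: "low_span n (card D) h" and D: "D \<subseteq> {1..m}" and m: "2 * m \<le> n" and r: "r \<in> Sym n"
  shows "Del m D h r = 0"
proof -
  have finD: "finite D" using D by (rule finite_subset_interval)
  have swS: "sw m B \<in> Sym n" if "B \<subseteq> D" for B using that D by (intro sw_Sym[OF _ m]) auto
  have zero: "(\<Sum>B\<in>Pow D. sg B * ind n i (r \<circ> sw m B)) = 0" if i: "i \<in> low_idx n (card D)" for i
  proof -
    have S: "card (fst i) < card D" "fst i \<subseteq> {1..n}" using i by (auto simp: low_idx_def)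
    have finS: "finite (fst i)" using S(2) by (rule finite_subset) simp
    obtain l where l: "l \<in> D" "l \<notin> fst i" "l + m \<notin> fst i"
    proof (rule ccontr)
      assume "\<not> thesis"
      then have *: "l \<in> fst i \<or> l + m \<in> fst i" if "l \<in> D" for l using that \<open>\<And>l. \<lbrakk>l \<in> D; l \<notin> fst i; l + m \<notin> fst i\<rbrakk> \<Longrightarrow> thesis\<close> by blast
      \<comment> \<open>Folding \<open>x + m\<close> back to \<open>x\<close> would make the image
        of the smaller set \<open>fst i\<close> cover \<open>D\<close>.\<close>
      have "D \<subseteq> (\<lambda>x. if x \<le> m then x else x - m) ` fst i"
      proof
        fix l assume lD: "l \<in> D"
        then have "1 \<le> l" "l \<le> m" using D by auto
        then show "l \<in> (\<lambda>x. if x \<le> m then x else x - m) ` fst i"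
          using *[OF lD] by (auto simp: image_iff intro: bexI[of _ l] bexI[of _ "l + m"])
      qed
      then have "card D \<le> card ((\<lambda>x. if x \<le> m then x else x - m) ` fst i)" using finS by (intro card_mono) auto
      also have "\<dots> \<le> card (fst i)" using finS by (intro card_image_le)
      finally show False using S by simp
    qed
    have lm: "l \<le> m" using l(1) D by auto
    have fin: "finite (D - {l})" using finD by simp
    have "(\<Sum>B\<in>Pow (insert l (D - {l})). sg B * ind n i (r \<circ> sw m B))
        = (\<Sum>B\<in>Pow (D - {l}). sg B * ind n i (r \<circ> sw m B) + sg (insert l B) * ind n i (r \<circ> sw m (insert l B)))"
      by (rule sum_Pow_insert[OF fin]) simp
    also have "\<dots> = 0"
    proof (rule sum.neutral, rule ballI)
      fix B assume "B \<in> Pow (D - {l})"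
      then have B: "B \<subseteq> D" "l \<notin> B" "finite B" using fin by (auto dest: finite_subset)
      have "ind n i (r \<circ> sw m (insert l B)) = ind n i (r \<circ> sw m B)"
      proof (rule depD[OF ind_dep])
        show "r \<circ> sw m B \<in> Sym n" "r \<circ> sw m (insert l B) \<in> Sym n"
          using B l(1) by (intro Sym_comp r swS; auto)+
        fix x assume x: "x \<in> fst i"
        then have "x \<noteq> l" "x \<noteq> l + m" using l by auto
        then have "sw m (insert l B) x = sw m B x" by (auto simp: sw_def)
        then show "(r \<circ> sw m (insert l B)) x = (r \<circ> sw m B) x" by simp
      qed
      then show "sg B * ind n i (r \<circ> sw m B) + sg (insert l B) * ind n i (r \<circ> sw m (insert l B)) = 0"
        using B by (simp add: sg_insert)
    qed
    finally show ?thesis using l(1) by (simp add: insert_absorb)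
  qed
  obtain c where c: "\<forall>r\<in>Sym n. h r = (\<Sum>i\<in>low_idx n (card D). c i * ind n i r)" using h by (auto simp: low_span_def)
  have "(\<Sum>B\<in>Pow D. sg B * h (r \<circ> sw m B)) = (\<Sum>B\<in>Pow D. \<Sum>i\<in>low_idx n (card D). c i * (sg B * ind n i (r \<circ> sw m B)))"
    using c by (intro sum.cong refl) (simp add: Sym_comp[OF r swS] sum_distrib_left mult_ac)
  also have "\<dots> = (\<Sum>i\<in>low_idx n (card D). c i * (\<Sum>B\<in>Pow D. sg B * ind n i (r \<circ> sw m B)))"
    by (subst sum.swap) (simp add: sum_distrib_left)
  also have "\<dots> = 0" using zero by simp
  finally show ?thesis by (simp add: Del_def)
qed

lemma CE_Del_level:
  assumes u: "low_orth n u (Suc (card D))" and p: "low_span n (card D) p"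
    and fg: "\<And>r. f r - g r = u r + p r"
    and D: "D \<subseteq> {1..m}" and m: "2 * m \<le> n" and s: "s \<in> Sym n" and th: "th \<in> Sym n"
  shows "CE n D (Del m D (\<lambda>r. f (r \<circ> inv th))) s = CE n D (Del m D (\<lambda>r. g (r \<circ> inv th))) s"
proof -
  have Dn: "D \<subseteq> {1..n}" using D m by force
  have it: "inv th \<in> Sym n" by (rule Sym_inv[OF th])
  let ?u = "\<lambda>r. u (r \<circ> inv th)" and ?p = "\<lambda>r. p (r \<circ> inv th)"
  have "CE n D (\<lambda>r. ?u (r \<circ> sw m B)) s = 0" if "B \<in> Pow D" for B
  proof (rule low_orthD[OF _ Dn _ s])
    show "low_orth n (\<lambda>r. ?u (r \<circ> sw m B)) (Suc (card D))"
      by (rule low_orth_right[OF low_orth_right[OF u it]]) (use that D in \<open>auto intro!: sw_Sym[OF _ m]\<close>)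
  qed simp
  then have zu: "CE n D (Del m D ?u) s = 0"
    unfolding Del_def CE_divide CE_sum CE_cmult by simp
  have zp: "CE n D (Del m D ?p) s = 0"
  proof -
    have "CE n D (Del m D ?p) s = CE n D (\<lambda>r. 0) s"
      by (intro CE_cong Del_low_span[OF low_span_right[OF p it] D m]) (auto dest: cls_subset)
    then show ?thesis by (simp add: CE_def)
  qed
  have "f q = g q + (u q + p q)" for q using fg[of q] by simp
  then have "Del m D (\<lambda>r. f (r \<circ> inv th)) = (\<lambda>r. Del m D (\<lambda>r. g (r \<circ> inv th)) r + (Del m D ?u r + Del m D ?p r))"
    by (simp add: Del_def fun_eq_iff sum.distrib distrib_left add_divide_distrib)
  then have "CE n D (Del m D (\<lambda>r. f (r \<circ> inv th))) s = CE n D (Del m D (\<lambda>r. g (r \<circ> inv th))) s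
     + (CE n D (Del m D ?u) s + CE n D (Del m D ?p) s)"
    by (simp only: CE_add)
  then show ?thesis using zu zp by simp
qed

text \<open>One fixed \<open>D\<close> suffices, as relabellings act transitively on
  \<open>d\<close>-sets. For fixed \<open>s\<close> the coefficient is a function of
  \<open>th\<close>, to which \<open>Del_CE_lower\<close> applies; \<open>CE_Del_twist\<close>
  restores the order of the operations and \<open>CE_Del_level\<close> replaces \<open>g\<close> by
  \<open>f\<close>.\<close>

lemma level_norm_le:
  assumes g1: "low_span n (Suc d) g" and g2: "low_orth n g d"
    and u: "low_orth n u (Suc d)" and p: "low_span n d p" and fg: "\<And>r. f r - g r = u r + p r"
    and D: "D \<in> subs {1..m} d" and m: "2 * m \<le> n"
  shows "fact n * (\<Sum>s\<in>Sym n. (g s)\<^sup>2) \<le> real (n choose d) * 2 ^ d *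
    (\<Sum>th\<in>Sym n. \<Sum>s\<in>Sym n. (CE n D (Del m D (\<lambda>r. f (r \<circ> inv th))) s)\<^sup>2)"
proof -
  have Dm: "D \<subseteq> {1..m}" and cD: "card D = d" using D by blast+
  have Dn: "D \<in> subs {1..n} d" using Dm cD m by force
  have "(\<Sum>th\<in>Sym n. \<Sum>s\<in>Sym n. (CE n (th ` D) g s)\<^sup>2) = (\<Sum>th\<in>Sym n. \<Sum>s\<in>Sym n. (CE n D (\<lambda>e. g (s \<circ> inv e)) th)\<^sup>2)"
  proof (rule sum.cong[OF refl])
    fix th assume th: "th \<in> Sym n"
    have "(\<Sum>s\<in>Sym n. (CE n (th ` D) g s)\<^sup>2) = (\<Sum>s\<in>Sym n. (CE n (th ` D) g (s \<circ> inv th))\<^sup>2)"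
      by (rule sum_Sym_right[OF Sym_inv[OF th], of "\<lambda>s. (CE n (th ` D) g s)\<^sup>2", symmetric])
    also have "\<dots> = (\<Sum>s\<in>Sym n. (CE n D (\<lambda>e. g (s \<circ> inv e)) th)\<^sup>2)"
      by (intro sum.cong refl) (simp add: CE_twist_id th CE_right'[OF th])
    finally show "(\<Sum>s\<in>Sym n. (CE n (th ` D) g s)\<^sup>2) = (\<Sum>s\<in>Sym n. (CE n D (\<lambda>e. g (s \<circ> inv e)) th)\<^sup>2)" .
  qed
  also have "\<dots> = (\<Sum>s\<in>Sym n. \<Sum>th\<in>Sym n. (CE n D (\<lambda>e. g (s \<circ> inv e)) th)\<^sup>2)" by (rule sum.swap)
  also have "\<dots> \<le> (\<Sum>s\<in>Sym n. 2 ^ d * (\<Sum>th\<in>Sym n. (Del m D (CE n D (\<lambda>e. g (s \<circ> inv e))) th)\<^sup>2))"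
    using Del_CE_lower[OF _ Dm m] low_orth_twist[OF g2] cD by (intro sum_mono) auto
  also have "\<dots> = 2 ^ d * (\<Sum>th\<in>Sym n. \<Sum>s\<in>Sym n. (Del m D (CE n D (\<lambda>e. g (s \<circ> inv e))) th)\<^sup>2)"
    unfolding sum_distrib_left[symmetric] by (subst sum.swap) (rule refl)
  also have "\<dots> = 2 ^ d * (\<Sum>th\<in>Sym n. \<Sum>s\<in>Sym n. (CE n D (Del m D (\<lambda>r. f (r \<circ> inv th))) s)\<^sup>2)"
  proof (intro arg_cong2[of _ _ _ _ "(*)"] refl sum.cong arg_cong[of _ _ "\<lambda>x. x\<^sup>2"])
    fix th s assume th: "th \<in> Sym n" and s: "s \<in> Sym n"
    show "Del m D (CE n D (\<lambda>e. g (s \<circ> inv e))) th = CE n D (Del m D (\<lambda>r. f (r \<circ> inv th))) s"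
      unfolding CE_Del_twist[OF s th Dm m, symmetric]
      by (rule CE_Del_level[OF _ _ fg Dm m s th, symmetric]) (simp_all add: cD u p)
  qed
  finally have le: "(\<Sum>th\<in>Sym n. \<Sum>s\<in>Sym n. (CE n (th ` D) g s)\<^sup>2)
    \<le> 2 ^ d * (\<Sum>th\<in>Sym n. \<Sum>s\<in>Sym n. (CE n D (Del m D (\<lambda>r. f (r \<circ> inv th))) s)\<^sup>2)" .
  have "fact n * (\<Sum>s\<in>Sym n. (g s)\<^sup>2) \<le> fact n * (\<Sum>I\<in>subs {1..n} d. \<Sum>s\<in>Sym n. (CE n I g s)\<^sup>2)"
    by (intro mult_left_mono norm_le_sum_CE g1 g2) simp
  also have "\<dots> = real (n choose d) * (\<Sum>th\<in>Sym n. \<Sum>s\<in>Sym n. (CE n (th ` D) g s)\<^sup>2)"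
    by (rule sum_CE_sq_average[OF Dn, symmetric])
  also have "\<dots> \<le> real (n choose d) * (2 ^ d * (\<Sum>th\<in>Sym n. \<Sum>s\<in>Sym n. (CE n D (Del m D (\<lambda>r. f (r \<circ> inv th))) s)\<^sup>2))"
    by (rule mult_left_mono[OF le]) simp
  finally show ?thesis by (simp only: mult.assoc)
qed

text \<open>Summing the estimate over all \<open>d\<close>-sets of pairs rather than using a single
  one reduces the loss from \<open>n choose d\<close> to its quotient by \<open>m choose d\<close>,
  which is exponential in \<open>d\<close> only.\<close>

lemma level_norm_le_wt:
  assumes g1: "low_span n (Suc d) g" and g2: "low_orth n g d"
    and u: "low_orth n u (Suc d)" and p: "low_span n d p" and fg: "\<And>r. f r - g r = u r + p r"
    and m: "2 * m \<le> n"
    and B: "\<And>th. th \<in> Sym n \<Longrightarrow> wt n m {} {1..m} d (\<lambda>r. f (r \<circ> inv th)) id \<le> \<beta>"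
  shows "real (m choose d) * ((\<Sum>s\<in>Sym n. (g s)\<^sup>2) / fact n) \<le> real (n choose d) * 2 ^ d * \<beta>"
proof -
  let ?X = "\<lambda>D th. \<Sum>s\<in>Sym n. (CE n D (Del m D (\<lambda>r. f (r \<circ> inv th))) s)\<^sup>2"
  have "real (m choose d) * (fact n * (\<Sum>s\<in>Sym n. (g s)\<^sup>2)) = (\<Sum>D\<in>subs {1..m} d. fact n * (\<Sum>s\<in>Sym n. (g s)\<^sup>2))"
    using n_subsets[of "{1..m}" d] by simp
  also have "\<dots> \<le> (\<Sum>D\<in>subs {1..m} d. real (n choose d) * 2 ^ d * (\<Sum>th\<in>Sym n. ?X D th))"
    by (rule sum_mono) (rule level_norm_le[OF g1 g2 u p fg _ m])
  also have "\<dots> = real (n choose d) * 2 ^ d * (\<Sum>th\<in>Sym n. \<Sum>D\<in>subs {1..m} d. ?X D th)"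
    unfolding sum_distrib_left[symmetric] by (subst sum.swap) (rule refl)
  also have "\<dots> \<le> real (n choose d) * 2 ^ d * (\<Sum>th\<in>Sym n. fact n * \<beta>)"
  proof (intro mult_left_mono sum_mono)
    fix th assume th: "th \<in> Sym n"
    have "(\<Sum>D\<in>subs {1..m} d. ?X D th) = fact n * wt n m {} {1..m} d (\<lambda>r. f (r \<circ> inv th)) id"
      unfolding wt_def CE_empty wcoef_def by (simp add: sum_divide_distrib[symmetric])
    also have "\<dots> \<le> fact n * \<beta>" by (intro mult_left_mono B th) simp
    finally show "(\<Sum>D\<in>subs {1..m} d. ?X D th) \<le> fact n * \<beta>" .
  qed simp
  also have "\<dots> = fact n * fact n * (real (n choose d) * 2 ^ d * \<beta>)" by (simp add: card_Sym)
  finally show ?thesis by (simp add: field_simps)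
qed

lemma choose_ratio:
  assumes "100000 * d \<le> n" "j \<le> d"
  shows "(n choose j) \<le> 6 ^ j * ((n div 4) choose j)"
  using assms(2)
proof (induction j)
  case (Suc j)
  \<comment> \<open>Since \<open>Suc j \<le> d\<close> forces \<open>n \<ge> 100000\<close> and
    \<open>j\<close> is tiny compared with \<open>n\<close>, going from 4 to 6 covers both the
    rounding and the shift by \<open>j\<close>.\<close>
  have "n - j \<le> 6 * (n div 4 - j)" using assms(1) Suc.prems by linarith
  then have "(n - j) * (n choose j) \<le> 6 * (n div 4 - j) * (6 ^ j * ((n div 4) choose j))"
    using Suc by (intro mult_mono) auto
  also have "\<dots> = 6 ^ Suc j * ((n div 4 - j) * ((n div 4) choose j))" by simp
  finally have "Suc j * (n choose Suc j) \<le> 6 ^ Suc j * (Suc j * ((n div 4) choose Suc j))"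
    by (simp only: binomial_step)
  also have "\<dots> = Suc j * (6 ^ Suc j * ((n div 4) choose Suc j))" by (simp only: mult_ac)
  finally show ?case by (rule iffD1[OF mult_le_cancel1, THEN mp]) simp
qed simp

text \<open>A single term of the exponential series at \<open>d\<close>, with
  \<open>exp 1 \<le> 3\<close>.\<close>

lemma power_self_le_fact: "real d ^ d \<le> 3 ^ d * fact d"
proof -
  have "real d ^ d / fact d \<le> exp (real d)"
    using sum_le_suminf[OF summable_exp[of "real d"], of "{d}"]
    by (simp add: exp_def scaleR_conv_of_real divide_inverse mult.commute)
  also have "\<dots> = exp 1 ^ d" by (simp add: exp_of_nat_mult[symmetric])
  also have "\<dots> \<le> 3 ^ d" by (intro power_mono exp_le) simp
  finally show ?thesis by (simp add: divide_le_eq)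
qed

section \<open>From global sets to spread functions\<close>

lemma mu_eq: "A \<subseteq> Sym n \<Longrightarrow> mu n A = card A / fact n"
  by (simp add: mu_def measure_pmf_of_set Sym_nonempty card_Sym Int_absorb1)

lemma sum_indicator_Sym: "A \<subseteq> Sym n \<Longrightarrow> (\<Sum>s\<in>Sym n. indicator A s :: real) = card A"
  by (simp add: indicator_def sum.If_cases Int_absorb1)

lemma umvirate_eq_cls:
  assumes "finite S"
  shows "umvirate n (sorted_list_of_set S) (map s (sorted_list_of_set S)) = cls n S s"
proof -
  have "(\<forall>k < length (sorted_list_of_set S). r (sorted_list_of_set S ! k) = map s (sorted_list_of_set S) ! k)
     \<longleftrightarrow> (\<forall>x\<in>set (sorted_list_of_set S). r x = s x)" for r
    by (auto simp: all_set_conv_all_nth)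
  then show ?thesis using assms unfolding umvirate_def cls_def by simp
qed

lemma Lnorm_nonneg: "0 \<le> Lnorm p U f"
  by (simp add: Lnorm_def)

text \<open>Squaring the norm bound and using that an indicator equals its square turns
  \<open>r\<close> into \<open>r\<^sup>2\<close>. The required tuples are the sorted list of
  \<open>S\<close> and its image under \<open>s\<close>.\<close>

lemma spread_indicator:
  assumes A: "A \<subseteq> Sym n" and r: "0 < r" and glob: "global_set n r A"
  shows "spread n (r\<^sup>2) (mu n A) (indicator A)"
  unfolding spread_def
proof (intro ballI conjI allI impI)
  fix s S assume s: "s \<in> Sym n" and S: "S \<subseteq> {1..n}"
  have fin: "finite S" using S by (rule finite_subset_interval)
  let ?f = "indicator A :: (nat \<Rightarrow> nat) \<Rightarrow> real"
  let ?I = "sorted_list_of_set S"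
  have sq: "(?f q)\<^sup>2 = ?f q" for q by (simp add: indicator_def)
  have "distinct (map s ?I)" using inj_on_subset[OF Sym_inj[OF s] subset_UNIV] by (simp add: distinct_map)
  then have "?I \<in> tuples n (card S)" "map s ?I \<in> tuples n (card S)"
    using S fin Sym_image_subset[OF s S] by (auto simp: tuples_def)
  then have "Lnorm 2 (umvirate n ?I (map s ?I)) ?f \<le> r ^ card S * Lnorm 2 (Sym n) ?f"
    using glob unfolding global_set_def global_fun_def global_with_def by blast
  then have "(Lnorm 2 (cls n S s) ?f)\<^sup>2 \<le> (r ^ card S * Lnorm 2 (Sym n) ?f)\<^sup>2"
    unfolding umvirate_eq_cls[OF fin] by (intro power_mono Lnorm_nonneg)
  moreover have "(Lnorm 2 (cls n S s) ?f)\<^sup>2 = CE n S ?f s"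
    using cls_self[OF s, of S] by (subst Lnorm_2_sq) (auto simp: sq CE_def card_cls[OF S s])
  moreover have "(Lnorm 2 (Sym n) ?f)\<^sup>2 = mu n A"
    using A by (subst Lnorm_2_sq) (auto simp: sq mu_eq card_Sym Sym_nonempty sum_indicator_Sym)
  ultimately show "CE n S ?f s \<le> (r\<^sup>2) ^ card S * mu n A"
    by (simp add: power_mult_distrib power_mult[symmetric] mult.commute)
qed (auto simp: indicator_def)

text \<open>The average of the conditional bounds over the value at a single point cannot be less
  than the mean.\<close>

lemma spread_radius_ge_1:
  assumes n: "0 < n" and f: "spread n R \<gamma> f" and \<gamma>: "0 < \<gamma>" "CE n {} f id = \<gamma>"
  shows "1 \<le> R"
proof -
  have "\<gamma> = CE n {} (CE n {1} f) id"
    using \<gamma>(2) n by (subst CE_tower) (auto simp: Sym_id)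
  also have "\<dots> \<le> CE n {} (\<lambda>s. R * \<gamma>) id"
  proof (rule CE_mono)
    fix s assume "s \<in> cls n {} id"
    then have "s \<in> Sym n" by (rule cls_subset)
    moreover have "{1} \<subseteq> {1..n}" using n by simp
    ultimately have "CE n {1} f s \<le> R ^ card {1 :: nat} * \<gamma>"
      using f unfolding spread_def by blast
    then show "CE n {1} f s \<le> R * \<gamma>" by simp
  qed
  also have "\<dots> = R * \<gamma>" by (simp add: CE_const Sym_id)
  finally show ?thesis using \<gamma>(1) by simp
qed

theorem theorem1p8:
  "\<exists>C::real. C > 0 \<and>
     (\<forall>(n::nat) (r::real) (A::(nat \<Rightarrow> nat) set) (d::nat).
        n > 0 \<longrightarrow> r > 0 \<longrightarrow> A \<subseteq> Sym n \<longrightarrow> A \<noteq> {} \<longrightarrow> global_set n r A \<longrightarrow>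
        real d \<le> min (1 / 8 * ln (1 / mu n A)) (real n / 10 ^ 5) \<longrightarrow>
        (Lnorm 2 (Sym n) (level n (int d) (indicator A)))\<^sup>2
          \<le> (mu n A)\<^sup>2 * (C * r ^ 4 * (1 / real d) * ln (1 / mu n A)) ^ d)"
\<comment> \<open>The constant is 12 * 2000 * 3: the factor 12 = 2 * 6 from
  \<open>level_norm_le_wt\<close> and \<open>choose_ratio\<close>, 2000 from
  \<open>level_bound\<close>, and 3 from replacing \<open>1 / fact d\<close> by a power of
  \<open>1 / d\<close>.\<close>
proof (intro exI[of _ 72000] conjI allI impI)
  fix n :: nat and r :: real and A :: "(nat \<Rightarrow> nat) set" and d :: nat
  assume n: "n > 0" and r: "r > 0" and A: "A \<subseteq> Sym n" and ne: "A \<noteq> {}" and glob: "global_set n r A"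
    and d: "real d \<le> min (1 / 8 * ln (1 / mu n A)) (real n / 10 ^ 5)"
  define L where "L = ln (1 / mu n A)"
  define f where "f = (indicator A :: (nat \<Rightarrow> nat) \<Rightarrow> real)"
  define g where "g = level n (int d) f"
  define m where "m = n div 4"
  have finA: "finite A" using A finite_Sym by (rule finite_subset)
  have mu: "0 < mu n A" using finA ne by (simp add: mu_eq[OF A] card_gt_0_iff)
  have Ld: "8 * real d \<le> L" using d by (simp add: L_def)
  have L0: "0 \<le> L" using Ld by simp
  have "real (100000 * d) \<le> real n" using d by simp
  then have nd: "100000 * d \<le> n" by (simp only: of_nat_le_iff)
  have spr: "spread n (r\<^sup>2) (mu n A) f" unfolding f_def by (rule spread_indicator[OF A r glob])
  have "CE n {} f id = mu n A"
    using A by (simp add: CE_empty f_def mu_eq sum_indicator_Sym)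
  then have R1: "1 \<le> r\<^sup>2" by (rule spread_radius_ge_1[OF n spr mu])
  define \<beta> where "\<beta> = (mu n A)\<^sup>2 * (r\<^sup>2) ^ (2 * d) * 2000 ^ d * L ^ d / fact d"
  have \<beta>0: "0 \<le> \<beta>" using L0 by (simp add: \<beta>_def)
  have m2: "2 * m \<le> n" and m4: "4 * m \<le> n" by (simp_all add: m_def)
  obtain u p where up: "low_orth n u (Suc d)" "low_span n d p" "\<And>q. f q - g q = u q + p q"
    using level_decomposition(3)[of n d f] unfolding g_def by blast
  have "real (m choose d) * ((\<Sum>s\<in>Sym n. (g s)\<^sup>2) / fact n) \<le> real (n choose d) * 2 ^ d * \<beta>"
  proof (rule level_norm_le_wt[OF _ _ up m2])
    show "low_span n (Suc d) g" "low_orth n g d" unfolding g_def by (rule level_decomposition)+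
    fix th assume th: "th \<in> Sym n"
    have "wt n m {} {1..m} d (\<lambda>r. f (r \<circ> inv th)) id
      \<le> ((r\<^sup>2) ^ card ({} :: nat set) * mu n A)\<^sup>2 * (r\<^sup>2) ^ (2 * d) * 2000 ^ d * L ^ d / fact d"
      by (rule level_bound[OF R1 mu L_def m4 spread_right[OF spr Sym_inv[OF th]]])
         (use nd Ld in \<open>auto simp: Sym_id\<close>)
    then show "wt n m {} {1..m} d (\<lambda>r. f (r \<circ> inv th)) id \<le> \<beta>" by (simp add: \<beta>_def)
  qed
  also have "\<dots> \<le> (6 ^ d * real (m choose d)) * 2 ^ d * \<beta>"
  proof (intro mult_right_mono)
    have "real (n choose d) \<le> real (6 ^ d * (m choose d))"
      using choose_ratio[OF nd, of d] unfolding m_def by (simp only: of_nat_le_iff)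
    then show "real (n choose d) \<le> 6 ^ d * real (m choose d)" by simp
  qed (use \<beta>0 in simp_all)
  also have "\<dots> = real (m choose d) * (12 ^ d * \<beta>)"
  proof -
    have "(12::real) ^ d = 6 ^ d * 2 ^ d" by (simp flip: power_mult_distrib)
    then show ?thesis by (simp only: mult_ac)
  qed
  finally have "real (m choose d) * ((\<Sum>s\<in>Sym n. (g s)\<^sup>2) / fact n) \<le> real (m choose d) * (12 ^ d * \<beta>)" .
  moreover have "0 < real (m choose d)" using nd by (simp add: m_def zero_less_binomial_iff)
  ultimately have "(\<Sum>s\<in>Sym n. (g s)\<^sup>2) / fact n \<le> 12 ^ d * \<beta>" by (rule mult_left_le_imp_le)
  moreover have "(Lnorm 2 (Sym n) g)\<^sup>2 = (\<Sum>s\<in>Sym n. (g s)\<^sup>2) / fact n"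
    by (simp add: Lnorm_2_sq Sym_nonempty card_Sym)
  moreover have "12 ^ d * \<beta> \<le> (mu n A)\<^sup>2 * (72000 * r ^ 4 * (1 / real d) * L) ^ d"
  \<comment> \<open>At \<open>d = 0\<close> the quotient \<open>1 / real d\<close> is 0 by
    convention, but the power is 1 and both sides equal \<open>(mu n A)\<^sup>2\<close>.\<close>
  proof (cases "d = 0")
    case True
    then show ?thesis by (simp add: \<beta>_def)
  next
    case False
    have f: "1 / fact d \<le> 3 ^ d * (1 / real d) ^ d"
      using power_self_le_fact[of d] False by (simp add: power_divide field_simps)
    have "12 ^ d * \<beta> = (mu n A)\<^sup>2 * (24000 * r ^ 4 * L) ^ d * (1 / fact d)"
    proof -
      have "(24000::real) ^ d = 12 ^ d * 2000 ^ d" by (simp flip: power_mult_distrib)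
      moreover have "(r\<^sup>2) ^ (2 * d) = (r ^ 4) ^ d" by (simp flip: power_mult)
      ultimately show ?thesis by (simp add: \<beta>_def power_mult_distrib)
    qed
    also have "\<dots> \<le> (mu n A)\<^sup>2 * (24000 * r ^ 4 * L) ^ d * (3 ^ d * (1 / real d) ^ d)"
      using L0 r by (intro mult_left_mono f) auto
    also have "\<dots> = (mu n A)\<^sup>2 * ((24000 * r ^ 4 * L) * 3 * (1 / real d)) ^ d"
      by (simp only: power_mult_distrib mult.assoc)
    also have "(24000 * r ^ 4 * L) * 3 * (1 / real d) = 72000 * r ^ 4 * (1 / real d) * L" by simp
    finally show ?thesis .
  qed
  ultimately show "(Lnorm 2 (Sym n) (level n (int d) (indicator A)))\<^sup>2
      \<le> (mu n A)\<^sup>2 * (72000 * r ^ 4 * (1 / real d) * ln (1 / mu n A)) ^ d"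
    unfolding g_def f_def L_def by simp
qed simp

end
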